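(* Let $\mathcal F$ be a saturated fusion system on a finite $p$-group $S$. The only idempotents of $A(\mathcal F)_{(p)}$ are $0$ and the $1$-element $[S/S]$. Hence $A^{\mathrm{char}}(\mathcal F)_{(p)}$ has exactly one non-zero idempotent, and therefore the characteristic idempotent of $\mathcal F$ (an idempotent of $A(S,S)_{(p)}$ that is $\mathcal F$-characteristic) is unique.
   Context: Here $p$ is a prime and $p$-groups are finite. A fusion system $\mathcal F$ on a $p$-group $S$ is a category whose objects are the subgroups of $S$, whose morphism sets $\mathcal F(P,Q)=\mathrm{Hom}_{\mathcal F}(P,Q)$ consist of injective group homomorphisms $P\to Q$ (composed as homomorphisms) and contain all homomorphisms $P\to Q$ induced by conjugation by elements of $S$, and such that for each $\varphi\in\mathcal F(P,Q)$ the isomorphism $\varphi\colon P\to\varphi P$ and its inverse are morphisms of $\mathcal F$. Write $\mathrm{Aut}_{\mathcal F}(P)=\mathcal F(P,P)$. Subgroups $P,Q$ are $\mathcal F$-conjugate ($P\sim_{\mathcal F}Q$) if they are isomorphic in $\mathcal F$; $[P]_{\mathcal F}$ is the set of $\mathcal F$-conjugates of $P$. $P$ is fully $\mathcal F$-normalized (resp. fully $\mathcal F$-centralized) if $|N_SP|\ge|N_SQ|$ (resp. $|C_SP|\ge|C_SQ|$) for all $Q\in[P]_{\mathcal F}$. $\mathcal F$ is saturated if for all $P\le S$: (1) if $P$ is fully $\mathcal F$-normalized, then $P$ is fully $\mathcal F$-centralized and $\mathrm{Aut}_S(P)$ is a Sylow $p$-subgroup of $\mathrm{Aut}_{\mathcal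 F}(P)$; (2) every $\varphi\in\mathcal F(P,S)$ with $\varphi(P)$ fully $\mathcal F$-centralized extends to a morphism in $\mathcal F(N_\varphi,S)$, where $N_\varphi=\{x\in N_S(P)\mid \exists y\in S:\varphi\circ c_x=c_y\circ\varphi\}$. $A(S)$ is the Burnside ring of $S$, $\Phi_Q$ the ring homomorphism counting $Q$-fixed points, $(p)$ denotes tensoring with $\mathbb Z_{(p)}$. $X\in A(S)_{(p)}$ is $\mathcal F$-stable if for all $P\le S$ and $\varphi\in\mathcal F(P,S)$ the restrictions of $X$ to $A(P)_{(p)}$ along $\varphi$ and along the inclusion agree; equivalently, $\Phi_P(X)=\Phi_Q(X)$ whenever $P\sim_{\mathcal F}Q$. $A(\mathcal F)_{(p)}$ is the subring of $\mathcal F$-stable elements of $A(S)_{(p)}$. Bisets: for finite groups $G,H$, a $(G,H)$-biset is a finite set with commuting right $G$-action and left $H$-action, regarded as a left $(H\times G)$-set via $(h,g).x=hxg^{-1}$. $A(G,H)$ is the Grothendieck group of isomorphism classes of $(G,H)$-bisets under disjoint union. Composition $\circ\colon A(H,K)\times A(G,H)\to A(G,K)$ is induced by $Y\circ X=Y\times_HX$. For $U\le G$ and a homomorphism $\varphi\colon U\to H$, $\Delta(U,\varphi)=\{(\varphi(u),u)\mid u\in U\}\le H\times G$ and $[U,\varphi]_G^H=[(H\times G)/\Delta(U,\varphi)]$. $X\in A(S,S)_{(p)}$ is $\mathcal F$-generated if it is a $\mathbb Z_{(p)}$-linear combination of elements $[P,\varphi]_S^S$ with $P\le S$, $\varphi\in\mathcal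 F(P,S)$. It is $\mathcal F$-stable if $X\circ[P,\varphi]_P^S=X\circ[P,\mathrm{id}]_P^S$ and $[\varphi P,\varphi^{-1}]_S^P\circ X=[P,\mathrm{id}]_S^P\circ X$ for all $P\le S$, $\varphi\in\mathcal F(P,S)$. It is $\mathcal F$-characteristic if it is $\mathcal F$-generated, $\mathcal F$-stable, and $\varepsilon(X)$ is invertible in $\mathbb Z_{(p)}$, where $\varepsilon$ is the $\mathbb Z_{(p)}$-linear extension of $X\mapsto|X|/|S|$ to the span of left-free bisets. $A^{\mathrm{char}}(\mathcal F)_{(p)}$ is the subring (under $\circ$) of $A(S,S)_{(p)}$ of all elements that are both $\mathcal F$-generated and $\mathcal F$-stable. *)

theory Defs
  imports Complex_Main "HOL-Algebra.Group_Action" "HOL-Algebra.Left_Coset" "HOL-Algebra.QuotRing"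
    "HOL-Computational_Algebra.Primes" "HOL-Library.Poly_Mapping"
begin

section \<open>Saturated fusion systems\<close>

definition conj_map :: "'a monoid \<Rightarrow> 'a \<Rightarrow> 'a \<Rightarrow> 'a"
  where "conj_map S x u = x \<otimes>\<^bsub>S\<^esub> u \<otimes>\<^bsub>S\<^esub> inv\<^bsub>S\<^esub> x"

definition centralizer :: "'a monoid \<Rightarrow> 'a set \<Rightarrow> 'a set"
  where "centralizer S P = {x \<in> carrier S. \<forall>u\<in>P. x \<otimes>\<^bsub>S\<^esub> u = u \<otimes>\<^bsub>S\<^esub> x}"

definition sylow_subgroup :: "nat \<Rightarrow> 'g set \<Rightarrow> 'g monoid \<Rightarrow> bool"
  where "sylow_subgroup p H G \<longleftrightarrow>
    subgroup H G \<and> (\<exists>a m. card H = p ^ a \<and> order G = p ^ a * m \<and> \<not> p dvd m)"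

locale p_group = group S for S :: "'a monoid" (structure) +
  fixes p :: nat
  assumes prime: "Factorial_Ring.prime p"
    and order_power: "\<exists>n. order S = p ^ n"

text \<open>\<open>F P Q\<close> is the set of morphisms from \<open>P\<close> to \<open>Q\<close>, for subgroups \<open>P\<close> and \<open>Q\<close> of \<open>S\<close> (it is
  never used for other arguments). Morphisms are extensional functions, so that equality
  of morphisms is equality of HOL functions. Identities are conjugations by \<open>\<one>\<close>.\<close>

locale fusion_system = p_group S p for S :: "'a monoid" (structure) and p +
  fixes F :: "'a set \<Rightarrow> 'a set \<Rightarrow> ('a \<Rightarrow> 'a) set"
  assumes mor_mon: "\<lbrakk>subgroup P S; subgroup Q S; \<phi> \<in> F P Q\<rbrakk>
      \<Longrightarrow> \<phi> \<in> extensional P \<and> \<phi> \<in> mon (S\<lparr>carrier := P\<rparr>) (S\<lparr>carrier := Q\<rparr>)"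
    and mor_conj: "\<lbrakk>subgroup P S; subgroup Q S; x \<in> carrier S; conj_map S x ` P \<subseteq> Q\<rbrakk>
      \<Longrightarrow> restrict (conj_map S x) P \<in> F P Q"
    and mor_compose: "\<lbrakk>subgroup P S; subgroup Q S; subgroup R S; \<phi> \<in> F P Q; \<psi> \<in> F Q R\<rbrakk>
      \<Longrightarrow> compose P \<psi> \<phi> \<in> F P R"
    and mor_image: "\<lbrakk>subgroup P S; subgroup Q S; \<phi> \<in> F P Q\<rbrakk> \<Longrightarrow> \<phi> \<in> F P (\<phi> ` P)"
    and mor_inverse: "\<lbrakk>subgroup P S; subgroup Q S; \<phi> \<in> F P Q\<rbrakk>
      \<Longrightarrow> restrict (inv_into P \<phi>) (\<phi> ` P) \<in> F (\<phi> ` P) P"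
begin

definition conjugates :: "'a set \<Rightarrow> 'a set set"
  where "conjugates P = {Q. subgroup Q S \<and>
    (\<exists>\<phi>\<in>F P Q. \<exists>\<psi>\<in>F Q P. compose P \<psi> \<phi> = (\<lambda>u\<in>P. u) \<and> compose Q \<phi> \<psi> = (\<lambda>u\<in>Q. u))}"

definition fully_normalized :: "'a set \<Rightarrow> bool"
  where "fully_normalized P \<longleftrightarrow> (\<forall>Q\<in>conjugates P. card (normalizer S P) \<ge> card (normalizer S Q))"

definition fully_centralized :: "'a set \<Rightarrow> bool"
  where "fully_centralized P \<longleftrightarrow> (\<forall>Q\<in>conjugates P. card (centralizer S P) \<ge> card (centralizer S Q))"

definition Aut_F :: "'a set \<Rightarrow> ('a \<Rightarrow> 'a) monoid"
  where "Aut_F P = (BijGroup P)\<lparr>carrier := F P P\<rparr>"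

definition Aut_S :: "'a set \<Rightarrow> ('a \<Rightarrow> 'a) set"
  where "Aut_S P = (\<lambda>x. restrict (conj_map S x) P) ` normalizer S P"

definition extender :: "'a set \<Rightarrow> ('a \<Rightarrow> 'a) \<Rightarrow> 'a set"  \<comment> \<open>\<open>N\<close> with index \<open>\<phi>\<close>\<close>
  where "extender P \<phi> = {x \<in> normalizer S P. \<exists>y\<in>carrier S.
    \<forall>u\<in>P. \<phi> (conj_map S x u) = conj_map S y (\<phi> u)}"

end

locale saturated_fusion_system = fusion_system S p F
  for S :: "'a monoid" (structure) and p F +
  assumes sylow: "\<lbrakk>subgroup P S; fully_normalized P\<rbrakk>
      \<Longrightarrow> fully_centralized P \<and> sylow_subgroup p (Aut_S P) (Aut_F P)"
    and extension: "\<lbrakk>subgroup P S; \<phi> \<in> F P (carrier S); fully_centralized (\<phi> ` P)\<rbrakk>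
      \<Longrightarrow> \<exists>\<psi>\<in>F (extender P \<phi>) (carrier S). \<forall>u\<in>P. \<psi> u = \<phi> u"


section \<open>Finite \<open>G\<close>-sets\<close>

type_synonym ('g, 'x) gset = "'x set \<times> ('g \<Rightarrow> 'x \<Rightarrow> 'x)"

definition gset_iso :: "'g monoid \<Rightarrow> ('g, 'x) gset \<Rightarrow> ('g, 'y) gset \<Rightarrow> bool"
  where "gset_iso G X Y \<longleftrightarrow> (\<exists>f. bij_betw f (fst X) (fst Y) \<and>
    (\<forall>g\<in>carrier G. \<forall>x\<in>fst X. f (snd X g x) = snd Y g (f x)))"

text \<open>Every finite \<open>G\<close>-set is isomorphic to one whose points are natural numbers, so the
  isomorphism class of a \<open>G\<close>-set over any type can be recorded by its models on sets of
  natural numbers.\<close>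

definition finite_gsets :: "'g monoid \<Rightarrow> ('g, nat) gset set"
  where "finite_gsets G = {X. finite (fst X) \<and> group_action G (fst X) (snd X)}"

definition iso_class :: "'g monoid \<Rightarrow> ('g, 'x) gset \<Rightarrow> ('g, nat) gset set"
  where "iso_class G X = {Y \<in> finite_gsets G. gset_iso G X Y}"

definition iso_classes :: "'g monoid \<Rightarrow> ('g, nat) gset set set"
  where "iso_classes G = iso_class G ` finite_gsets G"

definition gset_union :: "('g, 'x) gset \<Rightarrow> ('g, 'y) gset \<Rightarrow> ('g, 'x + 'y) gset"
  where "gset_union X Y =
    (fst X <+> fst Y, \<lambda>g. restrict (map_sum (snd X g) (snd Y g)) (fst X <+> fst Y))"

definition gset_prod :: "('g, 'x) gset \<Rightarrow> ('g, 'y) gset \<Rightarrow> ('g, 'x \<times> 'y) gset"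
  where "gset_prod X Y =
    (fst X \<times> fst Y, \<lambda>g. restrict (map_prod (snd X g) (snd Y g)) (fst X \<times> fst Y))"

definition coset_gset :: "'g monoid \<Rightarrow> 'g set \<Rightarrow> ('g, 'g set) gset"
  where "coset_gset G D = (lcosets\<^bsub>G\<^esub> D, \<lambda>g. \<lambda>C\<in>lcosets\<^bsub>G\<^esub> D. g <#\<^bsub>G\<^esub> C)"

definition gset_res :: "('h \<Rightarrow> 'g) \<Rightarrow> ('g, 'x) gset \<Rightarrow> ('h, 'x) gset"
  where "gset_res \<alpha> X = (fst X, \<lambda>h. snd X (\<alpha> h))"


section \<open>\<open>p\<close>-localized Burnside rings\<close>

definition Z_loc :: "nat \<Rightarrow> rat set"
  where "Z_loc p = {of_int a / of_int b | a b :: int. \<not> int p dvd b}"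

definition linear_ext :: "('x \<Rightarrow> 'z) \<Rightarrow> ('x \<Rightarrow>\<^sub>0 rat) \<Rightarrow> ('z \<Rightarrow>\<^sub>0 rat)"
  where "linear_ext h f =
    (\<Sum>x\<in>Poly_Mapping.keys f. Poly_Mapping.single (h x) (Poly_Mapping.lookup f x))"

definition bilinear_ext ::
    "('x \<Rightarrow> 'y \<Rightarrow> 'z) \<Rightarrow> ('x \<Rightarrow>\<^sub>0 rat) \<Rightarrow> ('y \<Rightarrow>\<^sub>0 rat) \<Rightarrow> ('z \<Rightarrow>\<^sub>0 rat)"
  where "bilinear_ext h f g = (\<Sum>x\<in>Poly_Mapping.keys f. \<Sum>y\<in>Poly_Mapping.keys g.
    Poly_Mapping.single (h x y) (Poly_Mapping.lookup f x * Poly_Mapping.lookup g y))"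

text \<open>The Grothendieck group of the isomorphism classes of finite \<open>G\<close>-sets is the free abelian
  group on the classes modulo the relations \<open>[X \<squnion> Y] = [X] + [Y]\<close>. Tensoring this presentation
  with the localization \<open>Z_loc p\<close> of the integers gives the free \<open>Z_loc p\<close>-module on the classes
  modulo the \<open>Z_loc p\<close>-span of the relations. The free module is a ring by Cartesian
  product. Operations on isomorphism classes, and on cosets below, are written as unions over
  all representatives; as in \<^const>\<open>FactRing\<close>, the sets united are all equal.\<close>

definition gset_ring :: "nat \<Rightarrow> 'g monoid \<Rightarrow> (('g, nat) gset set \<Rightarrow>\<^sub>0 rat) ring"
  where "gset_ring p G =
    \<lparr>carrier = {f. Poly_Mapping.keys f \<subseteq> iso_classes G \<and> range (Poly_Mapping.lookup f) \<subseteq> Z_loc p},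
     monoid.mult = bilinear_ext (\<lambda>x y. \<Union>X\<in>x. \<Union>Y\<in>y. iso_class G (gset_prod X Y)),
     one = Poly_Mapping.single (iso_class G (coset_gset G (carrier G))) 1,
     zero = 0,
     add = (+)\<rparr>"

inductive_set gset_rel :: "nat \<Rightarrow> 'g monoid \<Rightarrow> (('g, nat) gset set \<Rightarrow>\<^sub>0 rat) set"
  for p :: nat and G :: "'g monoid"
  where
    zero: "0 \<in> gset_rel p G"
  | step: "\<lbrakk>f \<in> gset_rel p G; X \<in> finite_gsets G; Y \<in> finite_gsets G; c \<in> Z_loc p\<rbrakk>
      \<Longrightarrow> f + (Poly_Mapping.single (iso_class G (gset_union X Y)) c
            - Poly_Mapping.single (iso_class G X) c
            - Poly_Mapping.single (iso_class G Y) c) \<in> gset_rel p G"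

definition burnside_coset ::
    "nat \<Rightarrow> 'g monoid \<Rightarrow> (('g, nat) gset set \<Rightarrow>\<^sub>0 rat) \<Rightarrow> (('g, nat) gset set \<Rightarrow>\<^sub>0 rat) set"
  where "burnside_coset p G f = gset_rel p G +>\<^bsub>gset_ring p G\<^esub> f"

definition burnside_ring :: "nat \<Rightarrow> 'g monoid \<Rightarrow> (('g, nat) gset set \<Rightarrow>\<^sub>0 rat) set ring"
  where "burnside_ring p G = gset_ring p G Quot gset_rel p G"

definition burnside_class ::
    "nat \<Rightarrow> 'g monoid \<Rightarrow> ('g, 'x) gset \<Rightarrow> (('g, nat) gset set \<Rightarrow>\<^sub>0 rat) set"
  where "burnside_class p G X = burnside_coset p G (Poly_Mapping.single (iso_class G X) 1)"

definition burnside_res :: "nat \<Rightarrow> 'h monoid \<Rightarrow> ('h \<Rightarrow> 'g) \<Rightarrow>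
    (('g, nat) gset set \<Rightarrow>\<^sub>0 rat) set \<Rightarrow> (('h, nat) gset set \<Rightarrow>\<^sub>0 rat) set"
  where "burnside_res p H \<alpha> A =
    (\<Union>f\<in>A. burnside_coset p H (linear_ext (\<lambda>x. \<Union>X\<in>x. iso_class H (gset_res \<alpha> X)) f))"

definition stable_burnside :: "nat \<Rightarrow> 'a monoid \<Rightarrow> ('a set \<Rightarrow> 'a set \<Rightarrow> ('a \<Rightarrow> 'a) set) \<Rightarrow>
    (('a, nat) gset set \<Rightarrow>\<^sub>0 rat) set ring"
  where "stable_burnside p S F = (burnside_ring p S)
    \<lparr>carrier := {A \<in> carrier (burnside_ring p S).
      \<forall>P. subgroup P S \<longrightarrow> (\<forall>\<phi>\<in>F P (carrier S).
        burnside_res p (S\<lparr>carrier := P\<rparr>) \<phi> A = burnside_res p (S\<lparr>carrier := P\<rparr>) (\<lambda>u. u) A)}\<rparr>"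


section \<open>Bisets and the double Burnside ring\<close>

text \<open>A \<open>(G, H)\<close>-biset is a finite left \<open>H \<times>\<times> G\<close>-set \<open>X\<close>, where \<open>h x = (h, \<one>) \<cdot> x\<close> and
  \<open>x g = (\<one>, inv g) \<cdot> x\<close>. Thus the additive group of \<open>burnside_ring p (H \<times>\<times> G)\<close> is the
  \<open>p\<close>-localized double Burnside module of \<open>(G, H)\<close>-bisets; its Cartesian multiplication
  plays no role here.\<close>

type_synonym ('h, 'g) dburnside = "(('h \<times> 'g, nat) gset set \<Rightarrow>\<^sub>0 rat) set"

definition tensor_rel :: "'g monoid \<Rightarrow> 'h monoid \<Rightarrow> 'k monoid \<Rightarrow>
    ('k \<times> 'h, 'y) gset \<Rightarrow> ('h \<times> 'g, 'x) gset \<Rightarrow> (('y \<times> 'x) \<times> ('y \<times> 'x)) set"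
  where "tensor_rel G H K Y X =
    {((snd Y (\<one>\<^bsub>K\<^esub>, inv\<^bsub>H\<^esub> h) y, x), (y, snd X (h, \<one>\<^bsub>G\<^esub>) x)) | y x h.
      y \<in> fst Y \<and> x \<in> fst X \<and> h \<in> carrier H}"

definition tensor :: "'g monoid \<Rightarrow> 'h monoid \<Rightarrow> 'k monoid \<Rightarrow>
    ('k \<times> 'h, 'y) gset \<Rightarrow> ('h \<times> 'g, 'x) gset \<Rightarrow> ('k \<times> 'g, ('y \<times> 'x) set) gset"
  where "tensor G H K Y X =
    (let E = (fst Y \<times> fst X) // tensor_rel G H K Y X
     in (E, \<lambda>(k, g). \<lambda>C\<in>E. map_prod (snd Y (k, \<one>\<^bsub>H\<^esub>)) (snd X (\<one>\<^bsub>H\<^esub>, g)) ` C))"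

definition biset_comp :: "nat \<Rightarrow> 'g monoid \<Rightarrow> 'h monoid \<Rightarrow> 'k monoid \<Rightarrow>
    ('k, 'h) dburnside \<Rightarrow> ('h, 'g) dburnside \<Rightarrow> ('k, 'g) dburnside"
  where "biset_comp p G H K B A = (\<Union>b\<in>B. \<Union>a\<in>A. burnside_coset p (K \<times>\<times> G)
    (bilinear_ext (\<lambda>y x. \<Union>Y\<in>y. \<Union>X\<in>x. iso_class (K \<times>\<times> G) (tensor G H K Y X)) b a))"

definition twisted_diagonal :: "'g set \<Rightarrow> ('g \<Rightarrow> 'h) \<Rightarrow> ('h \<times> 'g) set"
  where "twisted_diagonal U \<phi> = {(\<phi> u, u) | u. u \<in> U}"

definition transitive_biset :: "'g monoid \<Rightarrow> 'h monoid \<Rightarrow> 'g set \<Rightarrow> ('g \<Rightarrow> 'h) \<Rightarrow>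
    ('h \<times> 'g, ('h \<times> 'g) set) gset"
  where "transitive_biset G H U \<phi> = coset_gset (H \<times>\<times> G) (twisted_diagonal U \<phi>)"

definition biset_class :: "nat \<Rightarrow> 'g monoid \<Rightarrow> 'h monoid \<Rightarrow> 'g set \<Rightarrow> ('g \<Rightarrow> 'h) \<Rightarrow> ('h, 'g) dburnside"
  where "biset_class p G H U \<phi> = burnside_class p (H \<times>\<times> G) (transitive_biset G H U \<phi>)"

definition double_burnside_ring :: "nat \<Rightarrow> 'a monoid \<Rightarrow> ('a, 'a) dburnside ring"
  where "double_burnside_ring p S = (burnside_ring p (S \<times>\<times> S))
    \<lparr>monoid.mult := biset_comp p S S S, one := biset_class p S S (carrier S) (\<lambda>u. u)\<rparr>"

definition biset_generated :: "nat \<Rightarrow> 'a monoid \<Rightarrow> ('a set \<Rightarrow> 'a set \<Rightarrow> ('a \<Rightarrow> 'a) set) \<Rightarrow>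
    ('a, 'a) dburnside \<Rightarrow> bool"
  where "biset_generated p S F A \<longleftrightarrow> (\<exists>f. range (Poly_Mapping.lookup f) \<subseteq> Z_loc p \<and>
    Poly_Mapping.keys f \<subseteq> {iso_class (S \<times>\<times> S) (transitive_biset S S P \<phi>) | P \<phi>.
      subgroup P S \<and> \<phi> \<in> F P (carrier S)} \<and>
    A = burnside_coset p (S \<times>\<times> S) f)"

definition biset_stable :: "nat \<Rightarrow> 'a monoid \<Rightarrow> ('a set \<Rightarrow> 'a set \<Rightarrow> ('a \<Rightarrow> 'a) set) \<Rightarrow>
    ('a, 'a) dburnside \<Rightarrow> bool"
  where "biset_stable p S F A \<longleftrightarrow> (\<forall>P. subgroup P S \<longrightarrow> (\<forall>\<phi>\<in>F P (carrier S).
    let SP = S\<lparr>carrier := P\<rparr> in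
      biset_comp p SP S S A (biset_class p SP S P \<phi>) =
        biset_comp p SP S S A (biset_class p SP S P (\<lambda>u. u)) \<and>
      biset_comp p S S SP (biset_class p S SP (\<phi> ` P) (inv_into P \<phi>)) A =
        biset_comp p S S SP (biset_class p S SP P (\<lambda>u. u)) A))"

text \<open>The linear extension of \<open>X \<mapsto> |X| / |S|\<close> is defined here on all bisets, with rational
  values. On the span of the left-free bisets, which contains all \<open>F\<close>-generated elements, its
  values lie in \<open>Z_loc p\<close>. The sets to which \<^const>\<open>the_elem\<close> is applied are singletons.\<close>

definition augmentation :: "'a monoid \<Rightarrow> ('a, 'a) dburnside \<Rightarrow> rat"
  where "augmentation S A = the_elem ((\<lambda>f. \<Sum>x\<in>Poly_Mapping.keys f.
    Poly_Mapping.lookup f x * (of_nat (the_elem ((\<lambda>X. card (fst X)) ` x)) / of_nat (order S))) ` A)"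

definition biset_characteristic :: "nat \<Rightarrow> 'a monoid \<Rightarrow> ('a set \<Rightarrow> 'a set \<Rightarrow> ('a \<Rightarrow> 'a) set) \<Rightarrow>
    ('a, 'a) dburnside \<Rightarrow> bool"
  where "biset_characteristic p S F A \<longleftrightarrow> biset_generated p S F A \<and> biset_stable p S F A \<and>
    augmentation S A \<in> Z_loc p \<and> (\<exists>r\<in>Z_loc p. augmentation S A * r = 1)"

text \<open>In general, the unit of \<^const>\<open>double_burnside_ring\<close> is not an element of the following
  subring; the field \<^const>\<open>one\<close> of the record is irrelevant there.\<close>

definition char_burnside :: "nat \<Rightarrow> 'a monoid \<Rightarrow> ('a set \<Rightarrow> 'a set \<Rightarrow> ('a \<Rightarrow> 'a) set) \<Rightarrow>
    ('a, 'a) dburnside ring"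
  where "char_burnside p S F = (double_burnside_ring p S)
    \<lparr>carrier := {A \<in> carrier (double_burnside_ring p S). biset_generated p S F A \<and> biset_stable p S F A}\<rparr>"

definition idempotents :: "'r ring \<Rightarrow> 'r set"
  where "idempotents R = {e \<in> carrier R. e \<otimes>\<^bsub>R\<^esub> e = e}"

end

theory Submission
  imports Defs "HOL-Algebra.Generated_Groups"
begin

text \<open>An element of the localized Burnside ring of a finite group is determined by its marks, the numbers of
fixed points of the subgroups, extended linearly: every set is a disjoint union of transitive ones, and the
marks of the transitive sets form a triangular table (theorem \<open>gset_rel_iff_marks\<close>). So all statements
are turned into statements about marks.

For a \<open>p\<close>-group \<open>S\<close>, the marks of an element are all congruent modulo \<open>p\<close>, because the nontrivial
orbits of a \<open>p\<close>-group have cardinality divisible by \<open>p\<close>. The marks of an idempotent are \<open>0\<close> or \<open>1\<close>, hence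
all \<open>0\<close> or all \<open>1\<close> (lemma \<open>p_group_idempotent_marks\<close>), and the idempotent is \<open>0\<close> or \<open>1\<close>.

For bisets, the collapse \<open>X \<mapsto> S\X\<close> takes generated stable elements to the Burnside ring of \<open>S\<close>; its
marks are the numbers \<open>trace Q X\<close>. A stable \<open>X\<close> has the same mark on the graphs of all morphisms out
of \<open>Q\<close>, and a generated \<open>X\<close> has no other marks, so the collapse loses no information. It is also
multiplicative: if \<open>X\<close> is stable, then \<open>X \<circ> [P, \<phi>] = X \<circ> [P, id]\<close>, which is the Cartesian product of
\<open>X\<close> with \<open>S/P\<close> pulled back along the second projection, and \<open>S/P\<close> is the collapse of \<open>[P, \<phi>]\<close>
(theorem \<open>mark_composition\<close>). Therefore a nonzero idempotent has trace \<open>1\<close> everywhere, and its marks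
are the function \<open>char_mark\<close>: the mark is \<open>|S| / |F(Q, S)|\<close> on the graph of a morphism out of \<open>Q\<close>
(theorem \<open>characteristic_idempotent_marks\<close>). This is uniqueness.

For existence, the identity biset of \<open>S\<close> is made stable by adding multiples of transitive bisets \<open>[P, \<phi>]\<close>, in the
order of decreasing \<open>P\<close>. The multiples are \<open>p\<close>-integral because, by saturation, the normalizer of the graph
of \<open>\<phi>\<close> is carried into the normalizer of the diagonal of a fully normalized subgroup by a pair of
morphisms of the fusion system; comparing orbit counts for the two gives the divisibility (lemma
\<open>mark_defect_divisible\<close>). The trace at \<open>S\<close> of the resulting stable element is the index of \<open>Aut_S(S)\<close> in
\<open>Aut_F(S)\<close>, which is prime to \<open>p\<close>, so all its traces are units. Dividing by them stays inside the image
of the marks (lemma \<open>mark_functions_inverse\<close>) and gives the marks \<open>char_mark\<close>.\<close>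

section \<open>The localized integers and linear functionals\<close>

lemma Z_loc_iff: "r \<in> Z_loc p \<longleftrightarrow> (\<exists>a b. r = of_int a / of_int b \<and> \<not> int p dvd b)"
  by (simp add: Z_loc_def)

context
  fixes p :: nat
  assumes prime: "Factorial_Ring.prime p"
begin

lemma Z_loc_of_int [simp]: "of_int a \<in> Z_loc p"
  unfolding Z_loc_iff using prime by (intro exI[of _ a] exI[of _ 1]) (auto dest: prime_gt_1_nat)

lemma Z_loc_of_nat [simp]: "of_nat a \<in> Z_loc p"
  using Z_loc_of_int[of "int a"] by simp

lemma Z_loc_0 [simp]: "0 \<in> Z_loc p" and Z_loc_1 [simp]: "1 \<in> Z_loc p"
  using Z_loc_of_int[of 0] Z_loc_of_int[of 1] by simp_all

lemma Z_loc_add: "\<lbrakk>r \<in> Z_loc p; s \<in> Z_loc p\<rbrakk> \<Longrightarrow> r + s \<in> Z_loc p"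
proof -
  assume "r \<in> Z_loc p" "s \<in> Z_loc p"
  then obtain a b c d where r: "r = of_int a / of_int b" "\<not> int p dvd b"
    and s: "s = of_int c / of_int d" "\<not> int p dvd d" unfolding Z_loc_iff by blast
  have "b \<noteq> 0" "d \<noteq> 0" using r s by auto
  then have "r + s = of_int (a * d + c * b) / of_int (b * d)" using r s by (simp add: add_frac_eq)
  moreover have "\<not> int p dvd b * d" using r s prime by (simp add: prime_dvd_mult_iff)
  ultimately show ?thesis unfolding Z_loc_iff by blast
qed

lemma Z_loc_mult: "\<lbrakk>r \<in> Z_loc p; s \<in> Z_loc p\<rbrakk> \<Longrightarrow> r * s \<in> Z_loc p"
proof -
  assume "r \<in> Z_loc p" "s \<in> Z_loc p"
  then obtain a b c d where r: "r = of_int a / of_int b" "\<not> int p dvd b"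
    and s: "s = of_int c / of_int d" "\<not> int p dvd d" unfolding Z_loc_iff by blast
  then have "r * s = of_int (a * c) / of_int (b * d)" by simp
  moreover have "\<not> int p dvd b * d" using r s prime by (simp add: prime_dvd_mult_iff)
  ultimately show ?thesis unfolding Z_loc_iff by blast
qed

lemma Z_loc_uminus: "r \<in> Z_loc p \<Longrightarrow> - r \<in> Z_loc p"
  using Z_loc_mult[of "of_int (-1)" r] Z_loc_of_int[of "- 1"] by simp

lemma Z_loc_diff: "\<lbrakk>r \<in> Z_loc p; s \<in> Z_loc p\<rbrakk> \<Longrightarrow> r - s \<in> Z_loc p"
  using Z_loc_add[of r "- s"] Z_loc_uminus by simp

lemma Z_loc_sum: "(\<And>x. x \<in> A \<Longrightarrow> f x \<in> Z_loc p) \<Longrightarrow> sum f A \<in> Z_loc p"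
  by (induction A rule: infinite_finite_induct) (auto intro: Z_loc_add)

lemma one_not_in_p_Z_loc: "1 \<noteq> of_nat p * r" if r: "r \<in> Z_loc p"
proof
  assume eq: "1 = of_nat p * r"
  obtain a b where ab: "r = of_int a / of_int b" "\<not> int p dvd b" using r unfolding Z_loc_iff by blast
  then have "b \<noteq> 0" by auto
  with eq ab have "of_int b = (of_int (int p * a) :: rat)" by (simp add: field_simps)
  then have "b = int p * a" by (simp only: of_int_eq_iff)
  then show False using ab by simp
qed

text \<open>The numerator of \<open>m + p r\<close> is congruent modulo \<open>p\<close> to \<open>m\<close> times a denominator prime to \<open>p\<close>.\<close>

lemma Z_loc_unit:
  assumes m: "\<not> p dvd m" and r: "r \<in> Z_loc p" and u: "u = of_nat m + of_nat p * r"
  shows "u \<noteq> 0 \<and> 1 / u \<in> Z_loc p"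
proof -
  obtain a b where ab: "r = of_int a / of_int b" "\<not> int p dvd b" using r unfolding Z_loc_iff by blast
  then have b: "b \<noteq> 0" by auto
  have u': "u = of_int (int m * b + int p * a) / of_int b" using u ab b by (simp add: field_simps)
  have nd: "\<not> int p dvd int m * b + int p * a"
  proof
    assume "int p dvd int m * b + int p * a"
    then have "int p dvd int m * b" by (metis dvd_add_left_iff dvd_triv_left)
    then show False using m ab prime
      by (metis int_dvd_int_iff prime_dvd_mult_iff prime_nat_int_transfer)
  qed
  then have nz: "int m * b + int p * a \<noteq> 0" by (metis dvd_0_right)
  then have "(of_int (int m * b + int p * a) :: rat) \<noteq> 0" by (simp only: of_int_eq_0_iff not_False_eq_True)
  then have "u \<noteq> 0" using u' b by simp
  moreover have "1 / u = of_int b / of_int (int m * b + int p * a)" using u' by simp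
  ultimately show ?thesis using nd unfolding Z_loc_iff by blast
qed

end

text \<open>Invariants of formal sums are linear extensions of functions on isomorphism classes. The lemmas on
\<^const>\<open>linear_ext\<close> and \<^const>\<open>bilinear_ext\<close> carry them through restriction, product and composition.\<close>

definition lin :: "('k \<Rightarrow> rat) \<Rightarrow> ('k \<Rightarrow>\<^sub>0 rat) \<Rightarrow> rat"
  where "lin w f = (\<Sum>k\<in>Poly_Mapping.keys f. Poly_Mapping.lookup f k * w k)"

lemma lin_superset:
  "\<lbrakk>finite A; Poly_Mapping.keys f \<subseteq> A\<rbrakk> \<Longrightarrow> lin w f = (\<Sum>k\<in>A. Poly_Mapping.lookup f k * w k)"
  unfolding lin_def by (rule sum.mono_neutral_left) (auto simp: in_keys_iff)

lemma lin_zero [simp]: "lin w 0 = 0"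
  by (simp add: lin_def)

lemma lin_single [simp]: "lin w (Poly_Mapping.single k c) = c * w k"
  by (simp add: lin_def)

lemma lin_add: "lin w (f + g) = lin w f + lin w g"
proof -
  let ?A = "Poly_Mapping.keys f \<union> Poly_Mapping.keys g"
  have "lin w (f + g) = (\<Sum>k\<in>?A. Poly_Mapping.lookup (f + g) k * w k)"
    using keys_add[of f g] by (intro lin_superset) auto
  also have "\<dots> = (\<Sum>k\<in>?A. Poly_Mapping.lookup f k * w k) + (\<Sum>k\<in>?A. Poly_Mapping.lookup g k * w k)"
    by (simp add: lookup_add distrib_right sum.distrib)
  finally show ?thesis by (simp add: lin_superset[of ?A f] lin_superset[of ?A g])
qed

lemma keys_uminus_eq: "Poly_Mapping.keys (- f) = Poly_Mapping.keys (f :: 'k \<Rightarrow>\<^sub>0 rat)"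
  by (auto simp: in_keys_iff)

lemma lin_uminus: "lin w (- f) = - lin w f"
  by (simp add: lin_def keys_uminus_eq sum_negf)

lemma lin_diff: "lin w (f - g) = lin w f - lin w g"
  using lin_add[of w f "- g"] by (simp add: lin_uminus)

lemma lin_sum: "lin w (sum f A) = (\<Sum>x\<in>A. lin w (f x))"
  by (induction A rule: infinite_finite_induct) (auto simp: lin_add)

lemma lin_cong: "\<lbrakk>Poly_Mapping.keys f \<subseteq> K; \<And>k. k \<in> K \<Longrightarrow> w k = w' k\<rbrakk> \<Longrightarrow> lin w f = lin w' f"
  unfolding lin_def by (rule sum.cong) auto

lemma lin_scale: "lin (\<lambda>k. c * w k) f = c * lin w f"
  unfolding lin_def sum_distrib_left by (rule sum.cong) auto

lemma lin_sum_functional: "lin (\<lambda>k. \<Sum>i\<in>A. w i k) f = (\<Sum>i\<in>A. lin (w i) f)"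
  unfolding lin_def sum_distrib_left by (rule sum.swap)

lemma lin_linear_ext: "lin w (linear_ext h f) = lin (\<lambda>x. w (h x)) f"
  unfolding linear_ext_def lin_sum lin_single by (simp add: lin_def)

lemma lin_bilinear_ext: "lin w (bilinear_ext h f g) = lin (\<lambda>x. lin (\<lambda>y. w (h x y)) g) f"
  unfolding bilinear_ext_def lin_sum lin_single by (simp add: lin_def sum_distrib_left mult.assoc)

lemma poly_mapping_sum_singles:
  "(f :: 'k \<Rightarrow>\<^sub>0 rat) = (\<Sum>k\<in>Poly_Mapping.keys f. Poly_Mapping.single k (Poly_Mapping.lookup f k))"
proof (rule poly_mapping_eqI)
  fix j
  have "(\<Sum>k\<in>Poly_Mapping.keys f. Poly_Mapping.lookup f k when k = j) =
      (if j \<in> Poly_Mapping.keys f then Poly_Mapping.lookup f j else 0)"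
    by (simp add: when_def)
  then show "Poly_Mapping.lookup f j = Poly_Mapping.lookup (\<Sum>k\<in>Poly_Mapping.keys f. Poly_Mapping.single k (Poly_Mapping.lookup f k)) j"
    by (simp add: lookup_sum lookup_single in_keys_iff)
qed

section \<open>Finite \<open>G\<close>-sets and their isomorphism classes\<close>

text \<open>In contrast to \<^const>\<open>finite_gsets\<close>, the points may have any type; unions, products, coset spaces and
tensor products of sets of natural numbers are not sets of natural numbers.\<close>

definition is_gset :: "'g monoid \<Rightarrow> ('g, 'x) gset \<Rightarrow> bool"
  where "is_gset G X \<longleftrightarrow> finite (fst X) \<and> group_action G (fst X) (snd X)"

lemma finite_gsets_iff: "X \<in> finite_gsets G \<longleftrightarrow> is_gset G X"
  by (simp add: finite_gsets_def is_gset_def)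

lemma is_gset_finite: "is_gset G X \<Longrightarrow> finite (fst X)"
  and is_gset_action: "is_gset G X \<Longrightarrow> group_action G (fst X) (snd X)"
  by (simp_all add: is_gset_def)

lemma group_action_group: "group_action G E a \<Longrightarrow> group G"
  unfolding group_action_def group_hom_def by blast

lemma is_gset_group: "is_gset G X \<Longrightarrow> group G"
  by (rule group_action_group[OF is_gset_action])

lemma is_gset_closed: "\<lbrakk>is_gset G X; g \<in> carrier G; x \<in> fst X\<rbrakk> \<Longrightarrow> snd X g x \<in> fst X"
  by (rule group_action.element_image[OF is_gset_action _ _ refl])

lemma is_gset_mult: "\<lbrakk>is_gset G X; g \<in> carrier G; h \<in> carrier G; x \<in> fst X\<rbrakk>
    \<Longrightarrow> snd X (g \<otimes>\<^bsub>G\<^esub> h) x = snd X g (snd X h x)"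
  by (rule group_action.composition_rule[OF is_gset_action])

lemma is_gset_one: "\<lbrakk>is_gset G X; x \<in> fst X\<rbrakk> \<Longrightarrow> snd X \<one>\<^bsub>G\<^esub> x = x"
  using group_action.id_eq_one[OF is_gset_action] by (metis restrict_apply')

lemma is_gset_extensional: "\<lbrakk>is_gset G X; g \<in> carrier G\<rbrakk> \<Longrightarrow> snd X g \<in> extensional (fst X)"
  using Bij_imp_extensional[OF group_action.bij_prop0[OF is_gset_action]] .

lemma is_gset_inv: "\<lbrakk>is_gset G X; g \<in> carrier G; x \<in> fst X\<rbrakk> \<Longrightarrow> snd X (inv\<^bsub>G\<^esub> g) (snd X g x) = x"
  by (rule group_action.orbit_sym_aux[OF is_gset_action _ _ refl])

lemma is_gset_inv': "\<lbrakk>is_gset G X; g \<in> carrier G; x \<in> fst X\<rbrakk> \<Longrightarrow> snd X g (snd X (inv\<^bsub>G\<^esub> g) x) = x"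
  by (metis group.inv_closed group.inv_inv is_gset_group is_gset_inv)

lemma is_gsetI:
  assumes G: "group G" and fin: "finite E"
    and ext: "\<And>g. g \<in> carrier G \<Longrightarrow> a g \<in> extensional E"
    and cl: "\<And>g x. \<lbrakk>g \<in> carrier G; x \<in> E\<rbrakk> \<Longrightarrow> a g x \<in> E"
    and one: "\<And>x. x \<in> E \<Longrightarrow> a \<one>\<^bsub>G\<^esub> x = x"
    and mult: "\<And>g h x. \<lbrakk>g \<in> carrier G; h \<in> carrier G; x \<in> E\<rbrakk> \<Longrightarrow> a (g \<otimes>\<^bsub>G\<^esub> h) x = a g (a h x)"
  shows "is_gset G (E, a)"
proof -
  interpret group G by fact
  have bij: "a g \<in> Bij E" if g: "g \<in> carrier G" for g
  proof -
    have "bij_betw (a g) E E"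
    proof (rule bij_betw_byWitness[where f' = "a (inv\<^bsub>G\<^esub> g)"])
      show "\<forall>x\<in>E. a (inv\<^bsub>G\<^esub> g) (a g x) = x" using g one mult by (metis inv_closed l_inv)
      show "\<forall>x\<in>E. a g (a (inv\<^bsub>G\<^esub> g) x) = x" using g one mult by (metis inv_closed r_inv)
    qed (use cl g in auto)
    then show ?thesis using ext g by (simp add: Bij_def)
  qed
  have "a \<in> hom G (BijGroup E)"
  proof (rule homI)
    show "a g \<in> carrier (BijGroup E)" if "g \<in> carrier G" for g using bij that by (simp add: BijGroup_def)
    show "a (g \<otimes>\<^bsub>G\<^esub> h) = a g \<otimes>\<^bsub>BijGroup E\<^esub> a h" if "g \<in> carrier G" "h \<in> carrier G" for g h
      using that bij mult ext by (auto simp: BijGroup_def compose_def extensional_def fun_eq_iff)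
  qed
  then show ?thesis
    unfolding is_gset_def group_action_def group_hom_def group_hom_axioms_def
    using fin G group_BijGroup by auto
qed

lemma stabilizer_subgroup_gset: "\<lbrakk>is_gset G X; x \<in> fst X\<rbrakk> \<Longrightarrow> subgroup (stabilizer G (snd X) x) G"
  by (rule group_action.stabilizer_subgroup[OF is_gset_action])

lemma gset_iso_refl: "gset_iso G X X"
  unfolding gset_iso_def by (intro exI[of _ id]) auto

lemma gset_iso_sym:
  assumes X: "is_gset G X" and iso: "gset_iso G X Y" shows "gset_iso G Y X"
proof -
  obtain f where f: "bij_betw f (fst X) (fst Y)"
    and eq: "\<And>g x. \<lbrakk>g \<in> carrier G; x \<in> fst X\<rbrakk> \<Longrightarrow> f (snd X g x) = snd Y g (f x)"
    using iso unfolding gset_iso_def by blast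
  have "inv_into (fst X) f (snd Y g y) = snd X g (inv_into (fst X) f y)"
    if that: "g \<in> carrier G" "y \<in> fst Y" for g y
  proof -
    from that(2) obtain x where x: "x \<in> fst X" "y = f x" using f unfolding bij_betw_def by (metis imageE)
    show ?thesis using x that eq[OF that(1) x(1)] f is_gset_closed[OF X that(1) x(1)]
      by (metis bij_betw_inv_into_left)
  qed
  then show ?thesis unfolding gset_iso_def using bij_betw_inv_into[OF f] by blast
qed

lemma gset_iso_trans:
  assumes "gset_iso G X Y" "gset_iso G Y Z" shows "gset_iso G X Z"
proof -
  obtain f where f: "bij_betw f (fst X) (fst Y)"
    "\<And>g x. \<lbrakk>g \<in> carrier G; x \<in> fst X\<rbrakk> \<Longrightarrow> f (snd X g x) = snd Y g (f x)"
    using assms(1) unfolding gset_iso_def by blast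
  obtain f' where f': "bij_betw f' (fst Y) (fst Z)"
    "\<And>g x. \<lbrakk>g \<in> carrier G; x \<in> fst Y\<rbrakk> \<Longrightarrow> f' (snd Y g x) = snd Z g (f' x)"
    using assms(2) unfolding gset_iso_def by blast
  show ?thesis unfolding gset_iso_def
    by (rule exI[of _ "f' \<circ> f"]) (use f f' bij_betwE[OF f(1)] bij_betw_trans in auto)
qed

text \<open>This is what makes the isomorphism class of a set with points of an arbitrary type nonempty.\<close>

lemma gset_nat_model:
  assumes X: "is_gset G X" obtains Y where "Y \<in> finite_gsets G" "gset_iso G X Y"
proof -
  obtain f and n :: nat where f: "f ` fst X = {i. i < n}" "inj_on f (fst X)"
    using finite_imp_inj_to_nat_seg[OF is_gset_finite[OF X]] by blast
  let ?j = "inv_into (fst X) f"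
  let ?E = "f ` fst X"
  let ?Y = "(?E, \<lambda>g. \<lambda>y\<in>?E. f (snd X g (?j y)))"
  have "is_gset G ?Y"
  proof (rule is_gsetI)
    note j = inv_into_f_f[OF f(2)]
    fix g h x assume g: "g \<in> carrier G" and h: "h \<in> carrier G" and "x \<in> ?E"
    then obtain z where z: "z \<in> fst X" "x = f z" by blast
    show "(\<lambda>y\<in>?E. f (snd X g (?j y))) x \<in> ?E"
      using z is_gset_closed[OF X g z(1)] j by auto
    show "(\<lambda>y\<in>?E. f (snd X (g \<otimes>\<^bsub>G\<^esub> h) (?j y))) x =
        (\<lambda>y\<in>?E. f (snd X g (?j y))) ((\<lambda>y\<in>?E. f (snd X h (?j y))) x)"
      using z is_gset_closed[OF X h z(1)] j is_gset_mult[OF X g h z(1)] by auto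
  qed (use X f(2) in \<open>auto simp: is_gset_group is_gset_finite is_gset_one\<close>)
  moreover have "gset_iso G X ?Y"
    unfolding gset_iso_def by (rule exI[of _ f]) (use f X in \<open>auto simp: bij_betw_def\<close>)
  ultimately show thesis using that[of ?Y] unfolding finite_gsets_iff by blast
qed

lemma iso_class_iff: "Y \<in> iso_class G X \<longleftrightarrow> is_gset G Y \<and> gset_iso G X Y"
  by (auto simp: iso_class_def finite_gsets_iff)

lemma iso_class_eq:
  assumes "is_gset G X" "gset_iso G X Y" shows "iso_class G X = iso_class G Y"
  unfolding iso_class_def
  using gset_iso_trans[OF assms(2)] gset_iso_trans[OF gset_iso_sym[OF assms]] by auto

lemma iso_class_nonempty: "is_gset G X \<Longrightarrow> iso_class G X \<noteq> {}"
  using gset_nat_model unfolding iso_class_def by blast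

lemma iso_class_in_iso_classes: "is_gset G X \<Longrightarrow> iso_class G X \<in> iso_classes G"
  by (metis gset_nat_model iso_class_eq image_eqI iso_classes_def)

lemma iso_classesE:
  assumes "k \<in> iso_classes G"
  obtains X where "X \<in> finite_gsets G" "k = iso_class G X" "X \<in> k"
  using assms gset_iso_refl unfolding iso_classes_def iso_class_def by blast

lemma iso_class_repE:
  assumes "k \<in> iso_classes G"
  obtains X :: "('g, nat) gset" where "is_gset G X" "k = iso_class G X"
  by (rule iso_classesE[OF assms]) (simp add: finite_gsets_iff that)

text \<open>An operation on classes is a union over all representatives. It collapses to one class as soon as the
operation respects isomorphism.\<close>

lemma UN_iso_class:
  assumes X: "is_gset G X"
    and h: "\<And>Y. \<lbrakk>is_gset G Y; gset_iso G X Y\<rbrakk> \<Longrightarrow> h Y = c"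
  shows "(\<Union>Y\<in>iso_class G X. h Y) = c"
  using iso_class_nonempty[OF X] h by (auto simp: iso_class_iff)

section \<open>Weights and marks\<close>

text \<open>Summing a function of the stabilizer over the points is additive and invariant under isomorphism,
so it descends to the Grothendieck group. The number of fixed points of \<open>D\<close> is the case of the
indicator of \<open>D \<subseteq> A\<close>. Other weights occur when a composite of bisets is regarded as a function of one
of its factors.\<close>

definition orbit_weight :: "'g monoid \<Rightarrow> ('g set \<Rightarrow> rat) \<Rightarrow> ('g, 'x) gset \<Rightarrow> rat"
  where "orbit_weight G V X = (\<Sum>x\<in>fst X. V (stabilizer G (snd X) x))"

text \<open>All members of an isomorphism class have the same weight, so \<^const>\<open>the_elem\<close> is applied to a singleton.\<close>

definition class_weight :: "'g monoid \<Rightarrow> ('g set \<Rightarrow> rat) \<Rightarrow> ('g, nat) gset set \<Rightarrow> rat"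
  where "class_weight G V k = the_elem (orbit_weight G V ` k)"

definition burnside_weight :: "'g monoid \<Rightarrow> ('g set \<Rightarrow> rat) \<Rightarrow> (('g, nat) gset set \<Rightarrow>\<^sub>0 rat) \<Rightarrow> rat"
  where "burnside_weight G V f = lin (class_weight G V) f"

definition mark_weight :: "'g set \<Rightarrow> 'g set \<Rightarrow> rat"
  where "mark_weight D A = (if D \<subseteq> A then 1 else 0)"

definition mark :: "'g monoid \<Rightarrow> 'g set \<Rightarrow> (('g, nat) gset set \<Rightarrow>\<^sub>0 rat) \<Rightarrow> rat"
  where "mark G D f = burnside_weight G (mark_weight D) f"

definition fixed_points :: "'g set \<Rightarrow> ('g, 'x) gset \<Rightarrow> 'x set"
  where "fixed_points D X = {x \<in> fst X. \<forall>g\<in>D. snd X g x = x}"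

lemma orbit_weight_iso:
  assumes X: "is_gset G X" and iso: "gset_iso G X Y"
  shows "orbit_weight G V X = orbit_weight G V Y"
proof -
  obtain f where f: "bij_betw f (fst X) (fst Y)"
    and eq: "\<And>g x. \<lbrakk>g \<in> carrier G; x \<in> fst X\<rbrakk> \<Longrightarrow> f (snd X g x) = snd Y g (f x)"
    using iso unfolding gset_iso_def by blast
  have "stabilizer G (snd Y) (f x) = stabilizer G (snd X) x" if x: "x \<in> fst X" for x
    using eq[OF _ x] is_gset_closed[OF X _ x] x f unfolding stabilizer_def bij_betw_def inj_on_def
    by (metis (no_types, lifting))
  then show ?thesis
    unfolding orbit_weight_def using sum.reindex_bij_betw[OF f, of "\<lambda>y. V (stabilizer G (snd Y) y)"]
    by simp
qed

lemma class_weight_iso_class: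
  assumes X: "is_gset G X" shows "class_weight G V (iso_class G X) = orbit_weight G V X"
proof -
  have "orbit_weight G V Y = orbit_weight G V X" if "Y \<in> iso_class G X" for Y
    using orbit_weight_iso[OF X, of Y] that by (simp add: iso_class_iff)
  then have "orbit_weight G V ` iso_class G X = {orbit_weight G V X}"
    using iso_class_nonempty[OF X] by (metis image_constant_conv image_cong)
  then show ?thesis unfolding class_weight_def by simp
qed

lemma orbit_weight_mark:
  assumes X: "is_gset G X" and D: "D \<subseteq> carrier G"
  shows "orbit_weight G (mark_weight D) X = of_nat (card (fixed_points D X))"
proof -
  have "orbit_weight G (mark_weight D) X = (\<Sum>x\<in>fst X. if x \<in> fixed_points D X then 1 else 0)"
    unfolding orbit_weight_def mark_weight_def using D
    by (intro sum.cong) (auto simp: stabilizer_def fixed_points_def)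
  also have "\<dots> = of_nat (card (fst X \<inter> fixed_points D X))"
    using is_gset_finite[OF X] by (simp add: sum.If_cases)
  also have "fst X \<inter> fixed_points D X = fixed_points D X" by (auto simp: fixed_points_def)
  finally show ?thesis .
qed

lemma burnside_weight_add: "burnside_weight G V (f + g) = burnside_weight G V f + burnside_weight G V g"
  and burnside_weight_diff: "burnside_weight G V (f - g) = burnside_weight G V f - burnside_weight G V g"
  and burnside_weight_zero [simp]: "burnside_weight G V 0 = 0"
  and burnside_weight_sum: "burnside_weight G V (sum F A) = (\<Sum>i\<in>A. burnside_weight G V (F i))"
  by (simp_all add: burnside_weight_def lin_add lin_diff lin_sum)

lemma mark_add: "mark G D (f + g) = mark G D f + mark G D g"
  and mark_diff: "mark G D (f - g) = mark G D f - mark G D g"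
  and mark_zero [simp]: "mark G D 0 = 0"
  and mark_sum: "mark G D (sum F A) = (\<Sum>i\<in>A. mark G D (F i))"
  by (simp_all add: mark_def burnside_weight_add burnside_weight_diff burnside_weight_sum)

lemma burnside_weight_single:
  "is_gset G X \<Longrightarrow> burnside_weight G V (Poly_Mapping.single (iso_class G X) c) = c * orbit_weight G V X"
  by (simp add: burnside_weight_def class_weight_iso_class)

lemma mark_single:
  "\<lbrakk>is_gset G X; D \<subseteq> carrier G\<rbrakk> \<Longrightarrow>
    mark G D (Poly_Mapping.single (iso_class G X) c) = c * of_nat (card (fixed_points D X))"
  by (simp add: mark_def burnside_weight_single orbit_weight_mark)

lemma is_gset_union:
  assumes X: "is_gset G X" and Y: "is_gset G Y" shows "is_gset G (gset_union X Y)"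
  unfolding gset_union_def
proof (rule is_gsetI)
  interpret group G using is_gset_group[OF X] .
  fix g h z assume g: "g \<in> carrier G" and h: "h \<in> carrier G" and z: "z \<in> fst X <+> fst Y"
  show "restrict (map_sum (snd X g) (snd Y g)) (fst X <+> fst Y) z \<in> fst X <+> fst Y"
    using z g is_gset_closed[OF X] is_gset_closed[OF Y] by (cases z) auto
  show "restrict (map_sum (snd X (g \<otimes>\<^bsub>G\<^esub> h)) (snd Y (g \<otimes>\<^bsub>G\<^esub> h))) (fst X <+> fst Y) z =
     restrict (map_sum (snd X g) (snd Y g)) (fst X <+> fst Y)
       (restrict (map_sum (snd X h) (snd Y h)) (fst X <+> fst Y) z)"
    using z g h is_gset_closed[OF X h] is_gset_closed[OF Y h] is_gset_mult[OF X] is_gset_mult[OF Y]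
    by (cases z) auto
qed (use is_gset_finite[OF X] is_gset_finite[OF Y] is_gset_one[OF X] is_gset_one[OF Y] is_gset_group[OF X] in auto)

lemma orbit_weight_union:
  assumes X: "is_gset G X" and Y: "is_gset G Y"
  shows "orbit_weight G V (gset_union X Y) = orbit_weight G V X + orbit_weight G V Y"
proof -
  have l: "stabilizer G (snd (gset_union X Y)) (Inl x) = stabilizer G (snd X) x" if "x \<in> fst X" for x
    using that by (auto simp: stabilizer_def gset_union_def)
  have r: "stabilizer G (snd (gset_union X Y)) (Inr y) = stabilizer G (snd Y) y" if "y \<in> fst Y" for y
    using that by (auto simp: stabilizer_def gset_union_def)
  have "fst (gset_union X Y) = Inl ` fst X \<union> Inr ` fst Y" by (auto simp: gset_union_def)
  then have "orbit_weight G V (gset_union X Y) =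
      (\<Sum>z\<in>Inl ` fst X. V (stabilizer G (snd (gset_union X Y)) z)) +
      (\<Sum>z\<in>Inr ` fst Y. V (stabilizer G (snd (gset_union X Y)) z))"
    unfolding orbit_weight_def using is_gset_finite[OF X] is_gset_finite[OF Y]
    by (simp, intro sum.union_disjoint) auto
  then show ?thesis
    unfolding orbit_weight_def by (simp add: sum.reindex l r)
qed

lemma burnside_weight_gset_rel: "r \<in> gset_rel p G \<Longrightarrow> burnside_weight G V r = 0"
proof (induction rule: gset_rel.induct)
  case (step f X Y c)
  then have X: "is_gset G X" and Y: "is_gset G Y" by (simp_all add: finite_gsets_iff)
  show ?case
    using step by (simp add: burnside_weight_add burnside_weight_diff burnside_weight_single[OF X] burnside_weight_single[OF Y]
      burnside_weight_single[OF is_gset_union[OF X Y]] orbit_weight_union[OF X Y] algebra_simps)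
qed simp

section \<open>Formal sums of isomorphism classes\<close>

lemma carrier_gset_ring:
  "f \<in> carrier (gset_ring p G) \<longleftrightarrow> Poly_Mapping.keys f \<subseteq> iso_classes G \<and> (\<forall>k. Poly_Mapping.lookup f k \<in> Z_loc p)"
  by (auto simp: gset_ring_def)

lemma lin_cong_classes:
  assumes f: "f \<in> carrier (gset_ring p G)"
    and w: "\<And>X :: ('g, nat) gset. is_gset G X \<Longrightarrow> w (iso_class G X) = w' (iso_class G X)"
  shows "lin w f = lin w' f"
proof (rule lin_cong)
  show "Poly_Mapping.keys f \<subseteq> iso_classes G" using f by (simp add: carrier_gset_ring)
  show "w k = w' k" if "k \<in> iso_classes G" for k using that w by (elim iso_class_repE) simp
qed

context
  fixes p :: nat
  assumes prime: "Factorial_Ring.prime p"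
begin

lemma formal_zero: "0 \<in> carrier (gset_ring p G)"
  using prime by (simp add: carrier_gset_ring)

lemma formal_add: "\<lbrakk>f \<in> carrier (gset_ring p G); g \<in> carrier (gset_ring p G)\<rbrakk> \<Longrightarrow> f + g \<in> carrier (gset_ring p G)"
  unfolding carrier_gset_ring using keys_add[of f g] Z_loc_add[OF prime] by (auto simp: lookup_add)

lemma formal_uminus: "f \<in> carrier (gset_ring p G) \<Longrightarrow> - f \<in> carrier (gset_ring p G)"
  unfolding carrier_gset_ring using Z_loc_uminus[OF prime] by (auto simp: keys_uminus_eq)

lemma formal_diff: "\<lbrakk>f \<in> carrier (gset_ring p G); g \<in> carrier (gset_ring p G)\<rbrakk> \<Longrightarrow> f - g \<in> carrier (gset_ring p G)"
  by (metis diff_conv_add_uminus formal_add formal_uminus)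

lemma formal_sum: "(\<And>i. i \<in> A \<Longrightarrow> F i \<in> carrier (gset_ring p G)) \<Longrightarrow> sum F A \<in> carrier (gset_ring p G)"
  by (induction A rule: infinite_finite_induct) (auto intro: formal_add formal_zero)

lemma formal_single: "\<lbrakk>k \<in> iso_classes G; c \<in> Z_loc p\<rbrakk> \<Longrightarrow> Poly_Mapping.single k c \<in> carrier (gset_ring p G)"
  unfolding carrier_gset_ring using prime by (auto simp: lookup_single when_def)

lemma gset_rel_add: "\<lbrakk>r \<in> gset_rel p G; s \<in> gset_rel p G\<rbrakk> \<Longrightarrow> r + s \<in> gset_rel p G"
proof (induction rule: gset_rel.induct)
  case (step f X Y c)
  then have "(f + s) + (Poly_Mapping.single (iso_class G (gset_union X Y)) c
      - Poly_Mapping.single (iso_class G X) c - Poly_Mapping.single (iso_class G Y) c) \<in> gset_rel p G"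
    by (intro gset_rel.step)
  then show ?case by (simp add: algebra_simps)
qed simp

lemma gset_rel_single:
  "\<lbrakk>X \<in> finite_gsets G; Y \<in> finite_gsets G; c \<in> Z_loc p\<rbrakk> \<Longrightarrow>
    Poly_Mapping.single (iso_class G (gset_union X Y)) c
      - Poly_Mapping.single (iso_class G X) c - Poly_Mapping.single (iso_class G Y) c \<in> gset_rel p G"
  using gset_rel.step[OF gset_rel.zero] by fastforce

lemma gset_rel_uminus: "r \<in> gset_rel p G \<Longrightarrow> - r \<in> gset_rel p G"
proof (induction rule: gset_rel.induct)
  case (step f X Y c)
  have "- f + (Poly_Mapping.single (iso_class G (gset_union X Y)) (- c)
      - Poly_Mapping.single (iso_class G X) (- c) - Poly_Mapping.single (iso_class G Y) (- c)) \<in> gset_rel p G"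
    using step Z_loc_uminus[OF prime] by (intro gset_rel.step) auto
  then show ?case by (simp add: single_uminus algebra_simps)
qed (simp add: gset_rel.zero)

lemma gset_rel_diff: "\<lbrakk>r \<in> gset_rel p G; s \<in> gset_rel p G\<rbrakk> \<Longrightarrow> r - s \<in> gset_rel p G"
  by (metis diff_conv_add_uminus gset_rel_add gset_rel_uminus)

lemma gset_rel_sum: "(\<And>i. i \<in> A \<Longrightarrow> F i \<in> gset_rel p G) \<Longrightarrow> sum F A \<in> gset_rel p G"
  by (induction A rule: infinite_finite_induct) (auto intro: gset_rel_add gset_rel.zero)

lemma gset_rel_formal: "r \<in> gset_rel p G \<Longrightarrow> r \<in> carrier (gset_ring p G)"
proof (induction rule: gset_rel.induct)
  case (step f X Y c)
  then show ?case
    by (intro formal_add formal_diff formal_single iso_class_in_iso_classes is_gset_union)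
      (simp_all add: finite_gsets_iff)
qed (rule formal_zero)

lemma burnside_coset_alt: "burnside_coset p G f = {r + f | r. r \<in> gset_rel p G}"
  by (auto simp: burnside_coset_def a_r_coset_def' gset_ring_def)

lemma burnside_coset_eq_iff: "burnside_coset p G f = burnside_coset p G g \<longleftrightarrow> f - g \<in> gset_rel p G"
proof
  assume eq: "burnside_coset p G f = burnside_coset p G g"
  have "f \<in> burnside_coset p G f" unfolding burnside_coset_alt using gset_rel.zero by force
  then have "f \<in> burnside_coset p G g" using eq by simp
  then show "f - g \<in> gset_rel p G" unfolding burnside_coset_alt by auto
next
  assume d: "f - g \<in> gset_rel p G"
  show "burnside_coset p G f = burnside_coset p G g"
  proof
    show "burnside_coset p G f \<subseteq> burnside_coset p G g" unfolding burnside_coset_alt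
      using gset_rel_add[OF _ d] by (force simp: algebra_simps)
    show "burnside_coset p G g \<subseteq> burnside_coset p G f" unfolding burnside_coset_alt
      using gset_rel_diff[OF _ d] by (force simp: algebra_simps)
  qed
qed

lemma burnside_coset_self: "f \<in> burnside_coset p G f"
  unfolding burnside_coset_alt using gset_rel.zero by force

lemma burnside_coset_memD:
  "g \<in> burnside_coset p G f \<Longrightarrow> g - f \<in> gset_rel p G"
  unfolding burnside_coset_alt by auto

lemma burnside_coset_formal:
  "\<lbrakk>f \<in> carrier (gset_ring p G); g \<in> burnside_coset p G f\<rbrakk> \<Longrightarrow> g \<in> carrier (gset_ring p G)"
  using formal_add[OF gset_rel_formal[OF burnside_coset_memD]] by fastforce

lemma burnside_weight_coset:
  "g \<in> burnside_coset p G f \<Longrightarrow> burnside_weight G V g = burnside_weight G V f"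
  using burnside_weight_gset_rel[OF burnside_coset_memD, of g G f V] by (simp add: burnside_weight_diff)

lemma UN_burnside_coset:
  assumes "\<And>g. g \<in> burnside_coset p G f \<Longrightarrow> h g = c" shows "(\<Union>g\<in>burnside_coset p G f. h g) = c"
  using assms burnside_coset_self by blast

lemma carrier_burnside_ring: "A \<in> carrier (burnside_ring p G) \<longleftrightarrow>
    (\<exists>f\<in>carrier (gset_ring p G). A = burnside_coset p G f)"
  by (auto simp: burnside_ring_def FactRing_def A_RCOSETS_def' burnside_coset_def)

lemma zero_burnside_ring: "\<zero>\<^bsub>burnside_ring p G\<^esub> = burnside_coset p G 0"
  by (simp add: burnside_ring_def FactRing_def burnside_coset_alt)

end

section \<open>Transitive sets and the kernel of the marks\<close>

locale finite_group = group G for G :: "'a monoid" (structure) +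
  assumes finite_carrier: "finite (carrier G)"
begin

lemma subgroup_finite: "subgroup D G \<Longrightarrow> finite D"
  using finite_carrier finite_subset subgroup.subset by blast

lemma subgroup_card_pos: "subgroup D G \<Longrightarrow> 0 < card D"
  using subgroup_finite subgroup.one_closed by (metis card_gt_0_iff empty_iff)

lemma fst_coset_gset: "fst (coset_gset G D) = (\<lambda>g. g <#\<^bsub>G\<^esub> D) ` carrier G"
  by (auto simp: coset_gset_def LCOSETS_def)

lemma snd_coset_gset:
  assumes D: "subgroup D G" and g: "g \<in> carrier G" and a: "a \<in> carrier G"
  shows "snd (coset_gset G D) g (a <#\<^bsub>G\<^esub> D) = (g \<otimes> a) <#\<^bsub>G\<^esub> D"
  using assms lcos_m_assoc[OF subgroup.subset[OF D] g a]
  by (auto simp: coset_gset_def LCOSETS_def)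

lemma is_gset_coset:
  assumes D: "subgroup D G" shows "is_gset G (coset_gset G D)"
proof -
  have "is_gset G (fst (coset_gset G D), snd (coset_gset G D))"
  proof (rule is_gsetI)
    fix g h x assume g: "g \<in> carrier G" and h: "h \<in> carrier G" and "x \<in> fst (coset_gset G D)"
    then obtain a where a: "a \<in> carrier G" "x = a <#\<^bsub>G\<^esub> D" by (auto simp: fst_coset_gset)
    show "snd (coset_gset G D) g x \<in> fst (coset_gset G D)"
      using g a by (simp add: snd_coset_gset[OF D] fst_coset_gset)
    show "snd (coset_gset G D) (g \<otimes> h) x = snd (coset_gset G D) g (snd (coset_gset G D) h x)"
      using g h a by (simp add: snd_coset_gset[OF D] m_assoc)
  next
    fix x assume "x \<in> fst (coset_gset G D)"
    then obtain a where a: "a \<in> carrier G" "x = a <#\<^bsub>G\<^esub> D" by (auto simp: fst_coset_gset)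
    then show "snd (coset_gset G D) \<one> x = x" by (simp add: snd_coset_gset[OF D])
  qed (auto simp: is_group finite_carrier fst_coset_gset, auto simp: coset_gset_def LCOSETS_def)
  then show ?thesis by simp
qed

lemma l_coset_eq_iff:
  assumes D: "subgroup D G" and g: "g \<in> carrier G" and h: "h \<in> carrier G"
  shows "g <#\<^bsub>G\<^esub> D = h <#\<^bsub>G\<^esub> D \<longleftrightarrow> inv h \<otimes> g \<in> D"
proof
  assume "g <#\<^bsub>G\<^esub> D = h <#\<^bsub>G\<^esub> D"
  then have "g \<in> h <#\<^bsub>G\<^esub> D" using lcos_self[OF g D] by simp
  then show "inv h \<otimes> g \<in> D" using subgroup.lcos_module_imp[OF D is_group h] by simp
next
  assume "inv h \<otimes> g \<in> D"
  then have "g \<in> h <#\<^bsub>G\<^esub> D" using subgroup.lcos_module_rev[OF D is_group h g] by simp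
  then show "g <#\<^bsub>G\<^esub> D = h <#\<^bsub>G\<^esub> D" using l_repr_independence[OF _ h D] by simp
qed

lemma inv_cancel_left: "\<lbrakk>x \<in> carrier G; w \<in> carrier G\<rbrakk> \<Longrightarrow> inv x \<otimes> (x \<otimes> w) = w"
  by (simp add: m_assoc[symmetric])

lemma conj_map_closed: "\<lbrakk>x \<in> carrier G; u \<in> carrier G\<rbrakk> \<Longrightarrow> conj_map G x u \<in> carrier G"
  by (simp add: conj_map_def)

lemma conj_map_inv_conj: "\<lbrakk>x \<in> carrier G; u \<in> carrier G\<rbrakk> \<Longrightarrow> conj_map G (inv x) (conj_map G x u) = u"
  by (simp add: conj_map_def m_assoc inv_cancel_left)

lemma conj_map_conj_inv: "\<lbrakk>x \<in> carrier G; u \<in> carrier G\<rbrakk> \<Longrightarrow> conj_map G x (conj_map G (inv x) u) = u"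
  by (metis conj_map_inv_conj inv_closed inv_inv)

lemma conj_map_conj: "\<lbrakk>x \<in> carrier G; y \<in> carrier G; u \<in> carrier G\<rbrakk>
    \<Longrightarrow> conj_map G x (conj_map G y u) = conj_map G (x \<otimes> y) u"
  by (simp add: conj_map_def m_assoc inv_mult_group)

lemma conj_map_one [simp]: "u \<in> carrier G \<Longrightarrow> conj_map G \<one> u = u"
  by (simp add: conj_map_def)

lemma conj_map_mult: "\<lbrakk>x \<in> carrier G; u \<in> carrier G; v \<in> carrier G\<rbrakk>
    \<Longrightarrow> conj_map G x (u \<otimes> v) = conj_map G x u \<otimes> conj_map G x v"
  by (simp add: conj_map_def m_assoc inv_cancel_left)

lemma conj_map_hom: "x \<in> carrier G \<Longrightarrow> group_hom G G (conj_map G x)"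
  using conj_map_mult by unfold_locales (auto simp: hom_def conj_map_closed)

lemma conj_map_inj_on: "x \<in> carrier G \<Longrightarrow> inj_on (conj_map G x) (carrier G)"
  by (rule inj_on_inverseI[where g = "conj_map G (inv x)"]) (simp add: conj_map_inv_conj)

lemma conj_image_subgroup: "\<lbrakk>x \<in> carrier G; subgroup D G\<rbrakk> \<Longrightarrow> subgroup (conj_map G x ` D) G"
  using group_hom.subgroup_img_is_subgroup[OF conj_map_hom] by blast

lemma conj_image_card: "\<lbrakk>x \<in> carrier G; D \<subseteq> carrier G\<rbrakk> \<Longrightarrow> card (conj_map G x ` D) = card D"
  using conj_map_inj_on by (metis card_image inj_on_subset)

lemma mem_conj_image: "\<lbrakk>x \<in> carrier G; D \<subseteq> carrier G; u \<in> carrier G\<rbrakk>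
    \<Longrightarrow> u \<in> conj_map G x ` D \<longleftrightarrow> conj_map G (inv x) u \<in> D"
proof
  assume x: "x \<in> carrier G" and D: "D \<subseteq> carrier G" and u: "u \<in> carrier G"
  show "conj_map G (inv x) u \<in> D" if "u \<in> conj_map G x ` D"
    using that x D conj_map_inv_conj[OF x] by auto
  show "u \<in> conj_map G x ` D" if "conj_map G (inv x) u \<in> D"
    by (rule image_eqI[OF _ that]) (simp add: conj_map_conj_inv[OF x u])
qed

lemma conj_image_carrier: "x \<in> carrier G \<Longrightarrow> conj_map G x ` carrier G = carrier G"
  by (auto simp: conj_map_closed mem_conj_image[OF _ subset_refl])

lemma stabilizer_coset:
  assumes D: "subgroup D G" and a: "a \<in> carrier G"
  shows "stabilizer G (snd (coset_gset G D)) (a <#\<^bsub>G\<^esub> D) = conj_map G a ` D"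
proof -
  have "g \<in> stabilizer G (snd (coset_gset G D)) (a <#\<^bsub>G\<^esub> D) \<longleftrightarrow> g \<in> conj_map G a ` D" for g
  proof (cases "g \<in> carrier G")
    case True
    then show ?thesis
      using a by (simp add: stabilizer_def snd_coset_gset[OF D] l_coset_eq_iff[OF D]
          mem_conj_image[OF a subgroup.subset[OF D]]) (simp add: conj_map_def m_assoc)
  next
    case False
    then show ?thesis
      using subgroup.subset[OF conj_image_subgroup[OF a D]] by (auto simp: stabilizer_def)
  qed
  then show ?thesis by blast
qed

lemma stabilizer_translate:
  assumes X: "is_gset G X" and x: "x \<in> fst X" and a: "a \<in> carrier G"
  shows "stabilizer G (snd X) (snd X a x) = conj_map G a ` stabilizer G (snd X) x"
proof -
  have sub: "stabilizer G (snd X) x \<subseteq> carrier G" by (auto simp: stabilizer_def)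
  have "g \<in> stabilizer G (snd X) (snd X a x) \<longleftrightarrow> g \<in> conj_map G a ` stabilizer G (snd X) x"
    if g: "g \<in> carrier G" for g
  proof -
    have "snd X (conj_map G (inv a) g) x = snd X (inv a) (snd X g (snd X a x))"
      using g a x by (simp add: conj_map_def is_gset_mult[OF X] is_gset_closed[OF X])
    then have "snd X (conj_map G (inv a) g) x = x \<longleftrightarrow> snd X g (snd X a x) = snd X a x"
      using is_gset_inv[OF X a x] is_gset_inv'[OF X a] is_gset_closed[OF X] g a x by metis
    then show ?thesis
      using g a by (simp add: mem_conj_image[OF a sub g]) (simp add: stabilizer_def conj_map_closed)
  qed
  moreover have "conj_map G a ` stabilizer G (snd X) x \<subseteq> carrier G"
    using sub a conj_map_closed by blast
  ultimately show ?thesis by (auto simp: stabilizer_def)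
qed

text \<open>If \<open>D\<close> is the stabilizer of \<open>x\<close>, then \<open>g x\<close> depends exactly on the coset \<open>g D\<close>.\<close>

lemma transitive_gset_iso:
  assumes X: "is_gset G X" and x: "x \<in> fst X"
    and trans: "\<And>y. y \<in> fst X \<Longrightarrow> \<exists>g\<in>carrier G. snd X g x = y"
  shows "gset_iso G (coset_gset G (stabilizer G (snd X) x)) X"
proof -
  let ?D = "stabilizer G (snd X) x"
  have D: "subgroup ?D G" by (rule stabilizer_subgroup_gset[OF X x])
  have move: "snd X g x = snd X h x \<longleftrightarrow> g <#\<^bsub>G\<^esub> ?D = h <#\<^bsub>G\<^esub> ?D" if g: "g \<in> carrier G" and h: "h \<in> carrier G" for g h
  proof -
    have "snd X (inv h \<otimes> g) x = snd X (inv h) (snd X g x)" using g h x by (simp add: is_gset_mult[OF X])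
    then have "snd X g x = snd X h x \<longleftrightarrow> snd X (inv h \<otimes> g) x = x"
      using is_gset_inv[OF X h x] is_gset_inv'[OF X h] is_gset_closed[OF X g x] by metis
    then show ?thesis using g h by (simp add: l_coset_eq_iff[OF D]) (simp add: stabilizer_def)
  qed
  define f where "f C = snd X (SOME g. g \<in> carrier G \<and> C = g <#\<^bsub>G\<^esub> ?D) x" for C
  have f: "f (g <#\<^bsub>G\<^esub> ?D) = snd X g x" if g: "g \<in> carrier G" for g
  proof -
    define s where "s = (SOME h. h \<in> carrier G \<and> g <#\<^bsub>G\<^esub> ?D = h <#\<^bsub>G\<^esub> ?D)"
    have "s \<in> carrier G \<and> g <#\<^bsub>G\<^esub> ?D = s <#\<^bsub>G\<^esub> ?D"
      unfolding s_def by (rule someI[of _ g]) (simp add: g)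
    then have "snd X g x = snd X s x" using move[OF g] by simp
    then show ?thesis by (simp add: f_def s_def)
  qed
  have "bij_betw f (fst (coset_gset G ?D)) (fst X)"
    unfolding bij_betw_def
  proof
    show "inj_on f (fst (coset_gset G ?D))"
      unfolding fst_coset_gset using move f by (auto simp: inj_on_def)
    show "f ` fst (coset_gset G ?D) = fst X"
      unfolding fst_coset_gset using f trans is_gset_closed[OF X _ x] by (force simp: image_image)
  qed
  moreover have "f (snd (coset_gset G ?D) g C) = snd X g (f C)"
    if g: "g \<in> carrier G" and C: "C \<in> fst (coset_gset G ?D)" for g C
  proof -
    obtain a where a: "a \<in> carrier G" "C = a <#\<^bsub>G\<^esub> ?D" using C unfolding fst_coset_gset by blast
    show ?thesis using a g x f by (simp add: snd_coset_gset[OF D] is_gset_mult[OF X])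
  qed
  ultimately show ?thesis unfolding gset_iso_def by blast
qed

lemma iso_class_conj:
  assumes D: "subgroup D G" and g: "g \<in> carrier G"
  shows "iso_class G (coset_gset G (conj_map G g ` D)) = iso_class G (coset_gset G D)"
proof -
  note X = is_gset_coset[OF D]
  have "gset_iso G (coset_gset G (stabilizer G (snd (coset_gset G D)) (g <#\<^bsub>G\<^esub> D))) (coset_gset G D)"
  proof (rule transitive_gset_iso[OF X])
    fix y assume "y \<in> fst (coset_gset G D)"
    then obtain a where "a \<in> carrier G" "y = a <#\<^bsub>G\<^esub> D" by (auto simp: fst_coset_gset)
    then show "\<exists>h\<in>carrier G. snd (coset_gset G D) h (g <#\<^bsub>G\<^esub> D) = y"
      using g by (intro bexI[of _ "a \<otimes> inv g"]) (auto simp: snd_coset_gset[OF D] m_assoc)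
  qed (use g in \<open>auto simp: fst_coset_gset\<close>)
  then show ?thesis
    unfolding stabilizer_coset[OF D g]
    by (rule iso_class_eq[OF is_gset_coset[OF conj_image_subgroup[OF g D]]])
qed

text \<open>The stabilizer of the coset \<open>g D\<close> is the conjugate of \<open>D\<close> by \<open>g\<close>, and summing over \<open>g\<close> instead of
over cosets counts every coset \<open>|D|\<close> times.\<close>

lemma orbit_weight_coset:
  assumes D: "subgroup D G"
  shows "of_nat (card D) * orbit_weight G V (coset_gset G D) = (\<Sum>g\<in>carrier G. V (conj_map G g ` D))"
proof -
  let ?L = "fst (coset_gset G D)"
  have finL: "finite ?L" by (simp add: fst_coset_gset finite_carrier)
  have "(\<Sum>g\<in>carrier G. V (conj_map G g ` D)) =
      (\<Sum>C\<in>?L. \<Sum>g\<in>{g \<in> carrier G. g <#\<^bsub>G\<^esub> D = C}. V (conj_map G g ` D))"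
    by (rule sum.group[symmetric]) (auto simp: finite_carrier finL fst_coset_gset)
  also have "\<dots> = (\<Sum>C\<in>?L. of_nat (card D) * V (stabilizer G (snd (coset_gset G D)) C))"
  proof (rule sum.cong[OF refl])
    fix C assume "C \<in> ?L"
    then obtain a where a: "a \<in> carrier G" "C = a <#\<^bsub>G\<^esub> D" by (auto simp: fst_coset_gset)
    have "{g \<in> carrier G. g <#\<^bsub>G\<^esub> D = C} = a <#\<^bsub>G\<^esub> D"
      using a l_coset_eq_iff[OF D _ a(1)] subgroup.lcos_module_rev[OF D is_group a(1)]
        subgroup.lcos_module_imp[OF D is_group a(1)] l_coset_carrier[OF _ a(1) D] by auto
    moreover have "card (a <#\<^bsub>G\<^esub> D) = card D"
      using l_card_cosets_equal[OF _ subgroup.subset[OF D] finite_carrier, of "a <#\<^bsub>G\<^esub> D"] a(1)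
      unfolding LCOSETS_def by (metis (no_types, lifting) UN_I singletonI)
    moreover have "(\<Sum>g\<in>{g \<in> carrier G. g <#\<^bsub>G\<^esub> D = C}. V (conj_map G g ` D)) =
        (\<Sum>g\<in>{g \<in> carrier G. g <#\<^bsub>G\<^esub> D = C}. V (stabilizer G (snd (coset_gset G D)) C))"
      using stabilizer_coset[OF D] by (intro sum.cong) auto
    ultimately show "(\<Sum>g\<in>{g \<in> carrier G. g <#\<^bsub>G\<^esub> D = C}. V (conj_map G g ` D)) =
        of_nat (card D) * V (stabilizer G (snd (coset_gset G D)) C)" by simp
  qed
  finally show ?thesis unfolding orbit_weight_def by (simp add: sum_distrib_left)
qed

lemma fixed_points_coset_nonempty:
  assumes D: "subgroup D G" and E: "E \<subseteq> carrier G" and ne: "fixed_points E (coset_gset G D) \<noteq> {}"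
  obtains g where "g \<in> carrier G" "E \<subseteq> conj_map G g ` D"
proof -
  obtain C where C: "C \<in> fst (coset_gset G D)" "\<forall>g\<in>E. snd (coset_gset G D) g C = C"
    using ne by (auto simp: fixed_points_def)
  obtain a where a: "a \<in> carrier G" "C = a <#\<^bsub>G\<^esub> D" using C by (auto simp: fst_coset_gset)
  have "E \<subseteq> stabilizer G (snd (coset_gset G D)) (a <#\<^bsub>G\<^esub> D)" using C a E by (auto simp: stabilizer_def)
  then show thesis using that[OF a(1)] stabilizer_coset[OF D a(1)] by simp
qed

lemma fixed_points_coset_self:
  assumes D: "subgroup D G" shows "card (fixed_points D (coset_gset G D)) \<noteq> 0"
proof -
  have "D = stabilizer G (snd (coset_gset G D)) (\<one> <#\<^bsub>G\<^esub> D)"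
    using stabilizer_coset[OF D one_closed] subgroup.subset[OF D] by (force simp: image_iff subset_iff)
  then have "\<one> <#\<^bsub>G\<^esub> D \<in> fixed_points D (coset_gset G D)"
    by (auto simp: fixed_points_def fst_coset_gset stabilizer_def)
  moreover have "finite (fixed_points D (coset_gset G D))"
    using is_gset_finite[OF is_gset_coset[OF D]] by (auto simp: fixed_points_def)
  ultimately show ?thesis by auto
qed

text \<open>A fixed point of \<open>E\<close> on \<open>G/D\<close> is a conjugate of \<open>D\<close> that contains \<open>E\<close>; there is room for no
more elements.\<close>

lemma fixed_points_coset_same_card:
  assumes D: "subgroup D G" and E: "subgroup E G" and le: "card D \<le> card E"
    and ne: "card (fixed_points E (coset_gset G D)) \<noteq> 0"
  shows "\<exists>g\<in>carrier G. E = conj_map G g ` D" and "iso_class G (coset_gset G E) = iso_class G (coset_gset G D)"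
proof -
  have "fixed_points E (coset_gset G D) \<noteq> {}" using ne by auto
  then obtain g where g: "g \<in> carrier G" "E \<subseteq> conj_map G g ` D"
    using fixed_points_coset_nonempty[OF D subgroup.subset[OF E]] by metis
  have "E = conj_map G g ` D"
    using g le conj_image_card[OF g(1) subgroup.subset[OF D]] subgroup_finite[OF conj_image_subgroup[OF g(1) D]]
    by (metis card_seteq)
  then show "\<exists>g\<in>carrier G. E = conj_map G g ` D" and "iso_class G (coset_gset G E) = iso_class G (coset_gset G D)"
    using g iso_class_conj[OF D g(1)] by auto
qed

definition transitive_classes :: "('a, nat) gset set set"
  where "transitive_classes = {iso_class G (coset_gset G D) | D. subgroup D G}"

text \<open>The table of marks is triangular: if \<open>D\<close> has the largest cardinality among the subgroups whose
coset space occurs in \<open>f\<close>, then no other coset space in \<open>f\<close> has a point fixed by \<open>D\<close>.\<close>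

lemma transitive_combination_mark:
  assumes keys: "Poly_Mapping.keys f \<subseteq> transitive_classes" and nz: "f \<noteq> 0"
  obtains D where "subgroup D G" "iso_class G (coset_gset G D) \<in> Poly_Mapping.keys f" "mark G D f \<noteq> 0"
proof -
  let ?K = "{D. subgroup D G \<and> iso_class G (coset_gset G D) \<in> Poly_Mapping.keys f}"
  have "?K \<subseteq> Pow (carrier G)" using subgroup.subset by auto
  then have "finite ?K" using finite_carrier finite_subset by blast
  moreover obtain k where "k \<in> Poly_Mapping.keys f" using nz by (metis keys_eq_empty ex_in_conv)
  then have "?K \<noteq> {}" using keys by (auto simp: transitive_classes_def)
  ultimately obtain D where D: "D \<in> ?K" and max: "\<And>E. E \<in> ?K \<Longrightarrow> card E \<le> card D"
    by (metis (no_types, lifting) obtains_MAX[of ?K card] Max_ge finite_imageI imageI)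
  have sub: "subgroup D G" using D by simp
  let ?k = "iso_class G (coset_gset G D)"
  have "mark G D f = (\<Sum>k\<in>Poly_Mapping.keys f. Poly_Mapping.lookup f k * class_weight G (mark_weight D) k)"
    by (simp add: mark_def burnside_weight_def lin_def)
  also have "\<dots> = (\<Sum>k\<in>{?k}. Poly_Mapping.lookup f k * class_weight G (mark_weight D) k)"
  proof (rule sum.mono_neutral_right)
    show "\<forall>k\<in>Poly_Mapping.keys f - {?k}. Poly_Mapping.lookup f k * class_weight G (mark_weight D) k = 0"
    proof
      fix k assume k: "k \<in> Poly_Mapping.keys f - {?k}"
      then obtain E where E: "subgroup E G" "k = iso_class G (coset_gset G E)"
        using keys by (auto simp: transitive_classes_def)
      then have "card E \<le> card D" using max k by auto
      then have "card (fixed_points D (coset_gset G E)) = 0"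
        using fixed_points_coset_same_card(2)[OF E(1) sub] E k by auto
      then show "Poly_Mapping.lookup f k * class_weight G (mark_weight D) k = 0"
        using E by (simp add: class_weight_iso_class[OF is_gset_coset] orbit_weight_mark[OF is_gset_coset] subgroup.subset[OF sub])
    qed
  qed (use D in auto)
  also have "\<dots> \<noteq> 0"
    using D fixed_points_coset_self[OF sub]
    by (simp add: class_weight_iso_class[OF is_gset_coset] orbit_weight_mark[OF is_gset_coset] subgroup.subset[OF sub] in_keys_iff)
  finally show thesis using that D by blast
qed

end

locale local_burnside = finite_group G for G :: "'a monoid" (structure) +
  fixes p :: nat
  assumes prime_p: "Factorial_Ring.prime p"
begin

text \<open>Split off one orbit at a time.\<close>

lemma transitive_decomposition_gset:
  assumes "X \<in> finite_gsets G" "c \<in> Z_loc p"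
  shows "\<exists>h\<in>carrier (gset_ring p G). Poly_Mapping.keys h \<subseteq> transitive_classes \<and>
    Poly_Mapping.single (iso_class G X) c - h \<in> gset_rel p G"
  using assms(1)
proof (induction "card (fst X)" arbitrary: X rule: less_induct)
  case less
  then have X: "is_gset G X" by (simp add: finite_gsets_iff)
  show ?case
  proof (cases "fst X = {}")
    case True
    \<comment> \<open>The class of the empty set is a relation: the empty set is a disjoint union of two copies of itself.\<close>
    then have "gset_iso G (gset_union X X) X" by (auto simp: gset_iso_def gset_union_def bij_betw_def Plus_def)
    then have "iso_class G (gset_union X X) = iso_class G X"
      by (rule iso_class_eq[OF is_gset_union[OF X X]])
    then have "- Poly_Mapping.single (iso_class G X) c \<in> gset_rel p G"
      using gset_rel_single[OF prime_p less.prems less.prems assms(2)] by simp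
    then show ?thesis
      using gset_rel_uminus[OF prime_p] formal_zero[OF prime_p] by (intro bexI[of _ 0]) force+
  next
    case False
    then obtain x where x: "x \<in> fst X" by blast
    define P where "P = (\<lambda>g. snd X g x) ` carrier G"
    have P_sub: "P \<subseteq> fst X" using is_gset_closed[OF X _ x] by (auto simp: P_def)
    have x_P: "x \<in> P" using is_gset_one[OF X x] by (force simp: P_def)
    have P_closed: "snd X g y \<in> P" if g: "g \<in> carrier G" and y: "y \<in> P" for g y
    proof -
      obtain h where "h \<in> carrier G" "y = snd X h x" using y unfolding P_def by blast
      then show ?thesis using g is_gset_mult[OF X g _ x] by (auto simp: P_def intro!: image_eqI[of _ _ "g \<otimes> h"])
    qed
    have R_closed: "snd X g y \<in> fst X - P" if g: "g \<in> carrier G" and y: "y \<in> fst X - P" for g y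
    proof -
      have "snd X (inv g) (snd X g y) = y" using is_gset_inv[OF X g] y by blast
      then show ?thesis using P_closed[of "inv g" "snd X g y"] is_gset_closed[OF X g] y g by auto
    qed
    define restr where "restr E = (E, \<lambda>g. restrict (snd X g) E)" for E
    have restr: "is_gset G (restr E)"
      if E: "E \<subseteq> fst X" and cl: "\<And>g y. \<lbrakk>g \<in> carrier G; y \<in> E\<rbrakk> \<Longrightarrow> snd X g y \<in> E" for E
      unfolding restr_def using E cl is_gset_finite[OF X] is_gset_one[OF X] is_gset_mult[OF X] is_group
      by (intro is_gsetI) (auto intro: finite_subset simp: subset_iff)
    have O: "is_gset G (restr P)" using P_sub P_closed by (rule restr)
    have R: "is_gset G (restr (fst X - P))" by (rule restr) (use R_closed in auto)
    have "bij_betw (case_sum id id) (P <+> (fst X - P)) (fst X)"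
      unfolding bij_betw_def
      using P_sub by (auto simp: inj_on_def Plus_def image_Un image_image)
    moreover have "case_sum id id (map_sum (restrict (snd X g) P) (restrict (snd X g) (fst X - P)) z) = snd X g (case_sum id id z)"
      if "z \<in> P <+> (fst X - P)" for g z using that by auto
    ultimately have "gset_iso G (gset_union (restr P) (restr (fst X - P))) X"
      unfolding gset_iso_def gset_union_def restr_def by (intro exI[of _ "case_sum id id"]) auto
    then have eqU: "iso_class G (gset_union (restr P) (restr (fst X - P))) = iso_class G X"
      by (rule iso_class_eq[OF is_gset_union[OF O R]])
    have "gset_iso G (coset_gset G (stabilizer G (snd (restr P)) x)) (restr P)"
      by (rule transitive_gset_iso[OF O]) (use x_P in \<open>auto simp: restr_def P_def\<close>)
    moreover have D: "subgroup (stabilizer G (snd (restr P)) x) G"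
      using stabilizer_subgroup_gset[OF O] x_P by (simp add: restr_def)
    ultimately have "iso_class G (restr P) = iso_class G (coset_gset G (stabilizer G (snd (restr P)) x))"
      using iso_class_eq[OF is_gset_coset[OF D], of "restr P"] by simp
    then have kO: "iso_class G (restr P) \<in> transitive_classes"
      using D unfolding transitive_classes_def by blast
    have "card (fst (restr (fst X - P))) < card (fst X)"
      using x x_P is_gset_finite[OF X] by (auto simp: restr_def intro!: psubset_card_mono)
    then obtain h where h: "h \<in> carrier (gset_ring p G)" "Poly_Mapping.keys h \<subseteq> transitive_classes"
      "Poly_Mapping.single (iso_class G (restr (fst X - P))) c - h \<in> gset_rel p G"
      using less.hyps[of "restr (fst X - P)"] R by (auto simp: finite_gsets_iff)
    let ?h = "Poly_Mapping.single (iso_class G (restr P)) c + h"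
    have "?h \<in> carrier (gset_ring p G)"
      using formal_add[OF prime_p formal_single[OF prime_p iso_class_in_iso_classes[OF O] assms(2)] h(1)] .
    moreover have "Poly_Mapping.keys ?h \<subseteq> transitive_classes"
      using keys_add[of "Poly_Mapping.single (iso_class G (restr P)) c" h] h(2) kO by (auto split: if_splits)
    moreover have "Poly_Mapping.single (iso_class G X) c - ?h \<in> gset_rel p G"
    proof -
      have "Poly_Mapping.single (iso_class G X) c - Poly_Mapping.single (iso_class G (restr P)) c
          - Poly_Mapping.single (iso_class G (restr (fst X - P))) c \<in> gset_rel p G"
        using gset_rel_single[OF prime_p _ _ assms(2), of "restr P" G "restr (fst X - P)"] O R
        by (simp add: finite_gsets_iff eqU)
      from gset_rel_add[OF prime_p this h(3)] show ?thesis by (simp add: algebra_simps)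
    qed
    ultimately show ?thesis by blast
  qed
qed

lemma transitive_decomposition:
  assumes f: "f \<in> carrier (gset_ring p G)"
  obtains h where "h \<in> carrier (gset_ring p G)" "Poly_Mapping.keys h \<subseteq> transitive_classes"
    "f - h \<in> gset_rel p G"
proof -
  have "\<forall>k\<in>Poly_Mapping.keys f. \<exists>h. h \<in> carrier (gset_ring p G) \<and> Poly_Mapping.keys h \<subseteq> transitive_classes \<and>
      Poly_Mapping.single k (Poly_Mapping.lookup f k) - h \<in> gset_rel p G"
  proof
    fix k assume "k \<in> Poly_Mapping.keys f"
    then have "k \<in> iso_classes G" using f by (auto simp: carrier_gset_ring)
    then obtain X where X: "X \<in> finite_gsets G" "k = iso_class G X" by (rule iso_classesE)
    have "Poly_Mapping.lookup f k \<in> Z_loc p" using f by (simp add: carrier_gset_ring)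
    from transitive_decomposition_gset[OF X(1) this] show "\<exists>h. h \<in> carrier (gset_ring p G) \<and> Poly_Mapping.keys h \<subseteq> transitive_classes \<and>
      Poly_Mapping.single k (Poly_Mapping.lookup f k) - h \<in> gset_rel p G"
      unfolding X(2) by blast
  qed
  then obtain H where H: "\<And>k. k \<in> Poly_Mapping.keys f \<Longrightarrow> H k \<in> carrier (gset_ring p G)"
    "\<And>k. k \<in> Poly_Mapping.keys f \<Longrightarrow> Poly_Mapping.keys (H k) \<subseteq> transitive_classes"
    "\<And>k. k \<in> Poly_Mapping.keys f \<Longrightarrow> Poly_Mapping.single k (Poly_Mapping.lookup f k) - H k \<in> gset_rel p G"
    by metis
  show thesis
  proof
    show "sum H (Poly_Mapping.keys f) \<in> carrier (gset_ring p G)" using H(1) by (rule formal_sum[OF prime_p])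
    show "Poly_Mapping.keys (sum H (Poly_Mapping.keys f)) \<subseteq> transitive_classes"
      using keys_sum[of H "Poly_Mapping.keys f"] H(2) by blast
    have "f - sum H (Poly_Mapping.keys f) = (\<Sum>k\<in>Poly_Mapping.keys f. Poly_Mapping.single k (Poly_Mapping.lookup f k) - H k)"
      by (subst (1) poly_mapping_sum_singles[of f]) (simp add: sum_subtractf)
    also have "\<dots> \<in> gset_rel p G" using H(3) by (rule gset_rel_sum[OF prime_p])
    finally show "f - sum H (Poly_Mapping.keys f) \<in> gset_rel p G" .
  qed
qed

lemma mark_gset_rel: "r \<in> gset_rel p G \<Longrightarrow> mark G D r = 0"
  by (simp add: mark_def burnside_weight_gset_rel)

text \<open>Modulo the relations, \<open>f\<close> is a combination of transitive classes, and by triangularity such a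
combination is zero as soon as its marks vanish.\<close>

theorem gset_rel_iff_marks:
  assumes f: "f \<in> carrier (gset_ring p G)"
  shows "f \<in> gset_rel p G \<longleftrightarrow> (\<forall>D. subgroup D G \<longrightarrow> mark G D f = 0)"
proof
  assume marks: "\<forall>D. subgroup D G \<longrightarrow> mark G D f = 0"
  obtain h where h: "h \<in> carrier (gset_ring p G)" "Poly_Mapping.keys h \<subseteq> transitive_classes" "f - h \<in> gset_rel p G"
    using transitive_decomposition[OF f] by blast
  have "mark G D h = mark G D f" for D
    using mark_gset_rel[OF h(3), of D] by (simp add: mark_diff)
  then have "h = 0" using transitive_combination_mark[OF h(2)] marks by metis
  then show "f \<in> gset_rel p G" using h by simp
qed (simp add: mark_gset_rel)

theorem burnside_coset_eq_iff_marks: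
  assumes f: "f \<in> carrier (gset_ring p G)" and g: "g \<in> carrier (gset_ring p G)"
  shows "burnside_coset p G f = burnside_coset p G g \<longleftrightarrow> (\<forall>D. subgroup D G \<longrightarrow> mark G D f = mark G D g)"
  unfolding burnside_coset_eq_iff[OF prime_p] gset_rel_iff_marks[OF formal_diff[OF prime_p f g]]
  by (simp add: mark_diff)

lemma mark_coset: "g \<in> burnside_coset p G f \<Longrightarrow> mark G D g = mark G D f"
  unfolding mark_def by (rule burnside_weight_coset[OF prime_p])

end

section \<open>Products and restrictions\<close>

lemma linear_ext_formal:
  assumes "Factorial_Ring.prime p" "f \<in> carrier (gset_ring p G)"
    and "\<And>k. k \<in> iso_classes G \<Longrightarrow> h k \<in> iso_classes H"
  shows "linear_ext h f \<in> carrier (gset_ring p H)"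
  unfolding linear_ext_def using assms
  by (intro formal_sum formal_single) (auto simp: carrier_gset_ring)

lemma bilinear_ext_formal:
  assumes p: "Factorial_Ring.prime p" and "f \<in> carrier (gset_ring p G)" "f' \<in> carrier (gset_ring p G')"
    and "\<And>k k'. \<lbrakk>k \<in> iso_classes G; k' \<in> iso_classes G'\<rbrakk> \<Longrightarrow> h k k' \<in> iso_classes H"
  shows "bilinear_ext h f f' \<in> carrier (gset_ring p H)"
  unfolding bilinear_ext_def using assms(2,3)
  by (intro formal_sum[OF p] formal_single[OF p] Z_loc_mult[OF p] assms(4)) (auto simp: carrier_gset_ring)

lemma is_gset_res:
  assumes X: "is_gset G X" and H: "group H" and \<alpha>: "\<alpha> \<in> hom H G"
  shows "is_gset H (gset_res \<alpha> X)"
  unfolding gset_res_def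
proof (rule is_gsetI)
  have c: "\<alpha> h \<in> carrier G" if "h \<in> carrier H" for h using \<alpha> that by (auto simp: hom_def)
  have "\<alpha> \<one>\<^bsub>H\<^esub> = \<one>\<^bsub>G\<^esub>" using \<alpha> H is_gset_group[OF X] by (metis hom_one)
  then show "snd X (\<alpha> \<one>\<^bsub>H\<^esub>) x = x" if "x \<in> fst X" for x using that is_gset_one[OF X] by simp
  show "snd X (\<alpha> (g \<otimes>\<^bsub>H\<^esub> h)) x = snd X (\<alpha> g) (snd X (\<alpha> h) x)"
    if "g \<in> carrier H" "h \<in> carrier H" "x \<in> fst X" for g h x
    using that hom_mult[OF \<alpha>, of g h] c is_gset_mult[OF X] by simp
  show "snd X (\<alpha> g) \<in> extensional (fst X)" if "g \<in> carrier H" for g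
    using is_gset_extensional[OF X c[OF that]] .
  show "snd X (\<alpha> g) x \<in> fst X" if "g \<in> carrier H" "x \<in> fst X" for g x
    using is_gset_closed[OF X c[OF that(1)] that(2)] .
qed (use H is_gset_finite[OF X] in auto)

lemma gset_iso_res: "\<lbrakk>gset_iso G X Y; \<alpha> \<in> hom H G\<rbrakk> \<Longrightarrow> gset_iso H (gset_res \<alpha> X) (gset_res \<alpha> Y)"
  unfolding gset_iso_def gset_res_def by (auto simp: hom_def Pi_iff)

lemma res_class:
  assumes X: "is_gset G X" and H: "group H" and \<alpha>: "\<alpha> \<in> hom H G"
  shows "(\<Union>Y\<in>iso_class G X. iso_class H (gset_res \<alpha> Y)) = iso_class H (gset_res \<alpha> X)"
proof (rule UN_iso_class[OF X])
  fix Y assume "is_gset G Y" "gset_iso G X Y"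
  then show "iso_class H (gset_res \<alpha> Y) = iso_class H (gset_res \<alpha> X)"
    using iso_class_eq[OF is_gset_res[OF X H \<alpha>] gset_iso_res[OF _ \<alpha>, of X Y]] by simp
qed

lemma fixed_points_res: "fixed_points E (gset_res \<alpha> X) = fixed_points (\<alpha> ` E) X"
  by (auto simp: fixed_points_def gset_res_def)

lemma res_formal:
  assumes p: "Factorial_Ring.prime p" and f: "f \<in> carrier (gset_ring p G)" and H: "group H" and \<alpha>: "\<alpha> \<in> hom H G"
  shows "linear_ext (\<lambda>x. \<Union>X\<in>x. iso_class H (gset_res \<alpha> X)) f \<in> carrier (gset_ring p H)"
proof (rule linear_ext_formal[OF p f])
  fix k assume "k \<in> iso_classes G"
  then obtain X :: "(_, nat) gset" where X: "is_gset G X" "k = iso_class G X" by (rule iso_class_repE)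
  show "(\<Union>X\<in>k. iso_class H (gset_res \<alpha> X)) \<in> iso_classes H"
    unfolding X(2) res_class[OF X(1) H \<alpha>] by (rule iso_class_in_iso_classes[OF is_gset_res[OF X(1) H \<alpha>]])
qed

lemma mark_res:
  assumes f: "f \<in> carrier (gset_ring p G)" and H: "group H" and \<alpha>: "\<alpha> \<in> hom H G" and E: "E \<subseteq> carrier H"
  shows "mark H E (linear_ext (\<lambda>x. \<Union>X\<in>x. iso_class H (gset_res \<alpha> X)) f) = mark G (\<alpha> ` E) f"
  unfolding mark_def burnside_weight_def lin_linear_ext
proof (rule lin_cong_classes[OF f])
  fix X :: "(_, nat) gset" assume X: "is_gset G X"
  have "\<alpha> ` E \<subseteq> carrier G" using \<alpha> E by (auto simp: hom_def)
  then show "class_weight H (mark_weight E) (\<Union>X\<in>iso_class G X. iso_class H (gset_res \<alpha> X)) =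
      class_weight G (mark_weight (\<alpha> ` E)) (iso_class G X)"
    unfolding res_class[OF X H \<alpha>] class_weight_iso_class[OF X] class_weight_iso_class[OF is_gset_res[OF X H \<alpha>]]
    by (simp add: orbit_weight_mark[OF X] orbit_weight_mark[OF is_gset_res[OF X H \<alpha>] E] fixed_points_res)
qed

lemma is_gset_prod:
  assumes X: "is_gset G X" and Y: "is_gset G Y" shows "is_gset G (gset_prod X Y)"
  unfolding gset_prod_def
  by (rule is_gsetI) (use is_gset_group[OF X] is_gset_finite[OF X] is_gset_finite[OF Y] is_gset_closed[OF X]
    is_gset_closed[OF Y] is_gset_one[OF X] is_gset_one[OF Y] is_gset_mult[OF X] is_gset_mult[OF Y] in auto)

lemma gset_iso_prod:
  assumes "gset_iso G X X'" "gset_iso G Y Y'"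
  shows "gset_iso G (gset_prod X Y) (gset_prod X' Y')"
proof -
  obtain f where f: "bij_betw f (fst X) (fst X')" "\<forall>g\<in>carrier G. \<forall>x\<in>fst X. f (snd X g x) = snd X' g (f x)"
    using assms(1) unfolding gset_iso_def by blast
  obtain f' where f': "bij_betw f' (fst Y) (fst Y')" "\<forall>g\<in>carrier G. \<forall>x\<in>fst Y. f' (snd Y g x) = snd Y' g (f' x)"
    using assms(2) unfolding gset_iso_def by blast
  show ?thesis unfolding gset_iso_def
    by (rule exI[of _ "map_prod f f'"])
      (use f f' bij_betwE[OF f(1)] bij_betwE[OF f'(1)] in \<open>auto simp: gset_prod_def bij_betw_map_prod\<close>)
qed

lemma prod_class:
  assumes X: "is_gset G X" and Y: "is_gset G Y"
  shows "(\<Union>X'\<in>iso_class G X. \<Union>Y'\<in>iso_class G Y. iso_class G (gset_prod X' Y')) = iso_class G (gset_prod X Y)"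
proof (intro UN_iso_class[OF X] UN_iso_class[OF Y])
  fix X' Y' assume "gset_iso G X X'" "gset_iso G Y Y'"
  then show "iso_class G (gset_prod X' Y') = iso_class G (gset_prod X Y)"
    using iso_class_eq[OF is_gset_prod[OF X Y] gset_iso_prod, of X' Y'] by simp
qed

lemma fixed_points_prod:
  "fixed_points E (gset_prod X Y) = fixed_points E X \<times> fixed_points E Y"
  by (auto simp: fixed_points_def gset_prod_def)

lemma mult_gset_ring: "monoid.mult (gset_ring p G) f g =
    bilinear_ext (\<lambda>x y. \<Union>X\<in>x. \<Union>Y\<in>y. iso_class G (gset_prod X Y)) f g"
  by (simp add: gset_ring_def)

lemma mult_formal:
  assumes p: "Factorial_Ring.prime p" and f: "f \<in> carrier (gset_ring p G)" and g: "g \<in> carrier (gset_ring p G)"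
  shows "f \<otimes>\<^bsub>gset_ring p G\<^esub> g \<in> carrier (gset_ring p G)"
  unfolding mult_gset_ring
proof (rule bilinear_ext_formal[OF p f g])
  fix k k' assume k: "k \<in> iso_classes G" and k': "k' \<in> iso_classes G"
  obtain X :: "(_, nat) gset" where X: "is_gset G X" "k = iso_class G X" using k by (rule iso_class_repE)
  obtain Y :: "(_, nat) gset" where Y: "is_gset G Y" "k' = iso_class G Y" using k' by (rule iso_class_repE)
  show "(\<Union>X\<in>k. \<Union>Y\<in>k'. iso_class G (gset_prod X Y)) \<in> iso_classes G"
    unfolding X(2) Y(2) prod_class[OF X(1) Y(1)] by (rule iso_class_in_iso_classes[OF is_gset_prod[OF X(1) Y(1)]])
qed

lemma mark_mult:
  assumes f: "f \<in> carrier (gset_ring p G)" and g: "g \<in> carrier (gset_ring p G)" and E: "E \<subseteq> carrier G"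
  shows "mark G E (f \<otimes>\<^bsub>gset_ring p G\<^esub> g) = mark G E f * mark G E g"
proof -
  let ?w = "class_weight G (mark_weight E)"
  have "mark G E (f \<otimes>\<^bsub>gset_ring p G\<^esub> g) =
      lin (\<lambda>x. lin (\<lambda>y. ?w (\<Union>X\<in>x. \<Union>Y\<in>y. iso_class G (gset_prod X Y))) g) f"
    unfolding mark_def burnside_weight_def mult_gset_ring lin_bilinear_ext ..
  also have "\<dots> = lin (\<lambda>x. lin (\<lambda>y. ?w x * ?w y) g) f"
  proof (rule lin_cong_classes[OF f], rule lin_cong_classes[OF g])
    fix X Y :: "(_, nat) gset" assume X: "is_gset G X" and Y: "is_gset G Y"
    show "?w (\<Union>X\<in>iso_class G X. \<Union>Y\<in>iso_class G Y. iso_class G (gset_prod X Y)) = ?w (iso_class G X) * ?w (iso_class G Y)"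
      unfolding prod_class[OF X Y]
      by (simp add: class_weight_iso_class X Y is_gset_prod[OF X Y] orbit_weight_mark E fixed_points_prod
          card_cartesian_product)
  qed
  also have "\<dots> = mark G E f * mark G E g"
    unfolding lin_scale mark_def burnside_weight_def by (simp add: mult.commute[of _ "lin ?w g"] lin_scale)
  finally show ?thesis .
qed

context local_burnside
begin

lemma mult_burnside_ring:
  assumes f: "f \<in> carrier (gset_ring p G)" and g: "g \<in> carrier (gset_ring p G)"
  shows "burnside_coset p G f \<otimes>\<^bsub>burnside_ring p G\<^esub> burnside_coset p G g =
    burnside_coset p G (f \<otimes>\<^bsub>gset_ring p G\<^esub> g)"
proof -
  have "burnside_coset p G f \<otimes>\<^bsub>burnside_ring p G\<^esub> burnside_coset p G g =
      (\<Union>a\<in>burnside_coset p G f. \<Union>b\<in>burnside_coset p G g. burnside_coset p G (a \<otimes>\<^bsub>gset_ring p G\<^esub> b))"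
    by (simp add: burnside_ring_def FactRing_def rcoset_mult_def burnside_coset_def)
  also have "\<dots> = burnside_coset p G (f \<otimes>\<^bsub>gset_ring p G\<^esub> g)"
  proof (intro UN_burnside_coset[OF prime_p])
    fix a b assume a: "a \<in> burnside_coset p G f" and b: "b \<in> burnside_coset p G g"
    note fa = burnside_coset_formal[OF prime_p f a] and fb = burnside_coset_formal[OF prime_p g b]
    show "burnside_coset p G (a \<otimes>\<^bsub>gset_ring p G\<^esub> b) = burnside_coset p G (f \<otimes>\<^bsub>gset_ring p G\<^esub> g)"
      unfolding burnside_coset_eq_iff_marks[OF mult_formal[OF prime_p fa fb] mult_formal[OF prime_p f g]]
      using mark_mult[OF fa fb] mark_mult[OF f g] mark_coset[OF a] mark_coset[OF b]
      by (auto dest: subgroup.subset)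
  qed
  finally show ?thesis .
qed

definition point_class :: "('a, nat) gset set"
  where "point_class = iso_class G (coset_gset G (carrier G))"

lemma point_class_in: "point_class \<in> iso_classes G"
  unfolding point_class_def by (rule iso_class_in_iso_classes[OF is_gset_coset[OF subgroup_self]])

lemma coset_self_carrier: "g \<in> carrier G \<Longrightarrow> g <#\<^bsub>G\<^esub> carrier G = carrier G"
  by (metis coset_join3 subgroup_self)

lemma mark_point:
  assumes E: "E \<subseteq> carrier G" shows "mark G E (Poly_Mapping.single point_class c) = c"
proof -
  note D = subgroup_self
  have fs: "fst (coset_gset G (carrier G)) = {carrier G}"
    unfolding fst_coset_gset using coset_self_carrier one_closed by (auto simp: image_iff)
  have "fixed_points E (coset_gset G (carrier G)) = {carrier G}"
    using E is_gset_closed[OF is_gset_coset[OF D]] unfolding fixed_points_def fs by blast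
  then show ?thesis
    unfolding point_class_def by (simp add: mark_single[OF is_gset_coset[OF D] E])
qed

text \<open>The image of the Burnside ring under the marks, as functions with arbitrary values at sets that are not
subgroups.\<close>

definition mark_functions :: "('a set \<Rightarrow> rat) set"
  where "mark_functions = {\<xi>. \<exists>f\<in>carrier (gset_ring p G). \<forall>D. subgroup D G \<longrightarrow> mark G D f = \<xi> D}"

lemma mark_functions_const: "c \<in> Z_loc p \<Longrightarrow> (\<lambda>_. c) \<in> mark_functions"
  unfolding mark_functions_def
  using formal_single[OF prime_p point_class_in] mark_point subgroup.subset by blast

lemma mark_functions_add: "\<lbrakk>\<xi> \<in> mark_functions; \<eta> \<in> mark_functions\<rbrakk> \<Longrightarrow> (\<lambda>D. \<xi> D + \<eta> D) \<in> mark_functions"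
  unfolding mark_functions_def using formal_add[OF prime_p] mark_add by (smt (verit) mem_Collect_eq)

lemma mark_functions_diff: "\<lbrakk>\<xi> \<in> mark_functions; \<eta> \<in> mark_functions\<rbrakk> \<Longrightarrow> (\<lambda>D. \<xi> D - \<eta> D) \<in> mark_functions"
  unfolding mark_functions_def using formal_diff[OF prime_p] mark_diff by (smt (verit) mem_Collect_eq)

lemma mark_functions_mult: "\<lbrakk>\<xi> \<in> mark_functions; \<eta> \<in> mark_functions\<rbrakk> \<Longrightarrow> (\<lambda>D. \<xi> D * \<eta> D) \<in> mark_functions"
proof -
  assume "\<xi> \<in> mark_functions" "\<eta> \<in> mark_functions"
  then obtain f g where f: "f \<in> carrier (gset_ring p G)" "\<And>D. subgroup D G \<Longrightarrow> mark G D f = \<xi> D"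
    and g: "g \<in> carrier (gset_ring p G)" "\<And>D. subgroup D G \<Longrightarrow> mark G D g = \<eta> D"
    unfolding mark_functions_def by blast
  then show ?thesis
    unfolding mark_functions_def using mult_formal[OF prime_p f(1) g(1)] mark_mult[OF f(1) g(1) subgroup.subset]
    by (intro CollectI bexI[of _ "f \<otimes>\<^bsub>gset_ring p G\<^esub> g"]) auto
qed

text \<open>For finitely many subgroups \<open>Q\<close>, \<open>1 - (\<Prod>Q. 1 - u / u Q)\<close> is a multiple of \<open>u\<close>; over
  all subgroups, the product vanishes.\<close>

lemma mark_functions_inverse:
  assumes u: "u \<in> mark_functions" and unit: "\<And>D. subgroup D G \<Longrightarrow> u D \<noteq> 0 \<and> 1 / u D \<in> Z_loc p"
  obtains m where "m \<in> mark_functions" "\<And>D. subgroup D G \<Longrightarrow> u D * m D = 1"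
proof -
  have "\<exists>m\<in>mark_functions. \<forall>D\<in>\<Q>. u D * m D = 1" if "finite \<Q>" "\<Q> \<subseteq> {D. subgroup D G}" for \<Q>
    using that
  proof (induction \<Q>)
    case empty
    then show ?case using mark_functions_const[OF Z_loc_0[OF prime_p]] by auto
  next
    case (insert Q \<Q>)
    then obtain m where m: "m \<in> mark_functions" "\<forall>D\<in>\<Q>. u D * m D = 1" by auto
    have uQ: "u Q \<noteq> 0" "(\<lambda>_. 1 / u Q) \<in> mark_functions"
      using unit[of Q] insert.prems mark_functions_const by auto
    \<comment> \<open>Chosen such that \<open>u ?m = 1 - (1 - u m) (1 - u / u Q)\<close>.\<close>
    let ?m = "\<lambda>D. m D + (1 / u Q - u D * m D * (1 / u Q))"
    have "?m \<in> mark_functions"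
      by (intro mark_functions_add mark_functions_diff mark_functions_mult m u uQ(2))
    moreover have "u D * ?m D = 1" if "D \<in> insert Q \<Q>" for D
    proof -
      have "u D * ?m D = u D * m D + u D * (1 / u Q) * (1 - u D * m D)" by (simp add: algebra_simps)
      then show ?thesis using that m(2) uQ(1) by (auto simp: algebra_simps)
    qed
    ultimately show ?case by (intro bexI[of _ ?m]) auto
  qed
  moreover have "finite {D. subgroup D G}"
    by (rule finite_subset[of _ "Pow (carrier G)"]) (auto simp: finite_carrier dest: subgroup.subset)
  ultimately obtain m where "m \<in> mark_functions" "\<forall>D\<in>{D. subgroup D G}. u D * m D = 1" by blast
  then show thesis using that[of m] by simp
qed

section \<open>Congruences between marks\<close>

text \<open>This is the Cauchy-Frobenius lemma for the action of \<open>M\<close> on the points fixed by \<open>D\<close>: for a set, \<open>r\<close> is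
the number of orbits.\<close>

lemma burnside_average:
  assumes f: "f \<in> carrier (gset_ring p G)" and M: "subgroup M G" and D: "D \<subseteq> carrier G"
    and norm: "\<And>m d. \<lbrakk>m \<in> M; d \<in> D\<rbrakk> \<Longrightarrow> conj_map G m d \<in> D"
  obtains r where "r \<in> Z_loc p" "(\<Sum>m\<in>M. mark G (insert m D) f) = of_nat (card M) * r"
proof -
  have set: "\<exists>n::nat. (\<Sum>m\<in>M. orbit_weight G (mark_weight (insert m D)) X) = of_nat (card M) * of_nat n"
    if X: "is_gset G X" for X :: "('a, nat) gset"
  proof -
    let ?E = "fixed_points D X"
    let ?M = "G\<lparr>carrier := M\<rparr>"
    have sub: "M \<subseteq> carrier G" by (rule subgroup.subset[OF M])
    have cl: "snd X m x \<in> ?E" if m: "m \<in> M" and x: "x \<in> ?E" for m x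
    proof -
      have mG: "m \<in> carrier G" "inv m \<in> M" using m sub M by (auto simp: subgroup.m_inv_closed)
      have "snd X d (snd X m x) = snd X m x" if d: "d \<in> D" for d
      proof -
        have "conj_map G (inv m) d \<in> D" using norm mG d by blast
        then have "snd X (conj_map G (inv m) d) x = x" using x by (auto simp: fixed_points_def)
        moreover have "d \<otimes> m = m \<otimes> conj_map G (inv m) d"
          using mG d D by (auto simp: conj_map_def m_assoc[symmetric])
        ultimately show ?thesis
          using is_gset_mult[OF X, of d m x] is_gset_mult[OF X mG(1), of "conj_map G (inv m) d" x] d D mG x
          by (metis (no_types, lifting) \<open>conj_map G (inv m) d \<in> D\<close> fixed_points_def mem_Collect_eq subsetD)
      qed
      then show ?thesis using is_gset_closed[OF X mG(1)] x by (auto simp: fixed_points_def)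
    qed
    have "is_gset ?M (?E, \<lambda>m. restrict (snd X m) ?E)"
      by (rule is_gsetI) (use subgroup_imp_group[OF M] is_gset_finite[OF X] cl is_gset_one[OF X] is_gset_mult[OF X] sub
        in \<open>auto simp: fixed_points_def subset_iff\<close>)
    then interpret a: group_action ?M ?E "\<lambda>m. restrict (snd X m) ?E" by (simp add: is_gset_def)
    have finE: "finite ?E" using is_gset_finite[OF X] by (simp add: fixed_points_def)
    have "card (orbits ?M ?E (\<lambda>m. restrict (snd X m) ?E)) * order ?M = (\<Sum>m\<in>carrier ?M. card (invariants ?E (\<lambda>m. restrict (snd X m) ?E) m))"
      by (rule a.burnside) (use finE subgroup_finite[OF M] in auto)
    moreover have "invariants ?E (\<lambda>m. restrict (snd X m) ?E) m = fixed_points (insert m D) X" for m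
      by (auto simp: invariants_def fixed_points_def)
    ultimately have "(\<Sum>m\<in>M. card (fixed_points (insert m D) X)) = card M * card (orbits ?M ?E (\<lambda>m. restrict (snd X m) ?E))"
      by (simp add: order_def mult.commute)
    moreover have "(\<Sum>m\<in>M. orbit_weight G (mark_weight (insert m D)) X) = of_nat (\<Sum>m\<in>M. card (fixed_points (insert m D) X))"
      unfolding of_nat_sum using sub D by (intro sum.cong orbit_weight_mark[OF X]) auto
    ultimately show ?thesis by (metis of_nat_mult)
  qed
  define n where "n k = (SOME n::nat. (\<Sum>m\<in>M. class_weight G (mark_weight (insert m D)) k) = of_nat (card M) * of_nat n)" for k
  have n: "(\<Sum>m\<in>M. class_weight G (mark_weight (insert m D)) k) = of_nat (card M) * of_nat (n k)"
    if k: "k \<in> iso_classes G" for k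
  proof -
    obtain X :: "(_, nat) gset" where X: "is_gset G X" "k = iso_class G X" using k by (rule iso_class_repE)
    have "\<exists>n::nat. (\<Sum>m\<in>M. class_weight G (mark_weight (insert m D)) k) = of_nat (card M) * of_nat n"
      unfolding X(2) class_weight_iso_class[OF X(1)] by (rule set[OF X(1)])
    then show ?thesis unfolding n_def by (rule someI_ex)
  qed
  show thesis
  proof
    show "lin (\<lambda>k. of_nat (n k)) f \<in> Z_loc p"
      unfolding lin_def using f Z_loc_of_nat[OF prime_p]
      by (intro Z_loc_sum[OF prime_p] Z_loc_mult[OF prime_p]) (auto simp: carrier_gset_ring)
    have "(\<Sum>m\<in>M. mark G (insert m D) f) = lin (\<lambda>k. \<Sum>m\<in>M. class_weight G (mark_weight (insert m D)) k) f"
      unfolding mark_def burnside_weight_def lin_sum_functional ..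
    also have "\<dots> = lin (\<lambda>k. of_nat (card M) * of_nat (n k)) f"
      using f n by (intro lin_cong[of f "iso_classes G"]) (auto simp: carrier_gset_ring)
    finally show "(\<Sum>m\<in>M. mark G (insert m D) f) = of_nat (card M) * lin (\<lambda>k. of_nat (n k)) f"
      unfolding lin_scale .
  qed
qed

text \<open>If \<open>D\<close> is a proper subgroup, then \<open>G/D\<close> has no fixed point and its cardinality is a proper power of \<open>p\<close>.
So the two marks of a transitive set agree modulo \<open>p\<close>, and \<open>f\<close> is a combination of these.\<close>

lemma p_group_mark_congruence_carrier:
  assumes ord: "order G = p ^ n" and f: "f \<in> carrier (gset_ring p G)"
  obtains r where "r \<in> Z_loc p" "mark G {\<one>} f = mark G (carrier G) f + of_nat p * r"
proof -
  obtain h where h: "h \<in> carrier (gset_ring p G)" "Poly_Mapping.keys h \<subseteq> transitive_classes" "f - h \<in> gset_rel p G"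
    using transitive_decomposition[OF f] by blast
  have mh: "mark G D f = mark G D h" for D using mark_gset_rel[OF h(3), of D] by (simp add: mark_diff)
  let ?d = "\<lambda>k. class_weight G (mark_weight {\<one>}) k - class_weight G (mark_weight (carrier G)) k"
  have "\<exists>c::int. ?d k = of_nat p * of_int c" if "k \<in> transitive_classes" for k
  proof -
    obtain D where D: "subgroup D G" "k = iso_class G (coset_gset G D)" using \<open>k \<in> transitive_classes\<close> by (auto simp: transitive_classes_def)
    note X = is_gset_coset[OF D(1)]
    have "?d k = of_nat (card (fixed_points {\<one>} (coset_gset G D))) - of_nat (card (fixed_points (carrier G) (coset_gset G D)))"
      unfolding D(2) by (simp add: class_weight_iso_class[OF X] orbit_weight_mark[OF X])
    moreover have "fixed_points {\<one>} (coset_gset G D) = fst (coset_gset G D)"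
      using is_gset_one[OF X] by (auto simp: fixed_points_def)
    ultimately have dk: "?d k = of_nat (card (fst (coset_gset G D))) - of_nat (card (fixed_points (carrier G) (coset_gset G D)))" by simp
    have cardp: "card (fst (coset_gset G D)) * card D = p ^ n"
      using l_lagrange[OF finite_carrier D(1)] ord by (simp add: coset_gset_def)
    show ?thesis
    proof (cases "D = carrier G")
      case True
      then have "fst (coset_gset G D) = {carrier G}"
        unfolding fst_coset_gset using coset_self_carrier one_closed by (auto simp: image_iff)
      moreover from this have "fixed_points (carrier G) (coset_gset G D) = {carrier G}"
        using is_gset_closed[OF X] unfolding fixed_points_def by blast
      ultimately have "?d k = 0" using dk by simp
      then show ?thesis by (intro exI[of _ 0]) simp
    next
      case False
      have "fixed_points (carrier G) (coset_gset G D) = {}"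
      proof (rule ccontr)
        assume "fixed_points (carrier G) (coset_gset G D) \<noteq> {}"
        then obtain g where "g \<in> carrier G" "carrier G \<subseteq> conj_map G g ` D"
          using fixed_points_coset_nonempty[OF D(1) subset_refl] by metis
        then have "card (carrier G) \<le> card D"
          using conj_image_card subgroup.subset[OF D(1)] subgroup_finite[OF D(1)] by (metis card_mono finite_imageI)
        then show False using False subgroup.subset[OF D(1)] finite_carrier by (metis card_seteq)
      qed
      moreover have "p dvd card (fst (coset_gset G D))"
      proof -
        obtain i where i: "card (fst (coset_gset G D)) = p ^ i"
          using cardp divides_primepow_nat[OF prime_p] by (metis dvd_triv_left)
        have "i \<noteq> 0"
        proof
          assume "i = 0"
          then have "card D = card (carrier G)" using cardp i ord by (simp add: order_def)
          then show False using False subgroup.subset[OF D(1)] finite_carrier by (metis card_subset_eq)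
        qed
        then show ?thesis using i by (simp add: dvd_power)
      qed
      moreover from this obtain c where "card (fst (coset_gset G D)) = p * c" by (rule dvdE)
      ultimately have "?d k = of_nat (p * c)" using dk by simp
      then show ?thesis by (intro exI[of _ "int c"]) simp
    qed
  qed
  then obtain c :: "_ \<Rightarrow> int" where c: "\<And>k. k \<in> transitive_classes \<Longrightarrow> ?d k = of_nat p * of_int (c k)" by metis
  show thesis
  proof
    show "lin (\<lambda>k. of_int (c k)) h \<in> Z_loc p"
      unfolding lin_def using h(1) Z_loc_of_int[OF prime_p]
      by (intro Z_loc_sum[OF prime_p] Z_loc_mult[OF prime_p]) (auto simp: carrier_gset_ring)
    have "mark G {\<one>} f - mark G (carrier G) f = lin ?d h"
      unfolding mh by (simp add: mark_def burnside_weight_def lin_def right_diff_distrib sum_subtractf)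
    also have "\<dots> = lin (\<lambda>k. of_nat p * of_int (c k)) h" using h(2) c by (rule lin_cong)
    finally show "mark G {\<one>} f = mark G (carrier G) f + of_nat p * lin (\<lambda>k. of_int (c k)) h"
      unfolding lin_scale by simp
  qed
qed

lemma local_burnside_subgroup: "subgroup Q G \<Longrightarrow> local_burnside (G\<lparr>carrier := Q\<rparr>) p"
  using subgroup_imp_group subgroup_finite prime_p
  by (simp add: local_burnside_def finite_group_def finite_group_axioms_def local_burnside_axioms_def)

text \<open>Restrict \<open>f\<close> to \<open>Q\<close>.\<close>

lemma p_group_mark_congruence:
  assumes Q: "subgroup Q G" and card: "card Q = p ^ n" and f: "f \<in> carrier (gset_ring p G)"
  obtains r where "r \<in> Z_loc p" "mark G {\<one>} f = mark G Q f + of_nat p * r"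
proof -
  let ?Q = "G\<lparr>carrier := Q\<rparr>"
  interpret Q: local_burnside ?Q p by (rule local_burnside_subgroup[OF Q])
  have incl: "(\<lambda>u. u) \<in> hom ?Q G" using subgroup.subset[OF Q] by (auto simp: hom_def)
  let ?f = "linear_ext (\<lambda>x. \<Union>X\<in>x. iso_class ?Q (gset_res (\<lambda>u. u) X)) f"
  have "order ?Q = p ^ n" using card by (simp add: order_def)
  from Q.p_group_mark_congruence_carrier[OF this res_formal[OF prime_p f Q.is_group incl]]
  obtain r where r: "r \<in> Z_loc p" "mark ?Q {\<one>} ?f = mark ?Q Q ?f + of_nat p * r" by auto
  then show thesis
    using that[of r] mark_res[OF f Q.is_group incl, of "{\<one>}"] mark_res[OF f Q.is_group incl, of Q]
      subgroup.one_closed[OF Q] by simp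
qed

text \<open>The values are \<open>0\<close> or \<open>1\<close>, which are distinct modulo \<open>p\<close>, while all marks are congruent modulo \<open>p\<close>.\<close>

lemma p_group_idempotent_marks:
  assumes pow: "order G = p ^ n" and f: "f \<in> carrier (gset_ring p G)"
    and idem: "\<And>D. subgroup D G \<Longrightarrow> mark G D f * mark G D f = mark G D f"
  shows "(\<forall>D. subgroup D G \<longrightarrow> mark G D f = 0) \<or> (\<forall>D. subgroup D G \<longrightarrow> mark G D f = 1)"
proof -
  have val: "mark G D f = 0 \<or> mark G D f = 1" if "subgroup D G" for D using idem[OF that] by auto
  have "mark G D f = mark G {\<one>} f" if D: "subgroup D G" for D
  proof -
    have "card D dvd p ^ n" using lagrange[OF D] pow by (metis dvd_triv_right)
    then obtain i where "card D = p ^ i" using divides_primepow_nat[OF prime_p] by blast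
    then obtain r where r: "r \<in> Z_loc p" "mark G {\<one>} f = mark G D f + of_nat p * r"
      using p_group_mark_congruence[OF D _ f] by metis
    then show ?thesis
      using val[OF D] val[OF triv_subgroup] one_not_in_p_Z_loc[OF prime_p r(1)]
        one_not_in_p_Z_loc[OF prime_p Z_loc_uminus[OF prime_p r(1)]] by auto
  qed
  then show ?thesis using val[OF triv_subgroup] by metis
qed

end

section \<open>Composition of bisets\<close>

lemma burnside_weight_cong:
  assumes f: "f \<in> carrier (gset_ring p G)" and V: "\<And>A. subgroup A G \<Longrightarrow> V A = V' A"
  shows "burnside_weight G V f = burnside_weight G V' f"
  unfolding burnside_weight_def
proof (rule lin_cong_classes[OF f])
  fix X :: "(_, nat) gset" assume X: "is_gset G X"
  show "class_weight G V (iso_class G X) = class_weight G V' (iso_class G X)"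
    unfolding class_weight_iso_class[OF X] orbit_weight_def
    using V stabilizer_subgroup_gset[OF X] by (intro sum.cong) auto
qed

lemma burnside_weight_functional_sum:
  assumes f: "f \<in> carrier (gset_ring p G)"
  shows "burnside_weight G (\<lambda>A. \<Sum>i\<in>I. V i A) f = (\<Sum>i\<in>I. burnside_weight G (V i) f)"
  unfolding burnside_weight_def lin_sum_functional[symmetric]
  by (rule lin_cong_classes[OF f]) (simp add: class_weight_iso_class orbit_weight_def sum.swap[of _ I])

lemma burnside_weight_functional_scale:
  assumes f: "f \<in> carrier (gset_ring p G)"
  shows "burnside_weight G (\<lambda>A. c * V A) f = c * burnside_weight G V f"
  unfolding burnside_weight_def lin_scale[symmetric]
  by (rule lin_cong_classes[OF f]) (simp add: class_weight_iso_class orbit_weight_def sum_distrib_left)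

lemma (in finite_group) translate_fixed_points:
  assumes X: "is_gset G X" and g: "g \<in> carrier G" and D: "D \<subseteq> carrier G" and x: "x \<in> fixed_points D X"
  shows "snd X g x \<in> fixed_points (conj_map G g ` D) X"
proof -
  have xX: "x \<in> fst X" and "D \<subseteq> stabilizer G (snd X) x"
    using x D by (auto simp: fixed_points_def stabilizer_def)
  then have "conj_map G g ` D \<subseteq> stabilizer G (snd X) (snd X g x)"
    unfolding stabilizer_translate[OF X xX g] by (intro image_mono)
  then show ?thesis using is_gset_closed[OF X g xX] by (auto simp: fixed_points_def stabilizer_def)
qed

lemma (in finite_group) mark_conj:
  assumes f: "f \<in> carrier (gset_ring p G)" and g: "g \<in> carrier G" and D: "D \<subseteq> carrier G"
  shows "mark G (conj_map G g ` D) f = mark G D f"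
  unfolding mark_def burnside_weight_def
proof (rule lin_cong_classes[OF f])
  fix X :: "(_, nat) gset" assume X: "is_gset G X"
  have D': "conj_map G g ` D \<subseteq> carrier G" using g D conj_map_closed by auto
  have "bij_betw (snd X g) (fixed_points D X) (fixed_points (conj_map G g ` D) X)"
  proof (rule bij_betw_byWitness[where f' = "snd X (inv g)"])
    show "snd X g ` fixed_points D X \<subseteq> fixed_points (conj_map G g ` D) X"
      using translate_fixed_points[OF X g D] by blast
    have "conj_map G (inv g) ` conj_map G g ` D = (\<lambda>u. u) ` D"
      unfolding image_image using conj_map_inv_conj[OF g] D by (intro image_cong) auto
    then show "snd X (inv g) ` fixed_points (conj_map G g ` D) X \<subseteq> fixed_points D X"
      using translate_fixed_points[OF X inv_closed[OF g] D'] by auto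
    show "\<forall>x\<in>fixed_points D X. snd X (inv g) (snd X g x) = x"
      using is_gset_inv[OF X g] by (auto simp: fixed_points_def)
    show "\<forall>x\<in>fixed_points (conj_map G g ` D) X. snd X g (snd X (inv g) x) = x"
      using is_gset_inv'[OF X g] by (auto simp: fixed_points_def)
  qed
  then show "class_weight G (mark_weight (conj_map G g ` D)) (iso_class G X) = class_weight G (mark_weight D) (iso_class G X)"
    unfolding class_weight_iso_class[OF X] orbit_weight_mark[OF X D] orbit_weight_mark[OF X D']
    using bij_betw_same_card by metis
qed

text \<open>The contribution of a pair \<open>(y, x)\<close> with stabilizers \<open>A\<close> and \<open>B\<close> to \<open>|H|\<close> times the number of points of
the tensor product fixed by \<open>D\<close>. An element \<open>(k, g)\<close> fixes the class of \<open>(y, x)\<close> if and only if some \<open>h\<close>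
completes it to \<open>(k, h)\<close> in \<open>A\<close> and \<open>(h, g)\<close> in \<open>B\<close>. The class has \<open>|H|\<close> elements divided by the
cardinality in the definition, which is that of the stabilizer of \<open>(y, x)\<close> in \<open>H\<close>.\<close>

definition tensor_weight :: "'g monoid \<Rightarrow> 'h monoid \<Rightarrow> 'k monoid \<Rightarrow>
    ('k \<times> 'g) set \<Rightarrow> ('k \<times> 'h) set \<Rightarrow> ('h \<times> 'g) set \<Rightarrow> rat"
  where "tensor_weight G H K D A B =
    (if \<forall>(k, g)\<in>D. \<exists>h\<in>carrier H. (k, h) \<in> A \<and> (h, g) \<in> B
     then of_nat (card {h \<in> carrier H. (\<one>\<^bsub>K\<^esub>, h) \<in> A \<and> (h, \<one>\<^bsub>G\<^esub>) \<in> B}) else 0)"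

text \<open>The composition of representatives, as it occurs in \<^const>\<open>biset_comp\<close>.\<close>

definition biset_mult :: "'g monoid \<Rightarrow> 'h monoid \<Rightarrow> 'k monoid \<Rightarrow>
    (('k \<times> 'h, nat) gset set \<Rightarrow>\<^sub>0 rat) \<Rightarrow> (('h \<times> 'g, nat) gset set \<Rightarrow>\<^sub>0 rat) \<Rightarrow> (('k \<times> 'g, nat) gset set \<Rightarrow>\<^sub>0 rat)"
  where "biset_mult G H K b a =
    bilinear_ext (\<lambda>y x. \<Union>Y\<in>y. \<Union>X\<in>x. iso_class (K \<times>\<times> G) (tensor G H K Y X)) b a"

lemma finite_group_DirProd: "\<lbrakk>finite_group G; finite_group H\<rbrakk> \<Longrightarrow> finite_group (G \<times>\<times> H)"
  unfolding finite_group_def finite_group_axioms_def by (simp add: DirProd_group)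

locale three_groups = G: finite_group G + H: finite_group H + K: finite_group K
  for G :: "'g monoid" and H :: "'h monoid" and K :: "'k monoid"

locale two_bisets = three_groups G H K
  for G :: "'g monoid" and H :: "'h monoid" and K :: "'k monoid" +
  fixes Y :: "('k \<times> 'h, 'y) gset" and X :: "('h \<times> 'g, 'x) gset"
  assumes Y: "is_gset (K \<times>\<times> H) Y" and X: "is_gset (H \<times>\<times> G) X"
begin

definition yact :: "'k \<Rightarrow> 'h \<Rightarrow> 'y \<Rightarrow> 'y" where "yact k h y = snd Y (k, h) y"
definition xact :: "'h \<Rightarrow> 'g \<Rightarrow> 'x \<Rightarrow> 'x" where "xact h g x = snd X (h, g) x"

lemma yact_closed: "\<lbrakk>k \<in> carrier K; h \<in> carrier H; y \<in> fst Y\<rbrakk> \<Longrightarrow> yact k h y \<in> fst Y"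
  using is_gset_closed[OF Y, of "(k, h)"] by (simp add: yact_def)

lemma xact_closed: "\<lbrakk>h \<in> carrier H; g \<in> carrier G; x \<in> fst X\<rbrakk> \<Longrightarrow> xact h g x \<in> fst X"
  using is_gset_closed[OF X, of "(h, g)"] by (simp add: xact_def)

lemma yact_act: "\<lbrakk>k \<in> carrier K; h \<in> carrier H; k' \<in> carrier K; h' \<in> carrier H; y \<in> fst Y\<rbrakk>
    \<Longrightarrow> yact k h (yact k' h' y) = yact (k \<otimes>\<^bsub>K\<^esub> k') (h \<otimes>\<^bsub>H\<^esub> h') y"
  using is_gset_mult[OF Y, of "(k, h)" "(k', h')"] by (simp add: yact_def)

lemma xact_act: "\<lbrakk>h \<in> carrier H; g \<in> carrier G; h' \<in> carrier H; g' \<in> carrier G; x \<in> fst X\<rbrakk>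
    \<Longrightarrow> xact h g (xact h' g' x) = xact (h \<otimes>\<^bsub>H\<^esub> h') (g \<otimes>\<^bsub>G\<^esub> g') x"
  using is_gset_mult[OF X, of "(h, g)" "(h', g')"] by (simp add: xact_def)

lemma yact_one: "y \<in> fst Y \<Longrightarrow> yact \<one>\<^bsub>K\<^esub> \<one>\<^bsub>H\<^esub> y = y"
  using is_gset_one[OF Y] by (simp add: yact_def)

lemma xact_one: "x \<in> fst X \<Longrightarrow> xact \<one>\<^bsub>H\<^esub> \<one>\<^bsub>G\<^esub> x = x"
  using is_gset_one[OF X] by (simp add: xact_def)

text \<open>The classes of \<^const>\<open>tensor_rel\<close> are the orbits of this action of \<open>H\<close>.\<close>

definition diag :: "'h \<Rightarrow> 'y \<times> 'x \<Rightarrow> 'y \<times> 'x"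
  where "diag h = (\<lambda>a\<in>fst Y \<times> fst X. (yact \<one>\<^bsub>K\<^esub> h (fst a), xact h \<one>\<^bsub>G\<^esub> (snd a)))"

lemma diag_apply: "\<lbrakk>y \<in> fst Y; x \<in> fst X\<rbrakk> \<Longrightarrow> diag h (y, x) = (yact \<one>\<^bsub>K\<^esub> h y, xact h \<one>\<^bsub>G\<^esub> x)"
  by (simp add: diag_def)

lemma diag_gset: "is_gset H (fst Y \<times> fst X, diag)"
  by (rule is_gsetI) (use is_gset_finite[OF Y] is_gset_finite[OF X] H.is_group
    in \<open>auto simp: diag_def yact_closed xact_closed yact_act xact_act yact_one xact_one\<close>)

lemma diag_action: "group_action H (fst Y \<times> fst X) diag"
  using is_gset_action[OF diag_gset] by simp

lemma tensor_rel_image: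
  assumes y: "y \<in> fst Y" and x: "x \<in> fst X"
  shows "tensor_rel G H K Y X `` {(y, x)} = orbit H diag (y, x)"
proof
  show "tensor_rel G H K Y X `` {(y, x)} \<subseteq> orbit H diag (y, x)"
  proof
    fix z assume "z \<in> tensor_rel G H K Y X `` {(y, x)}"
    then obtain y' h where *: "y = yact \<one>\<^bsub>K\<^esub> (inv\<^bsub>H\<^esub> h) y'" "z = (y', xact h \<one>\<^bsub>G\<^esub> x)" "y' \<in> fst Y" "h \<in> carrier H"
      unfolding tensor_rel_def yact_def xact_def by auto
    then have "yact \<one>\<^bsub>K\<^esub> h y = y'" by (simp add: yact_act yact_one)
    then have "z = diag h (y, x)" using *(2) y x by (simp add: diag_apply)
    then show "z \<in> orbit H diag (y, x)" using *(4) unfolding orbit_def by blast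
  qed
  show "orbit H diag (y, x) \<subseteq> tensor_rel G H K Y X `` {(y, x)}"
  proof
    fix z assume "z \<in> orbit H diag (y, x)"
    then obtain h where h: "h \<in> carrier H" "z = (yact \<one>\<^bsub>K\<^esub> h y, xact h \<one>\<^bsub>G\<^esub> x)"
      using y x unfolding orbit_def by (auto simp: diag_apply)
    have "y = yact \<one>\<^bsub>K\<^esub> (inv\<^bsub>H\<^esub> h) (yact \<one>\<^bsub>K\<^esub> h y)" using h y by (simp add: yact_act yact_one)
    then show "z \<in> tensor_rel G H K Y X `` {(y, x)}"
      using h y x yact_closed[of "\<one>\<^bsub>K\<^esub>" h y] unfolding tensor_rel_def yact_def xact_def by (auto simp: Image_def)
  qed
qed

lemma fst_tensor: "fst (tensor G H K Y X) = orbits H (fst Y \<times> fst X) diag"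
proof -
  have "(fst Y \<times> fst X) // tensor_rel G H K Y X = orbits H (fst Y \<times> fst X) diag"
    unfolding quotient_def orbits_def using tensor_rel_image by (auto 0 4)
  then show ?thesis by (simp add: tensor_def Let_def)
qed

lemma orbit_translate:
  assumes k: "k \<in> carrier K" and g: "g \<in> carrier G" and y: "y \<in> fst Y" and x: "x \<in> fst X"
  shows "map_prod (snd Y (k, \<one>\<^bsub>H\<^esub>)) (snd X (\<one>\<^bsub>H\<^esub>, g)) ` orbit H diag (y, x) =
    orbit H diag (yact k \<one>\<^bsub>H\<^esub> y, xact \<one>\<^bsub>H\<^esub> g x)"
proof -
  have "map_prod (snd Y (k, \<one>\<^bsub>H\<^esub>)) (snd X (\<one>\<^bsub>H\<^esub>, g)) (diag h (y, x)) = diag h (yact k \<one>\<^bsub>H\<^esub> y, xact \<one>\<^bsub>H\<^esub> g x)"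
    if h: "h \<in> carrier H" for h
    using k g y x h by (simp add: diag_apply yact_closed xact_closed yact_def[symmetric] xact_def[symmetric] yact_act xact_act)
  then show ?thesis unfolding orbit_def Setcompr_eq_image image_image by (rule image_cong[OF refl])
qed

lemma orbit_in: "\<lbrakk>y \<in> fst Y; x \<in> fst X\<rbrakk> \<Longrightarrow> orbit H diag (y, x) \<in> fst (tensor G H K Y X)"
  unfolding fst_tensor orbits_def by auto

lemma tensor_orbitE:
  assumes "C \<in> fst (tensor G H K Y X)"
  obtains y x where "y \<in> fst Y" "x \<in> fst X" "C = orbit H diag (y, x)"
  using assms unfolding fst_tensor orbits_def by auto

lemma snd_tensor:
  assumes "k \<in> carrier K" "g \<in> carrier G" "y \<in> fst Y" "x \<in> fst X"
  shows "snd (tensor G H K Y X) (k, g) (orbit H diag (y, x)) = orbit H diag (yact k \<one>\<^bsub>H\<^esub> y, xact \<one>\<^bsub>H\<^esub> g x)"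
proof -
  have "orbit H diag (y, x) \<in> (fst Y \<times> fst X) // tensor_rel G H K Y X"
    using orbit_in[OF assms(3,4)] by (simp add: tensor_def Let_def)
  then show ?thesis using orbit_translate[OF assms] by (simp add: tensor_def Let_def)
qed

lemma is_gset_tensor: "is_gset (K \<times>\<times> G) (tensor G H K Y X)"
proof -
  have "is_gset (K \<times>\<times> G) (fst (tensor G H K Y X), snd (tensor G H K Y X))"
  proof (rule is_gsetI)
    show "group (K \<times>\<times> G)" by (rule DirProd_group[OF K.is_group G.is_group])
    show "finite (fst (tensor G H K Y X))"
      unfolding fst_tensor orbits_def Setcompr_eq_image using is_gset_finite[OF diag_gset]
      by (intro finite_imageI) simp
    show "snd (tensor G H K Y X) e \<in> extensional (fst (tensor G H K Y X))" for e
      by (cases e) (auto simp: tensor_def Let_def)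
  next
    fix e C assume e: "e \<in> carrier (K \<times>\<times> G)" and C: "C \<in> fst (tensor G H K Y X)"
    obtain k g where e': "e = (k, g)" "k \<in> carrier K" "g \<in> carrier G" using e by auto
    obtain y x where C': "y \<in> fst Y" "x \<in> fst X" "C = orbit H diag (y, x)" using C by (rule tensor_orbitE)
    show "snd (tensor G H K Y X) e C \<in> fst (tensor G H K Y X)"
      using e' C' by (simp add: snd_tensor orbit_in yact_closed xact_closed)
  next
    fix C assume C: "C \<in> fst (tensor G H K Y X)"
    obtain y x where C': "y \<in> fst Y" "x \<in> fst X" "C = orbit H diag (y, x)" using C by (rule tensor_orbitE)
    show "snd (tensor G H K Y X) \<one>\<^bsub>K \<times>\<times> G\<^esub> C = C"
      using C' by (simp add: snd_tensor yact_one xact_one)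
  next
    fix e e' C assume e: "e \<in> carrier (K \<times>\<times> G)" and e': "e' \<in> carrier (K \<times>\<times> G)" and C: "C \<in> fst (tensor G H K Y X)"
    obtain k g where e: "e = (k, g)" "k \<in> carrier K" "g \<in> carrier G" using e by auto
    obtain k' g' where e': "e' = (k', g')" "k' \<in> carrier K" "g' \<in> carrier G" using e' by auto
    obtain y x where C': "y \<in> fst Y" "x \<in> fst X" "C = orbit H diag (y, x)" using C by (rule tensor_orbitE)
    show "snd (tensor G H K Y X) (e \<otimes>\<^bsub>K \<times>\<times> G\<^esub> e') C = snd (tensor G H K Y X) e (snd (tensor G H K Y X) e' C)"
      using e e' C' by (simp add: snd_tensor yact_closed xact_closed yact_act xact_act)
  qed
  then show ?thesis by simp
qed

lemma orbit_eq_iff: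
  assumes "a \<in> fst Y \<times> fst X" "b \<in> fst Y \<times> fst X"
  shows "orbit H diag a = orbit H diag b \<longleftrightarrow> a \<in> orbit H diag b"
proof -
  interpret group_action H "fst Y \<times> fst X" diag by (rule diag_action)
  show ?thesis
  proof
    assume "orbit H diag a = orbit H diag b"
    then show "a \<in> orbit H diag b" using orbit_refl[OF assms(1)] by simp
  next
    assume a: "a \<in> orbit H diag b"
    have "orbit H diag a \<in> orbits H (fst Y \<times> fst X) diag" "orbit H diag b \<in> orbits H (fst Y \<times> fst X) diag"
      using assms by (auto simp: orbits_def)
    from disjoint_union[OF this] show "orbit H diag a = orbit H diag b"
      using a orbit_refl[OF assms(1)] by auto
  qed
qed

lemma tensor_fixed_iff:
  assumes y: "y \<in> fst Y" and x: "x \<in> fst X" and k: "k \<in> carrier K" and g: "g \<in> carrier G"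
  shows "snd (tensor G H K Y X) (k, g) (orbit H diag (y, x)) = orbit H diag (y, x) \<longleftrightarrow>
    (\<exists>h\<in>carrier H. yact k h y = y \<and> xact h g x = x)"
proof -
  have "snd (tensor G H K Y X) (k, g) (orbit H diag (y, x)) = orbit H diag (y, x) \<longleftrightarrow>
      (yact k \<one>\<^bsub>H\<^esub> y, xact \<one>\<^bsub>H\<^esub> g x) \<in> orbit H diag (y, x)"
    using assms by (simp add: snd_tensor orbit_eq_iff yact_closed xact_closed)
  also have "\<dots> \<longleftrightarrow> (\<exists>h\<in>carrier H. yact k \<one>\<^bsub>H\<^esub> y = yact \<one>\<^bsub>K\<^esub> h y \<and> xact \<one>\<^bsub>H\<^esub> g x = xact h \<one>\<^bsub>G\<^esub> x)"
    using y x by (auto simp: orbit_def diag_apply)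
  also have "\<dots> \<longleftrightarrow> (\<exists>h\<in>carrier H. yact k h y = y \<and> xact h g x = x)"
  proof
    assume "\<exists>h\<in>carrier H. yact k \<one>\<^bsub>H\<^esub> y = yact \<one>\<^bsub>K\<^esub> h y \<and> xact \<one>\<^bsub>H\<^esub> g x = xact h \<one>\<^bsub>G\<^esub> x"
    then obtain h where h: "h \<in> carrier H" "yact k \<one>\<^bsub>H\<^esub> y = yact \<one>\<^bsub>K\<^esub> h y" "xact \<one>\<^bsub>H\<^esub> g x = xact h \<one>\<^bsub>G\<^esub> x" by blast
    have "yact k (inv\<^bsub>H\<^esub> h) y = yact \<one>\<^bsub>K\<^esub> (inv\<^bsub>H\<^esub> h) (yact k \<one>\<^bsub>H\<^esub> y)" using h(1) y k by (simp add: yact_act)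
    also have "\<dots> = y" unfolding h(2) using h(1) y by (simp add: yact_act yact_one)
    finally have "yact k (inv\<^bsub>H\<^esub> h) y = y" .
    moreover have "xact (inv\<^bsub>H\<^esub> h) g x = xact (inv\<^bsub>H\<^esub> h) \<one>\<^bsub>G\<^esub> (xact \<one>\<^bsub>H\<^esub> g x)" using h(1) x g by (simp add: xact_act)
    then have "xact (inv\<^bsub>H\<^esub> h) g x = x" unfolding h(3) using h(1) x by (simp add: xact_act xact_one)
    ultimately show "\<exists>h\<in>carrier H. yact k h y = y \<and> xact h g x = x" using h(1) by blast
  next
    assume "\<exists>h\<in>carrier H. yact k h y = y \<and> xact h g x = x"
    then obtain h where h: "h \<in> carrier H" "yact k h y = y" "xact h g x = x" by blast
    have "yact \<one>\<^bsub>K\<^esub> (inv\<^bsub>H\<^esub> h) (yact k h y) = yact k \<one>\<^bsub>H\<^esub> y" using h(1) y k by (simp add: yact_act)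
    moreover have "xact (inv\<^bsub>H\<^esub> h) \<one>\<^bsub>G\<^esub> (xact h g x) = xact \<one>\<^bsub>H\<^esub> g x" using h(1) x g by (simp add: xact_act)
    ultimately show "\<exists>h\<in>carrier H. yact k \<one>\<^bsub>H\<^esub> y = yact \<one>\<^bsub>K\<^esub> h y \<and> xact \<one>\<^bsub>H\<^esub> g x = xact h \<one>\<^bsub>G\<^esub> x"
      using h by (intro bexI[of _ "inv\<^bsub>H\<^esub> h"]) auto
  qed
  finally show ?thesis .
qed

text \<open>The stabilizers of the points of one orbit of \<open>H\<close> have \<open>|H|\<close> elements altogether. So weighting each pair by
its stabilizer counts every orbit \<open>|H|\<close> times.\<close>

lemma tensor_mark:
  assumes D: "D \<subseteq> carrier (K \<times>\<times> G)"
  shows "of_nat (card (carrier H)) * orbit_weight (K \<times>\<times> G) (mark_weight D) (tensor G H K Y X) =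
    (\<Sum>y\<in>fst Y. \<Sum>x\<in>fst X. tensor_weight G H K D (stabilizer (K \<times>\<times> H) (snd Y) y) (stabilizer (H \<times>\<times> G) (snd X) x))"
proof -
  let ?T = "tensor G H K Y X" and ?A = "fst Y \<times> fst X"
  let ?W = "\<lambda>a. tensor_weight G H K D (stabilizer (K \<times>\<times> H) (snd Y) (fst a)) (stabilizer (H \<times>\<times> G) (snd X) (snd a))"
  interpret a: group_action H ?A diag by (rule diag_action)
  have finA: "finite ?A" using is_gset_finite[OF diag_gset] by simp
  have W: "?W a = (if orbit H diag a \<in> fixed_points D ?T then of_nat (card (stabilizer H diag a)) else 0)"
    if a: "a \<in> ?A" for a
  proof -
    obtain y x where a': "a = (y, x)" "y \<in> fst Y" "x \<in> fst X" using a by auto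
    have "(\<forall>(k, g)\<in>D. \<exists>h\<in>carrier H. (k, h) \<in> stabilizer (K \<times>\<times> H) (snd Y) y \<and> (h, g) \<in> stabilizer (H \<times>\<times> G) (snd X) x)
        \<longleftrightarrow> (\<forall>(k, g)\<in>D. \<exists>h\<in>carrier H. yact k h y = y \<and> xact h g x = x)"
      using D by (fastforce simp: stabilizer_def yact_def xact_def)
    also have "\<dots> \<longleftrightarrow> (\<forall>e\<in>D. snd ?T e (orbit H diag (y, x)) = orbit H diag (y, x))"
    proof (rule ball_cong[OF refl])
      fix e assume "e \<in> D"
      then show "(case e of (k, g) \<Rightarrow> \<exists>h\<in>carrier H. yact k h y = y \<and> xact h g x = x) \<longleftrightarrow>
          snd ?T e (orbit H diag (y, x)) = orbit H diag (y, x)"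
        using D tensor_fixed_iff[OF a'(2,3)] by (cases e) auto
    qed
    also have "\<dots> \<longleftrightarrow> orbit H diag (y, x) \<in> fixed_points D ?T"
      using orbit_in[OF a'(2,3)] by (simp add: fixed_points_def)
    finally have "(\<forall>(k, g)\<in>D. \<exists>h\<in>carrier H. (k, h) \<in> stabilizer (K \<times>\<times> H) (snd Y) y \<and> (h, g) \<in> stabilizer (H \<times>\<times> G) (snd X) x)
        \<longleftrightarrow> orbit H diag (y, x) \<in> fixed_points D ?T" .
    moreover have "{h \<in> carrier H. (\<one>\<^bsub>K\<^esub>, h) \<in> stabilizer (K \<times>\<times> H) (snd Y) y \<and> (h, \<one>\<^bsub>G\<^esub>) \<in> stabilizer (H \<times>\<times> G) (snd X) x}
        = stabilizer H diag (y, x)"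
      using a' by (auto simp: stabilizer_def diag_apply yact_def xact_def)
    ultimately show ?thesis unfolding tensor_weight_def a'(1) by simp
  qed
  have "(\<Sum>y\<in>fst Y. \<Sum>x\<in>fst X. ?W (y, x)) = (\<Sum>a\<in>?A. ?W a)"
    by (simp add: sum.cartesian_product case_prod_unfold)
  also have "\<dots> = (\<Sum>C\<in>orbits H ?A diag. \<Sum>a\<in>C. ?W a)"
    by (rule a.disjoint_sum[OF finA, symmetric])
  also have "\<dots> = (\<Sum>C\<in>orbits H ?A diag. if C \<in> fixed_points D ?T then of_nat (card (carrier H)) else 0)"
  proof (rule sum.cong[OF refl])
    fix C assume C: "C \<in> orbits H ?A diag"
    have mem: "a \<in> ?A \<and> orbit H diag a = C" if a: "a \<in> C" for a
    proof -
      obtain b where b: "b \<in> ?A" "C = orbit H diag b" using C by (auto simp: orbits_def)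
      have "a \<in> ?A" using a C a.orbits_coverture by blast
      then show ?thesis using orbit_eq_iff[of a b] a b by simp
    qed
    have "(\<Sum>a\<in>C. ?W a) = (\<Sum>a\<in>C. if C \<in> fixed_points D ?T then of_nat (card (stabilizer H diag a)) else 0)"
      using mem W by (intro sum.cong) auto
    also have "\<dots> = (if C \<in> fixed_points D ?T then of_nat (\<Sum>a\<in>C. card (stabilizer H diag a)) else 0)" by simp
    also have "(\<Sum>a\<in>C. card (stabilizer H diag a)) = card (carrier H)"
      using a.card_stablizer_sum[OF H.finite_carrier C] by (simp add: order_def)
    finally show "(\<Sum>a\<in>C. ?W a) = (if C \<in> fixed_points D ?T then of_nat (card (carrier H)) else 0)" .
  qed
  also have "\<dots> = of_nat (card (carrier H)) * of_nat (card (fixed_points D ?T))"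
  proof -
    have fin: "finite (orbits H ?A diag)" unfolding orbits_def Setcompr_eq_image using finA by (rule finite_imageI)
    have "orbits H ?A diag \<inter> fixed_points D ?T = fixed_points D ?T"
      unfolding fst_tensor[symmetric] by (auto simp: fixed_points_def)
    then show ?thesis using fin by (simp add: sum.If_cases mult.commute)
  qed
  finally show ?thesis unfolding orbit_weight_mark[OF is_gset_tensor D] by simp
qed

end

lemma tensor_iso:
  assumes "two_bisets G H K Y X" "two_bisets G H K Y' X'"
    and isoY: "gset_iso (K \<times>\<times> H) Y Y'" and isoX: "gset_iso (H \<times>\<times> G) X X'"
  shows "gset_iso (K \<times>\<times> G) (tensor G H K Y X) (tensor G H K Y' X')"
proof -
  interpret a: two_bisets G H K Y X by fact
  interpret b: two_bisets G H K Y' X' by fact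
  obtain f where f: "bij_betw f (fst Y) (fst Y')" "\<forall>e\<in>carrier (K \<times>\<times> H). \<forall>y\<in>fst Y. f (snd Y e y) = snd Y' e (f y)"
    using isoY unfolding gset_iso_def by blast
  obtain f' where f': "bij_betw f' (fst X) (fst X')" "\<forall>e\<in>carrier (H \<times>\<times> G). \<forall>y\<in>fst X. f' (snd X e y) = snd X' e (f' y)"
    using isoX unfolding gset_iso_def by blast
  have fy: "f (a.yact k h y) = b.yact k h (f y)" "f y \<in> fst Y'" if "k \<in> carrier K" "h \<in> carrier H" "y \<in> fst Y" for k h y
    using that f bij_betwE[OF f(1)] by (auto simp: a.yact_def b.yact_def)
  have fx: "f' (a.xact h g x) = b.xact h g (f' x)" "f' x \<in> fst X'" if "h \<in> carrier H" "g \<in> carrier G" "x \<in> fst X" for h g x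
    using that f' bij_betwE[OF f'(1)] by (auto simp: a.xact_def b.xact_def)
  have fmem: "f y \<in> fst Y'" "f' x \<in> fst X'" if "y \<in> fst Y" "x \<in> fst X" for y x
    using that bij_betwE[OF f(1)] bij_betwE[OF f'(1)] by auto
  have orb: "map_prod f f' ` orbit H a.diag (y, x) = orbit H b.diag (f y, f' x)" if yx: "y \<in> fst Y" "x \<in> fst X" for y x
  proof -
    have "map_prod f f' (a.diag h (y, x)) = b.diag h (f y, f' x)" if "h \<in> carrier H" for h
      using that yx fmem[OF yx] by (simp add: a.diag_apply b.diag_apply fy fx)
    then show ?thesis unfolding orbit_def Setcompr_eq_image image_image by (rule image_cong[OF refl])
  qed
  have bij: "bij_betw (map_prod f f') (fst Y \<times> fst X) (fst Y' \<times> fst X')" using f(1) f'(1) by (rule bij_betw_map_prod)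
  have "bij_betw (image (map_prod f f')) (fst (tensor G H K Y X)) (fst (tensor G H K Y' X'))"
    unfolding bij_betw_def
  proof
    have "inj_on (image (map_prod f f')) (Pow (fst Y \<times> fst X))"
      using bij by (simp add: bij_betw_def inj_on_image_Pow)
    moreover have "fst (tensor G H K Y X) \<subseteq> Pow (fst Y \<times> fst X)"
      unfolding a.fst_tensor using group_action.orbits_coverture[OF a.diag_action] by blast
    ultimately show "inj_on (image (map_prod f f')) (fst (tensor G H K Y X))" by (rule inj_on_subset)
    show "image (map_prod f f') ` fst (tensor G H K Y X) = fst (tensor G H K Y' X')"
    proof
      show "image (map_prod f f') ` fst (tensor G H K Y X) \<subseteq> fst (tensor G H K Y' X')"
      proof
        fix C' assume "C' \<in> image (map_prod f f') ` fst (tensor G H K Y X)"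
        then obtain C where C: "C \<in> fst (tensor G H K Y X)" "C' = map_prod f f' ` C" by blast
        obtain y x where "y \<in> fst Y" "x \<in> fst X" "C = orbit H a.diag (y, x)" using C(1) by (rule a.tensor_orbitE)
        then show "C' \<in> fst (tensor G H K Y' X')" using C(2) orb b.orbit_in fmem by simp
      qed
      show "fst (tensor G H K Y' X') \<subseteq> image (map_prod f f') ` fst (tensor G H K Y X)"
      proof
        fix C assume "C \<in> fst (tensor G H K Y' X')"
        then obtain y' x' where C: "y' \<in> fst Y'" "x' \<in> fst X'" "C = orbit H b.diag (y', x')" by (rule b.tensor_orbitE)
        obtain y where "y \<in> fst Y" "y' = f y" using C(1) f(1) unfolding bij_betw_def by blast
        moreover obtain x where "x \<in> fst X" "x' = f' x" using C(2) f'(1) unfolding bij_betw_def by blast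
        ultimately show "C \<in> image (map_prod f f') ` fst (tensor G H K Y X)"
          using C(3) orb a.orbit_in by (metis image_eqI)
      qed
    qed
  qed
  moreover have "map_prod f f' ` snd (tensor G H K Y X) e C = snd (tensor G H K Y' X') e (map_prod f f' ` C)"
    if e: "e \<in> carrier (K \<times>\<times> G)" and C: "C \<in> fst (tensor G H K Y X)" for e C
  proof -
    obtain k g where e: "e = (k, g)" "k \<in> carrier K" "g \<in> carrier G" using e by auto
    obtain y x where C: "y \<in> fst Y" "x \<in> fst X" "C = orbit H a.diag (y, x)" using C by (rule a.tensor_orbitE)
    show ?thesis using e C fmem[OF C(1,2)]
      by (simp add: a.snd_tensor b.snd_tensor orb a.yact_closed a.xact_closed fy fx)
  qed
  ultimately show ?thesis unfolding gset_iso_def by blast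
qed

locale local_bisets = three_groups G H K
  for G :: "'g monoid" and H :: "'h monoid" and K :: "'k monoid" +
  fixes p :: nat
  assumes prime_p: "Factorial_Ring.prime p"
begin

sublocale KG: local_burnside "K \<times>\<times> G" p
  unfolding local_burnside_def local_burnside_axioms_def
  using prime_p finite_group_DirProd[OF K.finite_group_axioms G.finite_group_axioms] by simp

sublocale HG: local_burnside "H \<times>\<times> G" p
  unfolding local_burnside_def local_burnside_axioms_def
  using prime_p finite_group_DirProd[OF H.finite_group_axioms G.finite_group_axioms] by simp

sublocale KH: local_burnside "K \<times>\<times> H" p
  unfolding local_burnside_def local_burnside_axioms_def
  using prime_p finite_group_DirProd[OF K.finite_group_axioms H.finite_group_axioms] by simp

lemma two_bisetsI: "\<lbrakk>is_gset (K \<times>\<times> H) Y; is_gset (H \<times>\<times> G) X\<rbrakk> \<Longrightarrow> two_bisets G H K Y X"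
  by (intro two_bisets.intro two_bisets_axioms.intro three_groups_axioms)

lemma tensor_class:
  assumes Y: "is_gset (K \<times>\<times> H) Y" and X: "is_gset (H \<times>\<times> G) X"
  shows "(\<Union>Y'\<in>iso_class (K \<times>\<times> H) Y. \<Union>X'\<in>iso_class (H \<times>\<times> G) X. iso_class (K \<times>\<times> G) (tensor G H K Y' X'))
    = iso_class (K \<times>\<times> G) (tensor G H K Y X)"
proof (intro UN_iso_class[OF X] UN_iso_class[OF Y])
  fix X' :: "('h \<times> 'g, nat) gset" and Y' :: "('k \<times> 'h, nat) gset"
  assume X': "is_gset (H \<times>\<times> G) X'" "gset_iso (H \<times>\<times> G) X X'" and Y': "is_gset (K \<times>\<times> H) Y'" "gset_iso (K \<times>\<times> H) Y Y'"
  have "gset_iso (K \<times>\<times> G) (tensor G H K Y X) (tensor G H K Y' X')"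
    by (rule tensor_iso[OF two_bisetsI[OF Y X] two_bisetsI[OF Y'(1) X'(1)] Y'(2) X'(2)])
  then show "iso_class (K \<times>\<times> G) (tensor G H K Y' X') = iso_class (K \<times>\<times> G) (tensor G H K Y X)"
    using iso_class_eq[OF two_bisets.is_gset_tensor[OF two_bisetsI[OF Y X]]] by metis
qed

lemma biset_mult_formal:
  assumes b: "b \<in> carrier (gset_ring p (K \<times>\<times> H))" and a: "a \<in> carrier (gset_ring p (H \<times>\<times> G))"
  shows "biset_mult G H K b a \<in> carrier (gset_ring p (K \<times>\<times> G))"
  unfolding biset_mult_def
proof (rule bilinear_ext_formal[OF prime_p b a])
  fix y x assume y: "y \<in> iso_classes (K \<times>\<times> H)" and x: "x \<in> iso_classes (H \<times>\<times> G)"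
  obtain Y :: "(_, nat) gset" where Y: "is_gset (K \<times>\<times> H) Y" "y = iso_class (K \<times>\<times> H) Y" using y by (rule iso_class_repE)
  obtain X :: "(_, nat) gset" where X: "is_gset (H \<times>\<times> G) X" "x = iso_class (H \<times>\<times> G) X" using x by (rule iso_class_repE)
  show "(\<Union>Y\<in>y. \<Union>X\<in>x. iso_class (K \<times>\<times> G) (tensor G H K Y X)) \<in> iso_classes (K \<times>\<times> G)"
    unfolding X(2) Y(2) tensor_class[OF Y(1) X(1)]
    by (rule iso_class_in_iso_classes[OF two_bisets.is_gset_tensor[OF two_bisetsI[OF Y(1) X(1)]]])
qed

text \<open>The right-hand side sees \<open>a\<close> and \<open>b\<close> only through weights, which vanish on the relations. This is the
reason why composition is well defined on the double Burnside modules.\<close>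

lemma mark_biset_mult:
  assumes b: "b \<in> carrier (gset_ring p (K \<times>\<times> H))" and a: "a \<in> carrier (gset_ring p (H \<times>\<times> G))"
    and D: "D \<subseteq> carrier (K \<times>\<times> G)"
  shows "of_nat (card (carrier H)) * mark (K \<times>\<times> G) D (biset_mult G H K b a) =
    burnside_weight (K \<times>\<times> H) (\<lambda>A. burnside_weight (H \<times>\<times> G) (tensor_weight G H K D A) a) b"
proof -
  let ?n = "of_nat (card (carrier H)) :: rat"
  let ?w = "class_weight (K \<times>\<times> G) (mark_weight D)"
  have "?n * mark (K \<times>\<times> G) D (biset_mult G H K b a) =
      lin (\<lambda>y. lin (\<lambda>x. ?n * ?w (\<Union>Y\<in>y. \<Union>X\<in>x. iso_class (K \<times>\<times> G) (tensor G H K Y X))) a) b"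
    unfolding mark_def burnside_weight_def biset_mult_def lin_bilinear_ext lin_scale ..
  also have "\<dots> = lin (class_weight (K \<times>\<times> H) (\<lambda>A. burnside_weight (H \<times>\<times> G) (tensor_weight G H K D A) a)) b"
  proof (rule lin_cong_classes[OF b])
    fix Y :: "('k \<times> 'h, nat) gset" assume Yg: "is_gset (K \<times>\<times> H) Y"
    let ?y = "iso_class (K \<times>\<times> H) Y" and ?st = "stabilizer (K \<times>\<times> H) (snd Y)"
    have "class_weight (K \<times>\<times> H) (\<lambda>A. burnside_weight (H \<times>\<times> G) (tensor_weight G H K D A) a) ?y =
        lin (\<lambda>x. \<Sum>z\<in>fst Y. class_weight (H \<times>\<times> G) (tensor_weight G H K D (?st z)) x) a"
      unfolding class_weight_iso_class[OF Yg] orbit_weight_def lin_sum_functional burnside_weight_def ..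
    also have "\<dots> = lin (\<lambda>x. ?n * ?w (\<Union>Y\<in>?y. \<Union>X\<in>x. iso_class (K \<times>\<times> G) (tensor G H K Y X))) a"
    proof (rule lin_cong_classes[OF a])
      fix X :: "('h \<times> 'g, nat) gset" assume Xg: "is_gset (H \<times>\<times> G) X"
      interpret two_bisets G H K Y X by (rule two_bisetsI[OF Yg Xg])
      show "(\<Sum>z\<in>fst Y. class_weight (H \<times>\<times> G) (tensor_weight G H K D (?st z)) (iso_class (H \<times>\<times> G) X)) =
          ?n * ?w (\<Union>Y\<in>?y. \<Union>X\<in>iso_class (H \<times>\<times> G) X. iso_class (K \<times>\<times> G) (tensor G H K Y X))"
        unfolding tensor_class[OF Yg Xg] class_weight_iso_class[OF Xg] class_weight_iso_class[OF is_gset_tensor] tensor_mark[OF D]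
        by (simp add: orbit_weight_def)
    qed
    finally show "lin (\<lambda>x. ?n * ?w (\<Union>Y\<in>?y. \<Union>X\<in>x. iso_class (K \<times>\<times> G) (tensor G H K Y X))) a =
        class_weight (K \<times>\<times> H) (\<lambda>A. burnside_weight (H \<times>\<times> G) (tensor_weight G H K D A) a) ?y" ..
  qed
  finally show ?thesis unfolding burnside_weight_def .
qed

lemma biset_comp_coset:
  assumes b: "b \<in> carrier (gset_ring p (K \<times>\<times> H))" and a: "a \<in> carrier (gset_ring p (H \<times>\<times> G))"
  shows "biset_comp p G H K (burnside_coset p (K \<times>\<times> H) b) (burnside_coset p (H \<times>\<times> G) a) =
    burnside_coset p (K \<times>\<times> G) (biset_mult G H K b a)"
  unfolding biset_comp_def biset_mult_def[symmetric]
proof (intro UN_burnside_coset[OF prime_p])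
  fix b' a' assume b': "b' \<in> burnside_coset p (K \<times>\<times> H) b" and a': "a' \<in> burnside_coset p (H \<times>\<times> G) a"
  note fb = burnside_coset_formal[OF prime_p b b'] and fa = burnside_coset_formal[OF prime_p a a']
  have "mark (K \<times>\<times> G) D (biset_mult G H K b' a') = mark (K \<times>\<times> G) D (biset_mult G H K b a)"
    if D: "subgroup D (K \<times>\<times> G)" for D
  proof -
    have "burnside_weight (H \<times>\<times> G) V a' = burnside_weight (H \<times>\<times> G) V a" for V
      by (rule burnside_weight_coset[OF prime_p a'])
    moreover have "burnside_weight (K \<times>\<times> H) V b' = burnside_weight (K \<times>\<times> H) V b" for V
      by (rule burnside_weight_coset[OF prime_p b'])
    ultimately have "of_nat (card (carrier H)) * mark (K \<times>\<times> G) D (biset_mult G H K b' a') =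
        of_nat (card (carrier H)) * mark (K \<times>\<times> G) D (biset_mult G H K b a)"
      by (simp add: mark_biset_mult fa fb a b subgroup.subset[OF D, simplified])
    then show ?thesis using H.subgroup_card_pos[OF H.subgroup_self] by simp
  qed
  then show "burnside_coset p (K \<times>\<times> G) (biset_mult G H K b' a') = burnside_coset p (K \<times>\<times> G) (biset_mult G H K b a)"
    unfolding KG.burnside_coset_eq_iff_marks[OF biset_mult_formal[OF fb fa] biset_mult_formal[OF b a]] by blast
qed

end

section \<open>Composition with transitive bisets\<close>

lemma subgroup_twisted_diagonal:
  assumes G: "group G" and H: "group H" and P: "subgroup P G" and \<phi>: "\<phi> \<in> hom (G\<lparr>carrier := P\<rparr>) H"
  shows "subgroup (twisted_diagonal P \<phi>) (H \<times>\<times> G)"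
proof -
  interpret G: group G by fact
  interpret H: group H by fact
  interpret \<phi>: group_hom "G\<lparr>carrier := P\<rparr>" H \<phi>
    using G.subgroup_imp_group[OF P] H \<phi> by (simp add: group_hom_def group_hom_axioms_def)
  have sub: "P \<subseteq> carrier G" by (rule subgroup.subset[OF P])
  have mult: "\<phi> (u \<otimes>\<^bsub>G\<^esub> v) = \<phi> u \<otimes>\<^bsub>H\<^esub> \<phi> v" if "u \<in> P" "v \<in> P" for u v using \<phi>.hom_mult that by simp
  have inv: "\<phi> (inv\<^bsub>G\<^esub> u) = inv\<^bsub>H\<^esub> \<phi> u" if "u \<in> P" for u
    using \<phi>.hom_inv that G.m_inv_consistent[OF P] by simp
  have cl: "\<phi> u \<in> carrier H" if "u \<in> P" for u using \<phi>.hom_closed that by simp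
  show ?thesis
  proof (rule group.subgroupI[OF DirProd_group[OF H G]])
    show "twisted_diagonal P \<phi> \<noteq> {}" using subgroup.one_closed[OF P] by (auto simp: twisted_diagonal_def)
    show "twisted_diagonal P \<phi> \<subseteq> carrier (H \<times>\<times> G)" using cl sub by (auto simp: twisted_diagonal_def)
  next
    fix a assume "a \<in> twisted_diagonal P \<phi>"
    then obtain u where u: "u \<in> P" "a = (\<phi> u, u)" by (auto simp: twisted_diagonal_def)
    have "inv\<^bsub>H \<times>\<times> G\<^esub> a = (\<phi> (inv\<^bsub>G\<^esub> u), inv\<^bsub>G\<^esub> u)" using u sub cl by (simp add: inv_DirProd[OF H G] inv subset_iff)
    then show "inv\<^bsub>H \<times>\<times> G\<^esub> a \<in> twisted_diagonal P \<phi>"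
      using subgroup.m_inv_closed[OF P u(1)] by (auto simp: twisted_diagonal_def)
    fix b assume "b \<in> twisted_diagonal P \<phi>"
    then obtain v where v: "v \<in> P" "b = (\<phi> v, v)" by (auto simp: twisted_diagonal_def)
    have "a \<otimes>\<^bsub>H \<times>\<times> G\<^esub> b = (\<phi> (u \<otimes>\<^bsub>G\<^esub> v), u \<otimes>\<^bsub>G\<^esub> v)" using u v by (simp add: mult)
    then show "a \<otimes>\<^bsub>H \<times>\<times> G\<^esub> b \<in> twisted_diagonal P \<phi>"
      using subgroup.m_closed[OF P u(1) v(1)] by (auto simp: twisted_diagonal_def)
  qed
qed

lemma card_twisted_diagonal: "card (twisted_diagonal P \<phi>) = card P"
proof -
  have "twisted_diagonal P \<phi> = (\<lambda>u. (\<phi> u, u)) ` P" by (auto simp: twisted_diagonal_def)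
  then show ?thesis by (simp add: card_image inj_on_def)
qed

lemma conj_map_DirProd:
  assumes "group H" "group G" "u \<in> carrier H" "v \<in> carrier G"
  shows "conj_map (H \<times>\<times> G) (u, v) (a, b) = (conj_map H u a, conj_map G v b)"
  using assms by (simp add: conj_map_def)

definition biset_single :: "'g monoid \<Rightarrow> 'h monoid \<Rightarrow> 'g set \<Rightarrow> ('g \<Rightarrow> 'h) \<Rightarrow> (('h \<times> 'g, nat) gset set \<Rightarrow>\<^sub>0 rat)"
  where "biset_single G H P \<phi> = Poly_Mapping.single (iso_class (H \<times>\<times> G) (transitive_biset G H P \<phi>)) 1"

lemma biset_class_alt: "biset_class p G H P \<phi> = burnside_coset p (H \<times>\<times> G) (biset_single G H P \<phi>)"
  by (simp add: biset_class_def burnside_class_def biset_single_def)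

context local_bisets
begin

lemma biset_single_formal:
  assumes P: "subgroup P G" and \<phi>: "\<phi> \<in> hom (G\<lparr>carrier := P\<rparr>) H"
  shows "biset_single G H P \<phi> \<in> carrier (gset_ring p (H \<times>\<times> G))"
  unfolding biset_single_def transitive_biset_def
  by (intro formal_single prime_p iso_class_in_iso_classes HG.is_gset_coset
      subgroup_twisted_diagonal G.is_group H.is_group P \<phi> Z_loc_1)

lemma weight_biset_single:
  assumes P: "subgroup P G" and \<phi>: "\<phi> \<in> hom (G\<lparr>carrier := P\<rparr>) H"
  shows "of_nat (card P) * burnside_weight (H \<times>\<times> G) V (biset_single G H P \<phi>) =
    (\<Sum>u\<in>carrier H. \<Sum>v\<in>carrier G. V ((\<lambda>w. (conj_map H u (\<phi> w), conj_map G v w)) ` P))"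
proof -
  note D = subgroup_twisted_diagonal[OF G.is_group H.is_group P \<phi>]
  have "of_nat (card P) * burnside_weight (H \<times>\<times> G) V (biset_single G H P \<phi>) =
      (\<Sum>e\<in>carrier (H \<times>\<times> G). V (conj_map (H \<times>\<times> G) e ` twisted_diagonal P \<phi>))"
    unfolding biset_single_def transitive_biset_def burnside_weight_single[OF HG.is_gset_coset[OF D]]
    using HG.orbit_weight_coset[OF D, of V] by (simp add: card_twisted_diagonal)
  also have "\<dots> = (\<Sum>e\<in>carrier H \<times> carrier G. V ((\<lambda>w. (conj_map H (fst e) (\<phi> w), conj_map G (snd e) w)) ` P))"
  proof (rule sum.cong)
    fix e assume "e \<in> carrier H \<times> carrier G"
    then have "conj_map (H \<times>\<times> G) e ` twisted_diagonal P \<phi> = (\<lambda>w. (conj_map H (fst e) (\<phi> w), conj_map G (snd e) w)) ` P"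
      unfolding twisted_diagonal_def Setcompr_eq_image image_image
      by (intro image_cong) (auto simp: conj_map_DirProd)
    then show "V (conj_map (H \<times>\<times> G) e ` twisted_diagonal P \<phi>) =
        V ((\<lambda>w. (conj_map H (fst e) (\<phi> w), conj_map G (snd e) w)) ` P)" by simp
  qed simp
  finally show ?thesis by (simp add: sum.cartesian_product case_prod_unfold)
qed

text \<open>The stabilizer of the coset of \<open>(u, v)\<close> is the graph of \<open>\<phi>\<close> conjugated by \<open>u\<close> and \<open>v\<close>. Hence for
\<open>(k, g)\<close> in \<open>D\<close> there is at most one \<open>h\<close> that can occur in \<^const>\<open>tensor_weight\<close>, namely the image of \<open>g\<close>
under that conjugate of \<open>\<phi>\<close>. The conjugation by \<open>u\<close> does not change marks of \<open>b\<close>.\<close>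

lemma mark_biset_mult_single_right:
  assumes b: "b \<in> carrier (gset_ring p (K \<times>\<times> H))" and P: "subgroup P G" and \<phi>: "\<phi> \<in> hom (G\<lparr>carrier := P\<rparr>) H"
    and D: "D \<subseteq> carrier (K \<times>\<times> G)"
  shows "of_nat (card P) * mark (K \<times>\<times> G) D (biset_mult G H K b (biset_single G H P \<phi>)) =
    (\<Sum>v | v \<in> carrier G \<and> snd ` D \<subseteq> conj_map G v ` P.
      mark (K \<times>\<times> H) ((\<lambda>(k, g). (k, \<phi> (conj_map G (inv\<^bsub>G\<^esub> v) g))) ` D) b)"
proof -
  note a = biset_single_formal[OF P \<phi>]
  have sub: "P \<subseteq> carrier G" by (rule subgroup.subset[OF P])
  have \<phi>cl: "\<phi> w \<in> carrier H" if "w \<in> P" for w using \<phi> that by (auto simp: hom_def)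
  have \<phi>1: "\<phi> \<one>\<^bsub>G\<^esub> = \<one>\<^bsub>H\<^esub>" using hom_one[OF \<phi> G.subgroup_imp_group[OF P] H.is_group] by simp
  let ?B = "\<lambda>u v. (\<lambda>w. (conj_map H u (\<phi> w), conj_map G v w)) ` P"
  let ?D = "\<lambda>v. (\<lambda>(k, g). (k, \<phi> (conj_map G (inv\<^bsub>G\<^esub> v) g))) ` D"
  have D': "k \<in> carrier K" "g \<in> carrier G" if "(k, g) \<in> D" for k g using D that by auto
  have inB: "(h, g) \<in> ?B u v \<longleftrightarrow> g \<in> conj_map G v ` P \<and> h = conj_map H u (\<phi> (conj_map G (inv\<^bsub>G\<^esub> v) g))"
    if v: "v \<in> carrier G" for u v h g
    using G.conj_map_inv_conj[OF v] sub by (auto simp: image_iff subset_iff)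
  have W: "tensor_weight G H K D A (?B u v) =
      (if snd ` D \<subseteq> conj_map G v ` P then mark_weight (conj_map (K \<times>\<times> H) (\<one>\<^bsub>K\<^esub>, u) ` ?D v) A else 0)"
    if A: "subgroup A (K \<times>\<times> H)" and u: "u \<in> carrier H" and v: "v \<in> carrier G" for A u v
  proof -
    have "{h \<in> carrier H. (\<one>\<^bsub>K\<^esub>, h) \<in> A \<and> (h, \<one>\<^bsub>G\<^esub>) \<in> ?B u v} = {\<one>\<^bsub>H\<^esub>}"
    proof -
      have "conj_map G (inv\<^bsub>G\<^esub> v) \<one>\<^bsub>G\<^esub> = \<one>\<^bsub>G\<^esub>" "conj_map H u \<one>\<^bsub>H\<^esub> = \<one>\<^bsub>H\<^esub>" "conj_map G v \<one>\<^bsub>G\<^esub> = \<one>\<^bsub>G\<^esub>"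
        using u v by (simp_all add: conj_map_def)
      moreover from this have "\<one>\<^bsub>G\<^esub> \<in> conj_map G v ` P" using subgroup.one_closed[OF P] by (metis imageI)
      moreover have "(\<one>\<^bsub>K\<^esub>, \<one>\<^bsub>H\<^esub>) \<in> A" using subgroup.one_closed[OF A] by simp
      ultimately show ?thesis unfolding inB[OF v] by (auto simp: \<phi>1)
    qed
    moreover have "(\<forall>(k, g)\<in>D. \<exists>h\<in>carrier H. (k, h) \<in> A \<and> (h, g) \<in> ?B u v) \<longleftrightarrow>
        snd ` D \<subseteq> conj_map G v ` P \<and> conj_map (K \<times>\<times> H) (\<one>\<^bsub>K\<^esub>, u) ` ?D v \<subseteq> A" (is "?l \<longleftrightarrow> ?r")
    proof -
      have c: "conj_map (K \<times>\<times> H) (\<one>\<^bsub>K\<^esub>, u) (k, h) = (k, conj_map H u h)" if "k \<in> carrier K" for k h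
        using that u by (simp add: conj_map_DirProd[OF K.is_group H.is_group])
      have im: "conj_map (K \<times>\<times> H) (\<one>\<^bsub>K\<^esub>, u) ` ?D v = (\<lambda>(k, g). (k, conj_map H u (\<phi> (conj_map G (inv\<^bsub>G\<^esub> v) g)))) ` D"
        unfolding image_image using D' c by (intro image_cong) auto
      show ?thesis
      proof
        assume l: ?l
        show ?r unfolding im
        proof (intro conjI subsetI)
          fix g assume "g \<in> snd ` D"
          then obtain k where "(k, g) \<in> D" by auto
          then show "g \<in> conj_map G v ` P" using l inB[OF v] by blast
        next
          fix z assume "z \<in> (\<lambda>(k, g). (k, conj_map H u (\<phi> (conj_map G (inv\<^bsub>G\<^esub> v) g)))) ` D"
          then obtain k g where z: "(k, g) \<in> D" "z = (k, conj_map H u (\<phi> (conj_map G (inv\<^bsub>G\<^esub> v) g)))" by auto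
          then show "z \<in> A" using l inB[OF v] by fastforce
        qed
      next
        assume r: ?r
        show ?l
        proof (intro ballI, clarify)
          fix k g assume kg: "(k, g) \<in> D"
          have g: "g \<in> conj_map G v ` P" using r kg by force
          then have "conj_map G (inv\<^bsub>G\<^esub> v) g \<in> P" using G.conj_map_inv_conj[OF v] sub by auto
          then have "conj_map H u (\<phi> (conj_map G (inv\<^bsub>G\<^esub> v) g)) \<in> carrier H" using \<phi>cl u by (simp add: H.conj_map_closed)
          moreover have "(k, conj_map H u (\<phi> (conj_map G (inv\<^bsub>G\<^esub> v) g))) \<in> A" using r kg unfolding im by force
          ultimately show "\<exists>h\<in>carrier H. (k, h) \<in> A \<and> (h, g) \<in> ?B u v" unfolding inB[OF v] using g by blast
        qed
      qed
    qed
    ultimately show ?thesis unfolding tensor_weight_def mark_weight_def by (simp split: if_splits)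
  qed
  let ?n = "of_nat (card (carrier H)) :: rat"
  have "?n * (of_nat (card P) * mark (K \<times>\<times> G) D (biset_mult G H K b (biset_single G H P \<phi>))) =
      burnside_weight (K \<times>\<times> H) (\<lambda>A. of_nat (card P) * burnside_weight (H \<times>\<times> G) (tensor_weight G H K D A) (biset_single G H P \<phi>)) b"
    unfolding burnside_weight_functional_scale[OF b] mark_biset_mult[OF b a D, symmetric] by simp
  also have "\<dots> = burnside_weight (K \<times>\<times> H) (\<lambda>A. \<Sum>u\<in>carrier H. \<Sum>v\<in>carrier G. tensor_weight G H K D A (?B u v)) b"
    unfolding weight_biset_single[OF P \<phi>] ..
  also have "\<dots> = burnside_weight (K \<times>\<times> H) (\<lambda>A. \<Sum>u\<in>carrier H. \<Sum>v | v \<in> carrier G \<and> snd ` D \<subseteq> conj_map G v ` P.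
      mark_weight (conj_map (K \<times>\<times> H) (\<one>\<^bsub>K\<^esub>, u) ` ?D v) A) b"
  proof (rule burnside_weight_cong[OF b], rule sum.cong[OF refl])
    fix A u assume A: "subgroup A (K \<times>\<times> H)" and u: "u \<in> carrier H"
    show "(\<Sum>v\<in>carrier G. tensor_weight G H K D A (?B u v)) = (\<Sum>v | v \<in> carrier G \<and> snd ` D \<subseteq> conj_map G v ` P.
        mark_weight (conj_map (K \<times>\<times> H) (\<one>\<^bsub>K\<^esub>, u) ` ?D v) A)"
      unfolding sum.inter_filter[OF G.finite_carrier] by (rule sum.cong[OF refl W[OF A u]])
  qed
  also have "\<dots> = (\<Sum>u\<in>carrier H. \<Sum>v | v \<in> carrier G \<and> snd ` D \<subseteq> conj_map G v ` P.
      mark (K \<times>\<times> H) (conj_map (K \<times>\<times> H) (\<one>\<^bsub>K\<^esub>, u) ` ?D v) b)"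
    unfolding burnside_weight_functional_sum[OF b] mark_def ..
  also have "\<dots> = (\<Sum>u\<in>carrier H. \<Sum>v | v \<in> carrier G \<and> snd ` D \<subseteq> conj_map G v ` P. mark (K \<times>\<times> H) (?D v) b)"
  proof (intro sum.cong refl)
    fix u v assume u: "u \<in> carrier H" and "v \<in> {v. v \<in> carrier G \<and> snd ` D \<subseteq> conj_map G v ` P}"
    then have v: "v \<in> carrier G" "snd ` D \<subseteq> conj_map G v ` P" by auto
    have "?D v \<subseteq> carrier (K \<times>\<times> H)"
    proof
      fix z assume "z \<in> ?D v"
      then obtain k g where z: "(k, g) \<in> D" "z = (k, \<phi> (conj_map G (inv\<^bsub>G\<^esub> v) g))" by auto
      then have "g \<in> conj_map G v ` P" using v by force
      then have "conj_map G (inv\<^bsub>G\<^esub> v) g \<in> P" using G.conj_map_inv_conj[OF v(1)] sub by auto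
      then show "z \<in> carrier (K \<times>\<times> H)" using z D' \<phi>cl by auto
    qed
    then show "mark (K \<times>\<times> H) (conj_map (K \<times>\<times> H) (\<one>\<^bsub>K\<^esub>, u) ` ?D v) b = mark (K \<times>\<times> H) (?D v) b"
      using KH.mark_conj[OF b] u by simp
  qed
  finally show ?thesis using H.subgroup_card_pos[OF H.subgroup_self] by simp
qed

text \<open>Composition with the biset of a homomorphism \<open>\<phi>\<close> defined on all of \<open>G\<close> is restriction along \<open>\<phi>\<close>: the
conjugation by \<open>v\<close> becomes conjugation by \<open>\<phi> v\<close>, and all summands are equal.\<close>

lemma mark_biset_mult_restrict_right:
  assumes b: "b \<in> carrier (gset_ring p (K \<times>\<times> H))" and \<phi>: "\<phi> \<in> hom G H" and D: "D \<subseteq> carrier (K \<times>\<times> G)"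
  shows "mark (K \<times>\<times> G) D (biset_mult G H K b (biset_single G H (carrier G) \<phi>)) =
    mark (K \<times>\<times> H) ((\<lambda>(k, g). (k, \<phi> g)) ` D) b"
proof -
  interpret \<phi>: group_hom G H \<phi> using \<phi> by unfold_locales
  have D': "k \<in> carrier K" "g \<in> carrier G" if "(k, g) \<in> D" for k g using D that by auto
  have "snd ` D \<subseteq> carrier G" using D' by auto
  then have surj: "{v. v \<in> carrier G \<and> snd ` D \<subseteq> conj_map G v ` carrier G} = carrier G"
    by (auto simp: G.conj_image_carrier)
  have "of_nat (card (carrier G)) * mark (K \<times>\<times> G) D (biset_mult G H K b (biset_single G H (carrier G) \<phi>)) =
    (\<Sum>v\<in>carrier G. mark (K \<times>\<times> H) ((\<lambda>(k, g). (k, \<phi> (conj_map G (inv\<^bsub>G\<^esub> v) g))) ` D) b)"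
    using mark_biset_mult_single_right[OF b G.subgroup_self _ D, of \<phi>] \<phi> unfolding surj by simp
  also have "\<dots> = (\<Sum>v\<in>carrier G. mark (K \<times>\<times> H) ((\<lambda>(k, g). (k, \<phi> g)) ` D) b)"
  proof (rule sum.cong[OF refl])
    fix v assume v: "v \<in> carrier G"
    have "(\<lambda>(k, g). (k, \<phi> (conj_map G (inv\<^bsub>G\<^esub> v) g))) ` D =
        conj_map (K \<times>\<times> H) (\<one>\<^bsub>K\<^esub>, inv\<^bsub>H\<^esub> (\<phi> v)) ` (\<lambda>(k, g). (k, \<phi> g)) ` D"
      unfolding image_image
    proof (rule image_cong[OF refl], clarify)
      fix k g assume "(k, g) \<in> D"
      then show "(k, \<phi> (conj_map G (inv\<^bsub>G\<^esub> v) g)) = conj_map (K \<times>\<times> H) (\<one>\<^bsub>K\<^esub>, inv\<^bsub>H\<^esub> (\<phi> v)) (k, \<phi> g)"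
        using D' v by (simp add: conj_map_DirProd[OF K.is_group H.is_group]) (simp add: conj_map_def)
    qed
    moreover have "(\<lambda>(k, g). (k, \<phi> g)) ` D \<subseteq> carrier (K \<times>\<times> H)" using D' by auto
    ultimately show "mark (K \<times>\<times> H) ((\<lambda>(k, g). (k, \<phi> (conj_map G (inv\<^bsub>G\<^esub> v) g))) ` D) b =
        mark (K \<times>\<times> H) ((\<lambda>(k, g). (k, \<phi> g)) ` D) b"
      using KH.mark_conj[OF b, of "(\<one>\<^bsub>K\<^esub>, inv\<^bsub>H\<^esub> (\<phi> v))"] v by simp
  qed
  finally show ?thesis using G.subgroup_card_pos[OF G.subgroup_self] by simp
qed

lemma inv_into_hom:
  assumes \<chi>: "\<chi> \<in> hom K H" and inj: "inj_on \<chi> (carrier K)"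
  shows "inv_into (carrier K) \<chi> \<in> hom (H\<lparr>carrier := \<chi> ` carrier K\<rparr>) K"
proof (rule homI)
  interpret \<chi>: group_hom K H \<chi> using \<chi> by unfold_locales
  let ?Q = "H\<lparr>carrier := \<chi> ` carrier K\<rparr>" and ?\<psi> = "inv_into (carrier K) \<chi>"
  show "?\<psi> w \<in> carrier K" if "w \<in> carrier ?Q" for w using that inj by auto
  fix w w' assume w: "w \<in> carrier ?Q" and w': "w' \<in> carrier ?Q"
  obtain k where k: "k \<in> carrier K" "w = \<chi> k" using w by auto
  obtain k' where k': "k' \<in> carrier K" "w' = \<chi> k'" using w' by auto
  have "?\<psi> (\<chi> (k \<otimes>\<^bsub>K\<^esub> k')) = k \<otimes>\<^bsub>K\<^esub> k'" using k k' inj by (intro inv_into_f_f) auto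
  then show "?\<psi> (w \<otimes>\<^bsub>?Q\<^esub> w') = ?\<psi> w \<otimes>\<^bsub>K\<^esub> ?\<psi> w'" using k k' inj by (simp add: inv_into_f_f)
qed

text \<open>The mirror image of the preceding lemma. Here the biset is the graph of the inverse of an injective
\<open>\<chi>\<close>, so \<open>k\<close> determines \<open>h\<close>, and composition is restriction along \<open>\<chi>\<close> on the left side.\<close>

lemma mark_biset_mult_restrict_left:
  assumes a: "a \<in> carrier (gset_ring p (H \<times>\<times> G))" and \<chi>: "\<chi> \<in> hom K H" and inj: "inj_on \<chi> (carrier K)"
    and D: "D \<subseteq> carrier (K \<times>\<times> G)"
  shows "mark (K \<times>\<times> G) D (biset_mult G H K (biset_single H K (\<chi> ` carrier K) (inv_into (carrier K) \<chi>)) a) =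
    mark (H \<times>\<times> G) ((\<lambda>(k, g). (\<chi> k, g)) ` D) a"
proof -
  interpret \<chi>: group_hom K H \<chi> using \<chi> by unfold_locales
  interpret HK: local_bisets H K K p by unfold_locales (rule prime_p)
  let ?Q = "\<chi> ` carrier K" and ?\<psi> = "inv_into (carrier K) \<chi>"
  have Q: "subgroup ?Q H" using \<chi>.subgroup_img_is_subgroup[OF K.subgroup_self] .
  note \<psi> = inv_into_hom[OF \<chi> inj]
  have cardQ: "card ?Q = card (carrier K)" using inj by (rule card_image)
  note b = HK.biset_single_formal[OF Q \<psi>]
  have D': "k \<in> carrier K" "g \<in> carrier G" if "(k, g) \<in> D" for k g using D that by auto
  let ?D = "(\<lambda>(k, g). (\<chi> k, g)) ` D"
  have D\<chi>: "?D \<subseteq> carrier (H \<times>\<times> G)" using D' by auto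
  let ?A = "\<lambda>u v. (\<lambda>w. (conj_map K u (?\<psi> w), conj_map H v w)) ` ?Q"
  have A: "(k, h) \<in> ?A u v \<longleftrightarrow> k \<in> carrier K \<and> h = conj_map H (v \<otimes>\<^bsub>H\<^esub> inv\<^bsub>H\<^esub> (\<chi> u)) (\<chi> k)"
    if u: "u \<in> carrier K" and v: "v \<in> carrier H" for u v k h
  proof
    assume "(k, h) \<in> ?A u v"
    then obtain l where l: "l \<in> carrier K" "k = conj_map K u (?\<psi> (\<chi> l))" "h = conj_map H v (\<chi> l)" by auto
    then have k: "k = conj_map K u l" using inj by (simp add: inv_into_f_f)
    then have "\<chi> k = conj_map H (\<chi> u) (\<chi> l)" using u l(1) by (simp add: conj_map_def)
    then have "conj_map H (inv\<^bsub>H\<^esub> (\<chi> u)) (\<chi> k) = \<chi> l" using u l(1) by (simp add: H.conj_map_inv_conj)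
    then show "k \<in> carrier K \<and> h = conj_map H (v \<otimes>\<^bsub>H\<^esub> inv\<^bsub>H\<^esub> (\<chi> u)) (\<chi> k)"
      using k u v l by (simp add: H.conj_map_conj[symmetric] K.conj_map_closed)
  next
    assume *: "k \<in> carrier K \<and> h = conj_map H (v \<otimes>\<^bsub>H\<^esub> inv\<^bsub>H\<^esub> (\<chi> u)) (\<chi> k)"
    let ?l = "conj_map K (inv\<^bsub>K\<^esub> u) k"
    have l: "?l \<in> carrier K" using * u by (simp add: K.conj_map_closed)
    have "\<chi> ?l = conj_map H (inv\<^bsub>H\<^esub> (\<chi> u)) (\<chi> k)" using * u by (simp add: conj_map_def)
    then have "h = conj_map H v (\<chi> ?l)" using * u v by (simp add: H.conj_map_conj)
    moreover have "k = conj_map K u (?\<psi> (\<chi> ?l))" using * u l inj by (simp add: inv_into_f_f K.conj_map_conj_inv)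
    ultimately show "(k, h) \<in> ?A u v" using l by blast
  qed
  have W: "tensor_weight G H K D (?A u v) B = mark_weight (conj_map (H \<times>\<times> G) (v \<otimes>\<^bsub>H\<^esub> inv\<^bsub>H\<^esub> (\<chi> u), \<one>\<^bsub>G\<^esub>) ` ?D) B"
    if B: "subgroup B (H \<times>\<times> G)" and u: "u \<in> carrier K" and v: "v \<in> carrier H" for B u v
  proof -
    let ?v = "v \<otimes>\<^bsub>H\<^esub> inv\<^bsub>H\<^esub> (\<chi> u)"
    have vc: "?v \<in> carrier H" using u v by simp
    have "(\<one>\<^bsub>H\<^esub>, \<one>\<^bsub>G\<^esub>) \<in> B" using subgroup.one_closed[OF B] by simp
    moreover have "conj_map H ?v \<one>\<^bsub>H\<^esub> = \<one>\<^bsub>H\<^esub>" using vc by (simp add: conj_map_def)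
    ultimately have "{h \<in> carrier H. (\<one>\<^bsub>K\<^esub>, h) \<in> ?A u v \<and> (h, \<one>\<^bsub>G\<^esub>) \<in> B} = {\<one>\<^bsub>H\<^esub>}"
      unfolding A[OF u v] by auto
    moreover have "(\<forall>(k, g)\<in>D. \<exists>h\<in>carrier H. (k, h) \<in> ?A u v \<and> (h, g) \<in> B) \<longleftrightarrow>
        conj_map (H \<times>\<times> G) (?v, \<one>\<^bsub>G\<^esub>) ` ?D \<subseteq> B"
    proof -
      have "conj_map (H \<times>\<times> G) (?v, \<one>\<^bsub>G\<^esub>) ` ?D = (\<lambda>(k, g). (conj_map H ?v (\<chi> k), g)) ` D"
        unfolding image_image
        using D' vc by (intro image_cong) (auto simp: conj_map_DirProd[OF H.is_group G.is_group])
      note im = this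
      have iff: "(\<exists>h\<in>carrier H. (k, h) \<in> ?A u v \<and> (h, g) \<in> B) \<longleftrightarrow> (conj_map H ?v (\<chi> k), g) \<in> B"
        if "(k, g) \<in> D" for k g
        unfolding A[OF u v] using D'[OF that] H.conj_map_closed[OF vc] by auto
      show ?thesis unfolding im image_subset_iff
      proof (rule ball_cong[OF refl])
        fix e assume e: "e \<in> D"
        obtain k g where kg: "e = (k, g)" by (cases e)
        show "(case e of (k, g) \<Rightarrow> \<exists>h\<in>carrier H. (k, h) \<in> ?A u v \<and> (h, g) \<in> B) \<longleftrightarrow>
            (case e of (k, g) \<Rightarrow> (conj_map H ?v (\<chi> k), g)) \<in> B"
          using iff[of k g] e unfolding kg by (simp only: prod.case)
      qed
    qed
    ultimately show ?thesis unfolding tensor_weight_def mark_weight_def by simp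
  qed
  let ?b = "biset_single H K ?Q ?\<psi>"
  have "of_nat (card ?Q) * (of_nat (card (carrier H)) * mark (K \<times>\<times> G) D (biset_mult G H K ?b a)) =
      (\<Sum>u\<in>carrier K. \<Sum>v\<in>carrier H. burnside_weight (H \<times>\<times> G) (tensor_weight G H K D (?A u v)) a)"
    unfolding mark_biset_mult[OF b a D] by (rule HK.weight_biset_single[OF Q \<psi>])
  also have "\<dots> = (\<Sum>u\<in>carrier K. \<Sum>v\<in>carrier H. mark (H \<times>\<times> G) ?D a)"
  proof (intro sum.cong refl)
    fix u v assume u: "u \<in> carrier K" and v: "v \<in> carrier H"
    have "burnside_weight (H \<times>\<times> G) (tensor_weight G H K D (?A u v)) a =
        mark (H \<times>\<times> G) (conj_map (H \<times>\<times> G) (v \<otimes>\<^bsub>H\<^esub> inv\<^bsub>H\<^esub> (\<chi> u), \<one>\<^bsub>G\<^esub>) ` ?D) a"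
      unfolding mark_def by (rule burnside_weight_cong[OF a]) (rule W[OF _ u v])
    then show "burnside_weight (H \<times>\<times> G) (tensor_weight G H K D (?A u v)) a = mark (H \<times>\<times> G) ?D a"
      using HG.mark_conj[OF a _ D\<chi>] u v by simp
  qed
  finally show ?thesis
    using H.subgroup_card_pos[OF H.subgroup_self] K.subgroup_card_pos[OF K.subgroup_self] cardQ by simp
qed

end

section \<open>Morphisms of a fusion system and their graphs\<close>

lemma twisted_diagonal_image: "twisted_diagonal P \<phi> = (\<lambda>u. (\<phi> u, u)) ` P"
  by (auto simp: twisted_diagonal_def)

context fusion_system
begin

sublocale local_burnside S p
proof
  obtain n where n: "order S = p ^ n" using order_power by blast
  show "finite (carrier S)" using n prime by (metis card.infinite order_def power_not_zero not_prime_0)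
  show "Factorial_Ring.prime p" by (rule prime)
qed

sublocale B: local_bisets S S S p
  by unfold_locales (rule prime)

abbreviation SS :: "('a \<times> 'a) monoid" where "SS \<equiv> S \<times>\<times> S"

abbreviation sub :: "'a set \<Rightarrow> 'a monoid" where "sub P \<equiv> S\<lparr>carrier := P\<rparr>"

text \<open>Morphisms into \<open>S\<close> suffice: a morphism into a subgroup \<open>Q\<close> is the same as a morphism into \<open>S\<close> with image in
\<open>Q\<close> (\<open>F_mor\<close> and \<open>mor_F\<close>).\<close>

definition mor :: "'a set \<Rightarrow> ('a \<Rightarrow> 'a) \<Rightarrow> bool"
  where "mor P \<phi> \<longleftrightarrow> subgroup P S \<and> \<phi> \<in> F P (carrier S)"

lemma mor_subgroup: "mor P \<phi> \<Longrightarrow> subgroup P S"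
  and mor_in: "mor P \<phi> \<Longrightarrow> \<phi> \<in> F P (carrier S)"
  by (simp_all add: mor_def)

lemma F_funcset: "\<lbrakk>subgroup P S; subgroup Q S; \<phi> \<in> F P Q; u \<in> P\<rbrakk> \<Longrightarrow> \<phi> u \<in> Q"
  using mor_mon[of P Q \<phi>] by (auto simp: mon_def hom_def)

lemma F_extensional: "\<lbrakk>subgroup P S; subgroup Q S; \<phi> \<in> F P Q\<rbrakk> \<Longrightarrow> \<phi> \<in> extensional P"
  using mor_mon by blast

lemma mor_closed: "\<lbrakk>mor P \<phi>; u \<in> P\<rbrakk> \<Longrightarrow> \<phi> u \<in> carrier S"
  using F_funcset subgroup_self by (auto simp: mor_def)

lemma mor_extensional: "mor P \<phi> \<Longrightarrow> \<phi> \<in> extensional P"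
  using F_extensional subgroup_self by (auto simp: mor_def)

lemma mor_inj: "mor P \<phi> \<Longrightarrow> inj_on \<phi> P"
  using mor_mon[OF _ subgroup_self] by (auto simp: mor_def mon_def)

lemma mor_hom: "mor P \<phi> \<Longrightarrow> \<phi> \<in> hom (sub P) S"
  using mor_mon[OF _ subgroup_self, of P \<phi>] by (auto simp: mor_def mon_def)

lemma mor_mult: "\<lbrakk>mor P \<phi>; u \<in> P; v \<in> P\<rbrakk> \<Longrightarrow> \<phi> (u \<otimes> v) = \<phi> u \<otimes> \<phi> v"
  using hom_mult[OF mor_hom] by fastforce

lemma mor_group_hom: "mor P \<phi> \<Longrightarrow> group_hom (sub P) S \<phi>"
  using mor_hom subgroup_imp_group[OF mor_subgroup] by (simp add: group_hom_def group_hom_axioms_def is_group)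

lemma mor_inv: "\<lbrakk>mor P \<phi>; u \<in> P\<rbrakk> \<Longrightarrow> \<phi> (inv u) = inv (\<phi> u)"
  using group_hom.hom_inv[OF mor_group_hom] m_inv_consistent[OF mor_subgroup] by fastforce

lemma mor_image_subgroup: "mor P \<phi> \<Longrightarrow> subgroup (\<phi> ` P) S"
  using group_hom.subgroup_img_is_subgroup[OF mor_group_hom] group.subgroup_self[OF subgroup_imp_group[OF mor_subgroup]]
  by fastforce

lemma mor_conj_map: "\<lbrakk>subgroup P S; x \<in> carrier S\<rbrakk> \<Longrightarrow> mor P (restrict (conj_map S x) P)"
  using mor_conj[OF _ subgroup_self, of P x] conj_map_closed subgroup.subset[of P S]
  by (auto simp: mor_def)

lemma F_inclusion:
  assumes P: "subgroup P S" and Q: "subgroup Q S" and PQ: "P \<subseteq> Q" shows "(\<lambda>u\<in>P. u) \<in> F P Q"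
proof -
  have eq: "conj_map S \<one> u = u" if "u \<in> P" for u using that subgroup.subset[OF P] by auto
  then have "restrict (conj_map S \<one>) P = (\<lambda>u\<in>P. u)" "conj_map S \<one> ` P \<subseteq> Q" using PQ by auto
  then show ?thesis using mor_conj[OF P Q one_closed] by simp
qed

lemma mor_incl: "subgroup P S \<Longrightarrow> mor P (\<lambda>u\<in>P. u)"
  using F_inclusion[OF _ subgroup_self] subgroup.subset by (auto simp: mor_def)

lemma F_mor:
  assumes P: "subgroup P S" and Q: "subgroup Q S" and \<phi>: "\<phi> \<in> F P Q" shows "mor P \<phi>"
proof -
  have "compose P (\<lambda>u\<in>Q. u) \<phi> \<in> F P (carrier S)"
    using mor_compose[OF P Q subgroup_self \<phi> F_inclusion[OF Q subgroup_self subgroup.subset[OF Q]]] .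
  moreover have "compose P (\<lambda>u\<in>Q. u) \<phi> = \<phi>"
    using F_funcset[OF P Q \<phi>] F_extensional[OF P Q \<phi>] by (auto simp: compose_def extensional_def fun_eq_iff)
  ultimately show ?thesis using P by (simp add: mor_def)
qed

lemma mor_F:
  assumes \<phi>: "mor P \<phi>" and Q: "subgroup Q S" and im: "\<phi> ` P \<subseteq> Q" shows "\<phi> \<in> F P Q"
proof -
  note P = mor_subgroup[OF \<phi>] and I = mor_image_subgroup[OF \<phi>]
  have "\<phi> \<in> F P (\<phi> ` P)" using mor_image[OF P subgroup_self] \<phi> by (simp add: mor_def)
  then have "compose P (\<lambda>u\<in>\<phi> ` P. u) \<phi> \<in> F P Q" using mor_compose[OF P I Q _ F_inclusion[OF I Q im]] by blast
  moreover have "compose P (\<lambda>u\<in>\<phi> ` P. u) \<phi> = \<phi>"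
    using mor_extensional[OF \<phi>] by (auto simp: compose_def extensional_def fun_eq_iff)
  ultimately show ?thesis by simp
qed

lemma F_Bij:
  assumes P: "subgroup P S" and \<phi>: "\<phi> \<in> F P P" shows "\<phi> \<in> Bij P"
proof -
  have "inj_on \<phi> P" using mor_inj[OF F_mor[OF P P \<phi>]] .
  moreover from this have "\<phi> ` P = P"
    using F_funcset[OF P P \<phi>] subgroup_finite[OF P] by (metis endo_inj_surj image_subsetI)
  ultimately show ?thesis using F_extensional[OF P P \<phi>] by (simp add: Bij_def bij_betw_def)
qed

lemma mor_comp:
  assumes \<phi>: "mor P \<phi>" and \<psi>: "mor Q \<psi>" and im: "\<phi> ` P \<subseteq> Q" shows "mor P (compose P \<psi> \<phi>)"
  using mor_compose[OF mor_subgroup[OF \<phi>] mor_subgroup[OF \<psi>] subgroup_self mor_F[OF \<phi> mor_subgroup[OF \<psi>] im] mor_in[OF \<psi>]]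
    mor_subgroup[OF \<phi>] by (simp add: mor_def)

lemma mor_restrict:
  assumes \<phi>: "mor P \<phi>" and Q: "subgroup Q S" and QP: "Q \<subseteq> P" shows "mor Q (restrict \<phi> Q)"
proof -
  have "mor Q (compose Q \<phi> (\<lambda>u\<in>Q. u))" by (rule mor_comp[OF mor_incl[OF Q] \<phi>]) (use QP in auto)
  moreover have "compose Q \<phi> (\<lambda>u\<in>Q. u) = restrict \<phi> Q" by (auto simp: compose_def fun_eq_iff)
  ultimately show ?thesis by simp
qed

lemma mor_inverse':
  assumes \<phi>: "mor P \<phi>" shows "mor (\<phi> ` P) (restrict (inv_into P \<phi>) (\<phi> ` P))"
  using F_mor[OF mor_image_subgroup[OF \<phi>] mor_subgroup[OF \<phi>]
      mor_inverse[OF mor_subgroup[OF \<phi>] subgroup_self mor_in[OF \<phi>]]] .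

lemma finite_F: "subgroup P S \<Longrightarrow> finite (F P (carrier S))"
proof (rule finite_subset)
  assume P: "subgroup P S"
  show "F P (carrier S) \<subseteq> P \<rightarrow>\<^sub>E carrier S"
    using F_extensional[OF P subgroup_self] F_funcset[OF P subgroup_self] by (auto simp: PiE_def)
  show "finite (P \<rightarrow>\<^sub>E carrier S)" using subgroup_finite[OF P] finite_carrier by (simp add: finite_PiE)
qed

lemma F_nonempty: "subgroup P S \<Longrightarrow> F P (carrier S) \<noteq> {}"
  using mor_incl by (auto simp: mor_def)

text \<open>Subgroups that are graphs of morphisms, with the values in the first coordinate.\<close>

definition fdiag :: "('a \<times> 'a) set \<Rightarrow> bool"
  where "fdiag D \<longleftrightarrow> (\<exists>P \<phi>. mor P \<phi> \<and> D = twisted_diagonal P \<phi>)"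

lemma fdiagI: "mor P \<phi> \<Longrightarrow> fdiag (twisted_diagonal P \<phi>)"
  by (auto simp: fdiag_def)

lemma twisted_diagonal_subgroup: "mor P \<phi> \<Longrightarrow> subgroup (twisted_diagonal P \<phi>) SS"
  by (intro subgroup_twisted_diagonal is_group mor_subgroup mor_hom)

lemma fdiag_subgroup: "fdiag D \<Longrightarrow> subgroup D SS"
  using twisted_diagonal_subgroup by (auto simp: fdiag_def)

lemma snd_twisted_diagonal [simp]: "snd ` twisted_diagonal P \<phi> = P"
  by (force simp: twisted_diagonal_def)

lemma fst_twisted_diagonal [simp]: "fst ` twisted_diagonal P \<phi> = \<phi> ` P"
  by (force simp: twisted_diagonal_def)

lemma twisted_diagonal_cong: "(\<And>u. u \<in> P \<Longrightarrow> \<phi> u = \<psi> u) \<Longrightarrow> twisted_diagonal P \<phi> = twisted_diagonal P \<psi>"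
  by (auto simp: twisted_diagonal_def)

lemma fst_map_twisted_diagonal:
  "(\<lambda>(a, b). (\<psi> a, b)) ` twisted_diagonal P \<phi> = twisted_diagonal P (compose P \<psi> \<phi>)"
  unfolding twisted_diagonal_image image_image by (rule image_cong) (auto simp: compose_def)

text \<open>The elements \<open>(\<phi> u, \<psi> u)\<close> form the graph of \<open>\<phi>\<close> composed with the inverse of \<open>\<psi>\<close>.\<close>

lemma snd_map_twisted_diagonal:
  assumes \<phi>: "mor P \<phi>" and \<psi>: "mor Q \<psi>" and PQ: "P \<subseteq> Q"
  obtains \<phi>' where "mor (\<psi> ` P) \<phi>'" "(\<lambda>(a, b). (a, \<psi> b)) ` twisted_diagonal P \<phi> = twisted_diagonal (\<psi> ` P) \<phi>'"
proof -
  let ?r = "restrict \<psi> P"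
  note r = mor_restrict[OF \<psi> mor_subgroup[OF \<phi>] PQ]
  let ?i = "restrict (inv_into P ?r) (?r ` P)"
  have im: "?r ` P = \<psi> ` P" by auto
  have i: "mor (\<psi> ` P) ?i" using mor_inverse'[OF r] im by simp
  have ir: "?i (\<psi> u) = u" if "u \<in> P" for u
    using that inv_into_f_f[OF mor_inj[OF r] that] by auto
  have sub: "?i ` (\<psi> ` P) \<subseteq> P"
  proof
    fix z assume "z \<in> ?i ` (\<psi> ` P)"
    then obtain u where "u \<in> P" "z = ?i (\<psi> u)" by blast
    then show "z \<in> P" using ir by (simp only:)
  qed
  have "mor (\<psi> ` P) (compose (\<psi> ` P) \<phi> ?i)" using mor_comp[OF i \<phi> sub] .
  moreover have "(\<lambda>(a, b). (a, \<psi> b)) ` twisted_diagonal P \<phi> = twisted_diagonal (\<psi> ` P) (compose (\<psi> ` P) \<phi> ?i)"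
    unfolding twisted_diagonal_image image_image
  proof (rule image_cong[OF refl])
    fix u assume u: "u \<in> P"
    have "compose (\<psi> ` P) \<phi> ?i (\<psi> u) = \<phi> u" unfolding compose_eq[OF imageI[OF u]] ir[OF u] ..
    then show "(case (\<phi> u, u) of (a, b) \<Rightarrow> (a, \<psi> b)) = (compose (\<psi> ` P) \<phi> ?i (\<psi> u), \<psi> u)" by simp
  qed
  ultimately show thesis by (rule that)
qed

lemma fdiag_fst_map:
  assumes D: "fdiag D" and \<psi>: "mor Q \<psi>" and sub: "fst ` D \<subseteq> Q"
  shows "fdiag ((\<lambda>(a, b). (\<psi> a, b)) ` D)"
proof -
  obtain P \<phi> where P: "mor P \<phi>" "D = twisted_diagonal P \<phi>" using D by (auto simp: fdiag_def)
  have "mor P (compose P \<psi> \<phi>)" using mor_comp[OF P(1) \<psi>] sub P(2) by simp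
  then show ?thesis unfolding P(2) fst_map_twisted_diagonal by (rule fdiagI)
qed

lemma fdiag_snd_map:
  assumes D: "fdiag D" and \<psi>: "mor Q \<psi>" and sub: "snd ` D \<subseteq> Q"
  shows "fdiag ((\<lambda>(a, b). (a, \<psi> b)) ` D)"
proof -
  obtain P \<phi> where P: "mor P \<phi>" "D = twisted_diagonal P \<phi>" using D by (auto simp: fdiag_def)
  have PQ: "P \<subseteq> Q" using sub P(2) by simp
  show ?thesis unfolding P(2) using snd_map_twisted_diagonal[OF P(1) \<psi> PQ] fdiagI by metis
qed

lemma inverse_image_id:
  assumes \<psi>: "mor Q \<psi>" and "A \<subseteq> Q"
  shows "\<And>a. a \<in> A \<Longrightarrow> restrict (inv_into Q \<psi>) (\<psi> ` Q) (\<psi> a) = a"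
  using assms inv_into_f_f[OF mor_inj[OF \<psi>]] by auto

lemma fdiag_fst_map_iff:
  assumes \<psi>: "mor Q \<psi>" and sub: "fst ` D \<subseteq> Q"
  shows "fdiag ((\<lambda>(a, b). (\<psi> a, b)) ` D) \<longleftrightarrow> fdiag D"
proof
  assume f: "fdiag ((\<lambda>(a, b). (\<psi> a, b)) ` D)"
  have "fst ` (\<lambda>(a, b). (\<psi> a, b)) ` D \<subseteq> \<psi> ` Q" using sub by force
  from fdiag_fst_map[OF f mor_inverse'[OF \<psi>] this]
  have "fdiag ((\<lambda>(a, b). (restrict (inv_into Q \<psi>) (\<psi> ` Q) a, b)) ` (\<lambda>(a, b). (\<psi> a, b)) ` D)" .
  moreover have "(\<lambda>(a, b). (restrict (inv_into Q \<psi>) (\<psi> ` Q) a, b)) ` (\<lambda>(a, b). (\<psi> a, b)) ` D = (\<lambda>e. e) ` D"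
    unfolding image_image using inverse_image_id[OF \<psi> sub] by (intro image_cong) (force simp del: restrict_apply)+
  ultimately show "fdiag D" by simp
qed (rule fdiag_fst_map[OF _ \<psi> sub])

lemma fdiag_snd_map_iff:
  assumes \<psi>: "mor Q \<psi>" and sub: "snd ` D \<subseteq> Q"
  shows "fdiag ((\<lambda>(a, b). (a, \<psi> b)) ` D) \<longleftrightarrow> fdiag D"
proof
  assume f: "fdiag ((\<lambda>(a, b). (a, \<psi> b)) ` D)"
  have "snd ` (\<lambda>(a, b). (a, \<psi> b)) ` D \<subseteq> \<psi> ` Q" using sub by force
  from fdiag_snd_map[OF f mor_inverse'[OF \<psi>] this]
  have "fdiag ((\<lambda>(a, b). (a, restrict (inv_into Q \<psi>) (\<psi> ` Q) b)) ` (\<lambda>(a, b). (a, \<psi> b)) ` D)" .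
  moreover have "(\<lambda>(a, b). (a, restrict (inv_into Q \<psi>) (\<psi> ` Q) b)) ` (\<lambda>(a, b). (a, \<psi> b)) ` D = (\<lambda>e. e) ` D"
    unfolding image_image using inverse_image_id[OF \<psi> sub] by (intro image_cong) (force simp del: restrict_apply)+
  ultimately show "fdiag D" by simp
qed (rule fdiag_snd_map[OF _ \<psi> sub])

lemma snd_image_subgroup: "subgroup D SS \<Longrightarrow> subgroup (snd ` D) S"
proof -
  assume D: "subgroup D SS"
  have "group_hom SS S snd"
    using DirProd_group[OF is_group is_group] by unfold_locales (auto simp: hom_def group_def mult_DirProd')
  then show ?thesis by (rule group_hom.subgroup_img_is_subgroup[OF _ D])
qed

lemma fdiag_subset:
  assumes D: "fdiag D" and E: "subgroup E SS" and ED: "E \<subseteq> D" shows "fdiag E"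
proof -
  obtain P \<phi> where P: "mor P \<phi>" "D = twisted_diagonal P \<phi>" using D by (auto simp: fdiag_def)
  have sub: "snd ` E \<subseteq> P" using image_mono[OF ED, of snd] P(2) by simp
  have "mor (snd ` E) (restrict \<phi> (snd ` E))" by (rule mor_restrict[OF P(1) snd_image_subgroup[OF E] sub])
  moreover have "E = twisted_diagonal (snd ` E) (restrict \<phi> (snd ` E))"
    using ED P(2) unfolding twisted_diagonal_def by force
  ultimately show ?thesis using fdiagI by metis
qed

lemma conj_map_SS: "\<lbrakk>x \<in> carrier S; y \<in> carrier S\<rbrakk> \<Longrightarrow> conj_map SS (x, y) (a, b) = (conj_map S x a, conj_map S y b)"
  by (rule conj_map_DirProd[OF is_group is_group])

lemma fdiag_conj:
  assumes D: "fdiag D" and e: "e \<in> carrier SS" shows "fdiag (conj_map SS e ` D)"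
proof -
  obtain x y where xy: "e = (x, y)" "x \<in> carrier S" "y \<in> carrier S" using e by auto
  have sub: "D \<subseteq> carrier S \<times> carrier S" using subgroup.subset[OF fdiag_subgroup[OF D]] by simp
  let ?x = "restrict (conj_map S x) (carrier S)" and ?y = "restrict (conj_map S y) (carrier S)"
  have 1: "fdiag ((\<lambda>(a, b). (?x a, b)) ` D)"
    using sub by (intro fdiag_fst_map[OF D mor_conj_map[OF subgroup_self xy(2)]]) auto
  have "fdiag ((\<lambda>(a, b). (a, ?y b)) ` (\<lambda>(a, b). (?x a, b)) ` D)"
    using sub by (intro fdiag_snd_map[OF 1 mor_conj_map[OF subgroup_self xy(3)]]) auto
  moreover have "(\<lambda>(a, b). (a, ?y b)) ` (\<lambda>(a, b). (?x a, b)) ` D = conj_map SS e ` D"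
    unfolding image_image using sub xy by (intro image_cong) (auto simp: conj_map_SS)
  ultimately show ?thesis by simp
qed

section \<open>Generation and stability in terms of marks\<close>

text \<open>Vanishing outside the graphs of morphisms characterizes generated elements (\<open>biset_generated_iff\<close>).\<close>

definition fgen :: "(('a \<times> 'a, nat) gset set \<Rightarrow>\<^sub>0 rat) \<Rightarrow> bool"
  where "fgen f \<longleftrightarrow> (\<forall>D. subgroup D SS \<longrightarrow> \<not> fdiag D \<longrightarrow> mark SS D f = 0)"

definition fclasses :: "('a \<times> 'a, nat) gset set set"
  where "fclasses = {iso_class SS (transitive_biset S S P \<phi>) | P \<phi>. mor P \<phi>}"

lemma fclassesE:
  assumes "k \<in> fclasses"
  obtains P \<phi> where "mor P \<phi>" "k = iso_class SS (coset_gset SS (twisted_diagonal P \<phi>))"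
  using assms by (auto simp: fclasses_def transitive_biset_def)

lemma fclasses_sub: "fclasses \<subseteq> iso_classes SS"
  using iso_class_in_iso_classes[OF B.KG.is_gset_coset[OF twisted_diagonal_subgroup]]
  by (auto simp: fclasses_def transitive_biset_def)

text \<open>A point of the biset of \<open>\<phi>\<close> fixed by \<open>D\<close> puts \<open>D\<close> into a conjugate of the graph of \<open>\<phi>\<close>. Conjugates and
subgroups of graphs of morphisms are such graphs.\<close>

lemma mark_class_not_fdiag:
  assumes D: "subgroup D SS" and nf: "\<not> fdiag D" and k: "k \<in> fclasses"
  shows "class_weight SS (mark_weight D) k = 0"
proof -
  obtain P \<phi> where P: "mor P \<phi>" "k = iso_class SS (coset_gset SS (twisted_diagonal P \<phi>))" using k by (rule fclassesE)
  note E = twisted_diagonal_subgroup[OF P(1)]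
  have "fixed_points D (coset_gset SS (twisted_diagonal P \<phi>)) = {}"
  proof (rule ccontr)
    assume "fixed_points D (coset_gset SS (twisted_diagonal P \<phi>)) \<noteq> {}"
    then obtain e where "e \<in> carrier SS" "D \<subseteq> conj_map SS e ` twisted_diagonal P \<phi>"
      using B.KG.fixed_points_coset_nonempty[OF E subgroup.subset[OF D]] by metis
    then show False using nf fdiag_subset[OF fdiag_conj[OF fdiagI[OF P(1)]] D] by blast
  qed
  then show ?thesis
    unfolding P(2) class_weight_iso_class[OF B.KG.is_gset_coset[OF E]]
    by (simp add: orbit_weight_mark[OF B.KG.is_gset_coset[OF E] subgroup.subset[OF D]])
qed

lemma fgen_fclasses: "Poly_Mapping.keys f \<subseteq> fclasses \<Longrightarrow> fgen f"
  unfolding fgen_def mark_def burnside_weight_def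
  using lin_cong[of f fclasses _ "\<lambda>_. 0"] mark_class_not_fdiag by (auto simp: lin_def intro!: sum.neutral)

text \<open>Take a combination \<open>h\<close> of transitive classes that represents \<open>f\<close>. If it involved classes outside
\<open>fclasses\<close>, triangularity would give their part a nonzero mark at some subgroup that is not a graph;
but there the marks of \<open>f\<close> and of the rest of \<open>h\<close> vanish.\<close>

lemma fgen_decomposition:
  assumes f: "f \<in> carrier (gset_ring p SS)" and gen: "fgen f"
  obtains h where "h \<in> carrier (gset_ring p SS)" "Poly_Mapping.keys h \<subseteq> fclasses"
    "burnside_coset p SS f = burnside_coset p SS h" "\<forall>D. mark SS D h = mark SS D f"
proof -
  obtain h where h: "h \<in> carrier (gset_ring p SS)" "Poly_Mapping.keys h \<subseteq> B.KG.transitive_classes" "f - h \<in> gset_rel p SS"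
    using B.KG.transitive_decomposition[OF f] by blast
  have marks: "mark SS D h = mark SS D f" for D
    using B.KG.mark_gset_rel[OF h(3), of D] by (simp add: mark_diff)
  let ?bad = "Poly_Mapping.keys h - fclasses" and ?s = "\<lambda>k. Poly_Mapping.single k (Poly_Mapping.lookup h k)"
  have look: "Poly_Mapping.lookup (sum ?s A) k = (if k \<in> A then Poly_Mapping.lookup h k else 0)"
    if "finite A" for A k using that by (simp add: lookup_sum lookup_single when_def)
  have keys: "Poly_Mapping.keys (sum ?s A) = A \<inter> Poly_Mapping.keys h" if "finite A" for A
    using look[OF that] by (auto simp: in_keys_iff split: if_splits)
  have split: "h = sum ?s (Poly_Mapping.keys h \<inter> fclasses) + sum ?s ?bad"
    by (rule poly_mapping_eqI) (auto simp: lookup_add look in_keys_iff)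
  have "sum ?s ?bad = 0"
  proof (rule ccontr)
    assume nz: "sum ?s ?bad \<noteq> 0"
    have sub: "Poly_Mapping.keys (sum ?s ?bad) \<subseteq> B.KG.transitive_classes" using h(2) by (auto simp: keys)
    obtain D where D: "subgroup D SS" "iso_class SS (coset_gset SS D) \<in> Poly_Mapping.keys (sum ?s ?bad)"
      "mark SS D (sum ?s ?bad) \<noteq> 0"
      by (rule B.KG.transitive_combination_mark[OF sub nz])
    have nf: "\<not> fdiag D"
    proof
      assume "fdiag D"
      then have "iso_class SS (coset_gset SS D) \<in> fclasses" by (auto simp: fdiag_def fclasses_def transitive_biset_def)
      then show False using D(2) by (simp add: keys)
    qed
    have "mark SS D h = 0" using marks gen nf D(1) by (simp add: fgen_def)
    moreover have "fgen (sum ?s (Poly_Mapping.keys h \<inter> fclasses))"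
      by (rule fgen_fclasses, subst keys) auto
    then have "mark SS D (sum ?s (Poly_Mapping.keys h \<inter> fclasses)) = 0" using nf D(1) unfolding fgen_def by blast
    moreover have "mark SS D h = mark SS D (sum ?s (Poly_Mapping.keys h \<inter> fclasses)) + mark SS D (sum ?s ?bad)"
      by (subst split) (rule mark_add)
    ultimately show False using D(3) by linarith
  qed
  then have "?bad \<inter> Poly_Mapping.keys h = {}" using keys[of ?bad] by simp
  then have "Poly_Mapping.keys h \<subseteq> fclasses" by blast
  moreover have "burnside_coset p SS f = burnside_coset p SS h"
    unfolding burnside_coset_eq_iff[OF prime] by (rule h(3))
  ultimately show thesis using that[OF h(1)] marks by simp
qed

lemma biset_generated_iff:
  assumes f: "f \<in> carrier (gset_ring p SS)"
  shows "biset_generated p S F (burnside_coset p SS f) \<longleftrightarrow> fgen f"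
proof
  assume "biset_generated p S F (burnside_coset p SS f)"
  then obtain h where h: "Poly_Mapping.keys h \<subseteq> fclasses" "burnside_coset p SS f = burnside_coset p SS h"
    unfolding biset_generated_def fclasses_def mor_def by auto
  have "mark SS D f = mark SS D h" for D
    using B.KG.mark_coset[of f h] burnside_coset_self[OF prime, of f SS] h(2) by metis
  then show "fgen f" using fgen_fclasses[OF h(1)] by (simp add: fgen_def)
next
  assume "fgen f"
  then obtain h where "h \<in> carrier (gset_ring p SS)" "Poly_Mapping.keys h \<subseteq> fclasses"
    "burnside_coset p SS f = burnside_coset p SS h" using fgen_decomposition[OF f] by metis
  then show "biset_generated p S F (burnside_coset p SS f)"
    unfolding biset_generated_def fclasses_def mor_def carrier_gset_ring by auto
qed

text \<open>On either side, restriction along \<open>\<psi>\<close> has the same marks as restriction along the inclusion of \<open>Q\<close>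
(\<open>biset_stable_iff\<close>).\<close>

definition fstable :: "(('a \<times> 'a, nat) gset set \<Rightarrow>\<^sub>0 rat) \<Rightarrow> bool"
  where "fstable f \<longleftrightarrow> (\<forall>Q \<psi> E. mor Q \<psi> \<longrightarrow> subgroup E SS \<longrightarrow>
    (snd ` E \<subseteq> Q \<longrightarrow> mark SS ((\<lambda>(a, b). (a, \<psi> b)) ` E) f = mark SS E f) \<and>
    (fst ` E \<subseteq> Q \<longrightarrow> mark SS ((\<lambda>(a, b). (\<psi> a, b)) ` E) f = mark SS E f))"

text \<open>A biset for \<open>S\<close> and a subgroup \<open>Q\<close> is a set for a subgroup of \<open>S \<times> S\<close>.\<close>

lemma DirProd_sub_right: "S \<times>\<times> sub Q = SS\<lparr>carrier := carrier S \<times> Q\<rparr>"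
  and DirProd_sub_left: "sub Q \<times>\<times> S = SS\<lparr>carrier := Q \<times> carrier S\<rparr>"
  by (simp_all add: DirProd_def)

lemma subgroup_DirProd_sub_iff:
  assumes Q: "subgroup Q S"
  shows "subgroup E (S \<times>\<times> sub Q) \<longleftrightarrow> subgroup E SS \<and> snd ` E \<subseteq> Q"
    and "subgroup E (sub Q \<times>\<times> S) \<longleftrightarrow> subgroup E SS \<and> fst ` E \<subseteq> Q"
proof -
  have SQ: "subgroup (carrier S \<times> Q) SS" "subgroup (Q \<times> carrier S) SS"
    by (intro DirProd_subgroups is_group subgroup_self Q)+
  have sub: "E \<subseteq> carrier S \<times> carrier S" if "subgroup E SS" using subgroup.subset[OF that] by simp
  show "subgroup E (S \<times>\<times> sub Q) \<longleftrightarrow> subgroup E SS \<and> snd ` E \<subseteq> Q"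
    unfolding DirProd_sub_right
  proof
    assume E: "subgroup E (SS\<lparr>carrier := carrier S \<times> Q\<rparr>)"
    have "snd ` E \<subseteq> Q" using subgroup.subset[OF E] by auto
    then show "subgroup E SS \<and> snd ` E \<subseteq> Q" using B.KG.incl_subgroup[OF SQ(1) E] by simp
  next
    assume E: "subgroup E SS \<and> snd ` E \<subseteq> Q"
    then have "E \<subseteq> carrier S \<times> Q" using sub by (auto simp: image_subset_iff)
    then show "subgroup E (SS\<lparr>carrier := carrier S \<times> Q\<rparr>)" using B.KG.subgroup_incl[OF _ SQ(1)] E by blast
  qed
  show "subgroup E (sub Q \<times>\<times> S) \<longleftrightarrow> subgroup E SS \<and> fst ` E \<subseteq> Q"
    unfolding DirProd_sub_left
  proof
    assume E: "subgroup E (SS\<lparr>carrier := Q \<times> carrier S\<rparr>)"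
    have "fst ` E \<subseteq> Q" using subgroup.subset[OF E] by auto
    then show "subgroup E SS \<and> fst ` E \<subseteq> Q" using B.KG.incl_subgroup[OF SQ(2) E] by simp
  next
    assume E: "subgroup E SS \<and> fst ` E \<subseteq> Q"
    then have "E \<subseteq> Q \<times> carrier S" using sub by (auto simp: image_subset_iff)
    then show "subgroup E (SS\<lparr>carrier := Q \<times> carrier S\<rparr>)" using B.KG.subgroup_incl[OF _ SQ(2)] E by blast
  qed
qed

lemma local_bisets_sub:
  assumes Q: "subgroup Q S"
  shows "local_bisets (sub Q) S S p" "local_bisets S S (sub Q) p"
proof -
  have "finite_group (sub Q)"
    using local_burnside_subgroup[OF Q] by (simp add: local_burnside_def)
  then show "local_bisets (sub Q) S S p" "local_bisets S S (sub Q) p"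
    using finite_group_axioms prime by (simp_all add: local_bisets_def three_groups_def local_bisets_axioms_def)
qed

text \<open>Composition with \<open>[P, \<phi>]\<close> on the right and with the biset of the inverse of \<open>\<phi>\<close> on the left are the two
restrictions along \<open>\<phi>\<close>.\<close>

lemma biset_stable_iff:
  assumes f: "f \<in> carrier (gset_ring p SS)"
  shows "biset_stable p S F (burnside_coset p SS f) \<longleftrightarrow> fstable f"
proof -
  have one: "(biset_comp p (sub Q) S S (burnside_coset p SS f) (biset_class p (sub Q) S Q \<psi>) =
        biset_comp p (sub Q) S S (burnside_coset p SS f) (biset_class p (sub Q) S Q (\<lambda>u. u)) \<longleftrightarrow>
      (\<forall>E. subgroup E SS \<longrightarrow> snd ` E \<subseteq> Q \<longrightarrow> mark SS ((\<lambda>(a, b). (a, \<psi> b)) ` E) f = mark SS E f)) \<and>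
      (biset_comp p S S (sub Q) (biset_class p S (sub Q) (\<psi> ` Q) (inv_into Q \<psi>)) (burnside_coset p SS f) =
        biset_comp p S S (sub Q) (biset_class p S (sub Q) Q (\<lambda>u. u)) (burnside_coset p SS f) \<longleftrightarrow>
      (\<forall>E. subgroup E SS \<longrightarrow> fst ` E \<subseteq> Q \<longrightarrow> mark SS ((\<lambda>(a, b). (\<psi> a, b)) ` E) f = mark SS E f))"
    if \<psi>: "mor Q \<psi>" for Q \<psi>
  proof -
    note Q = mor_subgroup[OF \<psi>]
    interpret R: local_bisets "sub Q" S S p by (rule local_bisets_sub[OF Q])
    interpret L: local_bisets S S "sub Q" p by (rule local_bisets_sub[OF Q])
    interpret T: local_bisets S "sub Q" "sub Q" p
      using local_bisets_sub[OF Q] by (simp add: local_bisets_def three_groups_def)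
    have hom: "\<psi> \<in> hom (sub Q) S" "(\<lambda>u. u) \<in> hom (sub Q) S"
      using mor_hom[OF \<psi>] subgroup.subset[OF Q] by (auto simp: hom_def)
    have gQ: "subgroup Q (sub Q)" using group.subgroup_self[OF subgroup_imp_group[OF Q]] by simp
    have c: "carrier (sub Q) = Q" by simp
    have sr: "biset_single (sub Q) S Q \<chi> \<in> carrier (gset_ring p (S \<times>\<times> sub Q))" if "\<chi> \<in> hom (sub Q) S" for \<chi>
      using R.biset_single_formal[OF gQ, of \<chi>] that by simp
    have mr: "mark (S \<times>\<times> sub Q) E (biset_mult (sub Q) S S f (biset_single (sub Q) S Q \<chi>)) = mark SS ((\<lambda>(a, b). (a, \<chi> b)) ` E) f"
      if "\<chi> \<in> hom (sub Q) S" "subgroup E (S \<times>\<times> sub Q)" for \<chi> E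
      using R.mark_biset_mult_restrict_right[OF f that(1) subgroup.subset[OF that(2)]] by simp
    have r: "biset_comp p (sub Q) S S (burnside_coset p SS f) (biset_class p (sub Q) S Q \<psi>) =
        biset_comp p (sub Q) S S (burnside_coset p SS f) (biset_class p (sub Q) S Q (\<lambda>u. u)) \<longleftrightarrow>
      (\<forall>E. subgroup E (S \<times>\<times> sub Q) \<longrightarrow> mark SS ((\<lambda>(a, b). (a, \<psi> b)) ` E) f = mark SS E f)"
      unfolding biset_class_alt R.biset_comp_coset[OF f sr[OF hom(1)]] R.biset_comp_coset[OF f sr[OF hom(2)]]
        R.KG.burnside_coset_eq_iff_marks[OF R.biset_mult_formal[OF f sr[OF hom(1)]] R.biset_mult_formal[OF f sr[OF hom(2)]]]
      using mr[OF hom(1)] mr[OF hom(2)] by auto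
    have id_eq: "biset_single S (sub Q) Q (\<lambda>u. u) = biset_single S (sub Q) ((\<lambda>u. u) ` Q) (inv_into Q (\<lambda>u. u))"
      unfolding biset_single_def transitive_biset_def
      using twisted_diagonal_cong[of Q "\<lambda>u. u" "inv_into Q (\<lambda>u. u)"] by (simp add: inv_into_f_f[of "\<lambda>u. u"])
    have sl: "biset_single S (sub Q) (\<chi> ` Q) (inv_into Q \<chi>) \<in> carrier (gset_ring p (sub Q \<times>\<times> S))"
      if \<chi>: "\<chi> \<in> hom (sub Q) S" "inj_on \<chi> Q" for \<chi>
    proof (rule T.biset_single_formal)
      interpret \<chi>: group_hom "sub Q" S \<chi> using \<chi>(1) by unfold_locales
      show "subgroup (\<chi> ` Q) S" using \<chi>.subgroup_img_is_subgroup[OF gQ] .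
      show "inv_into Q \<chi> \<in> hom (S\<lparr>carrier := \<chi> ` Q\<rparr>) (sub Q)" using L.inv_into_hom[OF \<chi>(1)] \<chi>(2) by simp
    qed
    have ml: "mark (sub Q \<times>\<times> S) E (biset_mult S S (sub Q) (biset_single S (sub Q) (\<chi> ` Q) (inv_into Q \<chi>)) f) =
        mark SS ((\<lambda>(a, b). (\<chi> a, b)) ` E) f"
      if "\<chi> \<in> hom (sub Q) S" "inj_on \<chi> Q" "subgroup E (sub Q \<times>\<times> S)" for \<chi> E
      using L.mark_biset_mult_restrict_left[OF f that(1) _ subgroup.subset[OF that(3)]] that(2) by simp
    have inj: "inj_on \<psi> Q" "inj_on (\<lambda>u. u) Q" using mor_inj[OF \<psi>] by (auto simp: inj_on_def)
    have l: "biset_comp p S S (sub Q) (biset_class p S (sub Q) (\<psi> ` Q) (inv_into Q \<psi>)) (burnside_coset p SS f) =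
        biset_comp p S S (sub Q) (biset_class p S (sub Q) Q (\<lambda>u. u)) (burnside_coset p SS f) \<longleftrightarrow>
      (\<forall>E. subgroup E (sub Q \<times>\<times> S) \<longrightarrow> mark SS ((\<lambda>(a, b). (\<psi> a, b)) ` E) f = mark SS E f)"
      unfolding biset_class_alt id_eq L.biset_comp_coset[OF sl[OF hom(1) inj(1)] f] L.biset_comp_coset[OF sl[OF hom(2) inj(2)] f]
        L.KG.burnside_coset_eq_iff_marks[OF L.biset_mult_formal[OF sl[OF hom(1) inj(1)] f] L.biset_mult_formal[OF sl[OF hom(2) inj(2)] f]]
      using ml[OF hom(1) inj(1)] ml[OF hom(2) inj(2)] by auto
    show ?thesis using r l subgroup_DirProd_sub_iff[OF Q] by auto
  qed
  show ?thesis
    unfolding biset_stable_def Let_def fstable_def using one by (auto simp: mor_def)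
qed

section \<open>The collapse to the Burnside ring of \<open>S\<close>\<close>

definition F_card :: "'a set \<Rightarrow> rat"
  where "F_card Q = of_nat (card (F Q (carrier S)))"

lemma F_card_pos: "subgroup Q S \<Longrightarrow> F_card Q > 0"
  unfolding F_card_def using finite_F F_nonempty by (simp add: card_gt_0_iff)

lemma card_S_pos: "(of_nat (card (carrier S)) :: rat) > 0"
  using subgroup_card_pos[OF subgroup_self] by simp

text \<open>The number of points of the left quotient \<open>S\X\<close> fixed by \<open>Q\<close>, for a left-free biset \<open>X\<close> whose
stabilizers are graphs of morphisms: in a fixed left orbit, each of the \<open>|S|\<close> points is fixed by the graph
of exactly one \<open>\<psi>\<close>.\<close>

definition trace :: "'a set \<Rightarrow> (('a \<times> 'a, nat) gset set \<Rightarrow>\<^sub>0 rat) \<Rightarrow> rat"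
  where "trace Q f = (\<Sum>\<psi>\<in>F Q (carrier S). mark SS (twisted_diagonal Q \<psi>) f) / of_nat (card (carrier S))"

lemma trace_lin: "trace Q f = lin (\<lambda>k. trace Q (Poly_Mapping.single k 1)) f"
proof -
  have "trace Q f = (\<Sum>\<psi>\<in>F Q (carrier S). lin (class_weight SS (mark_weight (twisted_diagonal Q \<psi>))) f) * (1 / of_nat (card (carrier S)))"
    by (simp add: trace_def mark_def burnside_weight_def)
  also have "\<dots> = lin (\<lambda>k. (1 / of_nat (card (carrier S))) * (\<Sum>\<psi>\<in>F Q (carrier S). class_weight SS (mark_weight (twisted_diagonal Q \<psi>)) k)) f"
    unfolding lin_scale lin_sum_functional by simp
  finally show ?thesis by (simp add: trace_def mark_def burnside_weight_def)
qed

definition transporter :: "'a set \<Rightarrow> 'a set \<Rightarrow> 'a set"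
  where "transporter P Q = {v \<in> carrier S. Q \<subseteq> conj_map S v ` P}"

lemma biset_single_mor: "mor P \<phi> \<Longrightarrow> biset_single S S P \<phi> \<in> carrier (gset_ring p SS)"
  by (rule B.biset_single_formal[OF mor_subgroup mor_hom])

lemma mem_conj_P:
  assumes P: "subgroup P S" and v: "v \<in> carrier S" and g: "g \<in> conj_map S v ` P"
  shows "conj_map S (inv v) g \<in> P"
  using g conj_map_inv_conj[OF v] subgroup.subset[OF P] by auto

text \<open>The coset of \<open>(u, v)\<close> is fixed by the graph of exactly one morphism if \<open>Q\<close> is contained in the conjugate of
\<open>P\<close> by \<open>v\<close>, and by none otherwise. So the trace is the number of points of \<open>S/P\<close> fixed by \<open>Q\<close>.\<close>

lemma trace_single:
  assumes \<phi>: "mor P \<phi>" and Q: "subgroup Q S"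
  shows "of_nat (card P) * trace Q (biset_single S S P \<phi>) = of_nat (card (transporter P Q))"
proof -
  note P = mor_subgroup[OF \<phi>]
  let ?B = "\<lambda>u v. (\<lambda>w. (conj_map S u (\<phi> w), conj_map S v w)) ` P"
  have count: "(\<Sum>\<psi>\<in>F Q (carrier S). mark_weight (twisted_diagonal Q \<psi>) (?B u v)) = (if Q \<subseteq> conj_map S v ` P then 1 else 0)"
    if u: "u \<in> carrier S" and v: "v \<in> carrier S" for u v
  proof (cases "Q \<subseteq> conj_map S v ` P")
    case False
    have "mark_weight (twisted_diagonal Q \<psi>) (?B u v) = 0" for \<psi>
    proof -
      have "\<not> twisted_diagonal Q \<psi> \<subseteq> ?B u v"
      proof
        assume "twisted_diagonal Q \<psi> \<subseteq> ?B u v"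
        then have "snd ` twisted_diagonal Q \<psi> \<subseteq> snd ` ?B u v" by (rule image_mono)
        then show False using False by (simp add: image_image)
      qed
      then show ?thesis by (simp add: mark_weight_def)
    qed
    then show ?thesis using False by simp
  next
    case True
    let ?\<psi> = "\<lambda>q\<in>Q. conj_map S u (\<phi> (conj_map S (inv v) q))"
    have inP: "conj_map S (inv v) q \<in> P" if "q \<in> Q" for q using mem_conj_P[OF P v] True that by blast
    have "mor Q ?\<psi>"
    proof -
      let ?c = "restrict (conj_map S (inv v)) Q" and ?d = "restrict (conj_map S u) (carrier S)"
      have c: "mor Q ?c" by (rule mor_conj_map[OF Q inv_closed[OF v]])
      have "?c ` Q \<subseteq> P" using inP by auto
      note c\<phi> = mor_comp[OF c \<phi> this]
      have "mor Q (compose Q ?d (compose Q \<phi> ?c))"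
        by (rule mor_comp[OF c\<phi> mor_conj_map[OF subgroup_self u]]) (use mor_closed[OF c\<phi>] in auto)
      moreover have "compose Q ?d (compose Q \<phi> ?c) = ?\<psi>"
        using inP mor_closed[OF \<phi>] by (auto simp: compose_def fun_eq_iff)
      ultimately show ?thesis by simp
    qed
    then have mem: "?\<psi> \<in> F Q (carrier S)" by (simp add: mor_def)
    have inB: "(a, q) \<in> ?B u v \<longleftrightarrow> a = ?\<psi> q" if q: "q \<in> Q" for a q
    proof
      assume "(a, q) \<in> ?B u v"
      then obtain w where w: "w \<in> P" "a = conj_map S u (\<phi> w)" "q = conj_map S v w" by auto
      then have "conj_map S (inv v) q = w" using conj_map_inv_conj[OF v] subgroup.subset[OF P] by auto
      then show "a = ?\<psi> q" using w q by simp
    next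
      assume "a = ?\<psi> q"
      moreover have "q = conj_map S v (conj_map S (inv v) q)"
        using conj_map_conj_inv[OF v] subgroup.subset[OF Q] q by auto
      ultimately show "(a, q) \<in> ?B u v" using inP[OF q] q by (auto intro!: image_eqI[of _ _ "conj_map S (inv v) q"])
    qed
    have "twisted_diagonal Q \<psi> \<subseteq> ?B u v \<longleftrightarrow> \<psi> = ?\<psi>" if "\<psi> \<in> F Q (carrier S)" for \<psi>
    proof -
      have "twisted_diagonal Q \<psi> \<subseteq> ?B u v \<longleftrightarrow> (\<forall>q\<in>Q. \<psi> q = ?\<psi> q)"
        unfolding twisted_diagonal_image image_subset_iff by (rule ball_cong[OF refl inB])
      also have "\<dots> \<longleftrightarrow> \<psi> = ?\<psi>"
        using F_extensional[OF Q subgroup_self that] by (auto intro!: extensionalityI[of _ Q])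
      finally show ?thesis .
    qed
    then have "(\<Sum>\<psi>\<in>F Q (carrier S). mark_weight (twisted_diagonal Q \<psi>) (?B u v)) = (\<Sum>\<psi>\<in>F Q (carrier S). if \<psi> = ?\<psi> then 1 else 0)"
      unfolding mark_weight_def by (intro sum.cong) auto
    also have "\<dots> = 1" using mem finite_F[OF Q] by simp
    finally show ?thesis using True by simp
  qed
  have "of_nat (card P) * (\<Sum>\<psi>\<in>F Q (carrier S). mark SS (twisted_diagonal Q \<psi>) (biset_single S S P \<phi>)) =
      (\<Sum>\<psi>\<in>F Q (carrier S). \<Sum>u\<in>carrier S. \<Sum>v\<in>carrier S. mark_weight (twisted_diagonal Q \<psi>) (?B u v))"
    unfolding sum_distrib_left mark_def B.weight_biset_single[OF P mor_hom[OF \<phi>]] ..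
  also have "\<dots> = (\<Sum>u\<in>carrier S. \<Sum>v\<in>carrier S. \<Sum>\<psi>\<in>F Q (carrier S). mark_weight (twisted_diagonal Q \<psi>) (?B u v))"
    by (subst sum.swap, rule sum.cong[OF refl], rule sum.swap)
  also have "\<dots> = (\<Sum>u\<in>carrier S. \<Sum>v\<in>carrier S. if Q \<subseteq> conj_map S v ` P then 1 else 0)"
    by (intro sum.cong refl count)
  also have "\<dots> = of_nat (card (carrier S)) * of_nat (card (transporter P Q))"
    using finite_carrier by (simp add: sum.If_cases transporter_def Int_def)
  finally show ?thesis using card_S_pos by (simp add: trace_def field_simps)
qed

text \<open>By stability, the graph can be moved along \<open>\<phi>\<close> and along conjugation by \<open>v\<close> without changing the mark
of \<open>f\<close>. What is left is to count the admissible \<open>v\<close>, and this count is the trace.\<close>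

lemma mark_mult_single:
  assumes f: "f \<in> carrier (gset_ring p SS)" and st: "fstable f" and \<phi>: "mor P \<phi>" and D: "subgroup D SS"
  shows "mark SS D (biset_mult S S S f (biset_single S S P \<phi>)) = mark SS D f * trace (snd ` D) (biset_single S S P \<phi>)"
proof -
  note P = mor_subgroup[OF \<phi>]
  have sub: "D \<subseteq> carrier S \<times> carrier S" using subgroup.subset[OF D] by simp
  have "of_nat (card P) * mark SS D (biset_mult S S S f (biset_single S S P \<phi>)) =
      (\<Sum>v\<in>transporter P (snd ` D). mark SS ((\<lambda>(k, g). (k, \<phi> (conj_map S (inv v) g))) ` D) f)"
    unfolding B.mark_biset_mult_single_right[OF f P mor_hom[OF \<phi>] subgroup.subset[OF D]] transporter_def ..
  also have "\<dots> = (\<Sum>v\<in>transporter P (snd ` D). mark SS D f)"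
  proof (rule sum.cong[OF refl])
    fix v assume "v \<in> transporter P (snd ` D)"
    then have v: "v \<in> carrier S" and t: "snd ` D \<subseteq> conj_map S v ` P" by (auto simp: transporter_def)
    let ?e = "(\<one>, inv v)"
    have e: "?e \<in> carrier SS" using v by simp
    let ?E = "conj_map SS ?e ` D"
    have E: "?E = (\<lambda>(k, g). (k, conj_map S (inv v) g)) ` D"
      using sub v by (intro image_cong) (auto simp: conj_map_SS)
    have "snd ` ?E \<subseteq> P" unfolding E using t mem_conj_P[OF P v] by force
    then have "mark SS ((\<lambda>(a, b). (a, \<phi> b)) ` ?E) f = mark SS ?E f"
      using st \<phi> B.KG.conj_image_subgroup[OF e D] unfolding fstable_def by blast
    also have "\<dots> = mark SS D f" by (rule B.KG.mark_conj[OF f e subgroup.subset[OF D]])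
    finally show "mark SS ((\<lambda>(k, g). (k, \<phi> (conj_map S (inv v) g))) ` D) f = mark SS D f"
      unfolding E image_image by (simp add: case_prod_unfold)
  qed
  also have "\<dots> = of_nat (card (transporter P (snd ` D))) * mark SS D f" by simp
  also have "\<dots> = of_nat (card P) * (mark SS D f * trace (snd ` D) (biset_single S S P \<phi>))"
    unfolding trace_single[OF \<phi> snd_image_subgroup[OF D], symmetric] by simp
  finally show ?thesis using subgroup_card_pos[OF P] by simp
qed

lemma mark_biset_mult_lin:
  "mark SS D (biset_mult S S S f g) = lin (\<lambda>k. mark SS D (biset_mult S S S f (Poly_Mapping.single k 1))) g"
  unfolding mark_def burnside_weight_def biset_mult_def lin_bilinear_ext lin_single
  unfolding lin_def by (simp add: sum_distrib_left mult.left_commute sum.swap[of _ "Poly_Mapping.keys f"])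

text \<open>Both sides are linear in \<open>g\<close>, and \<open>g\<close> is a combination of transitive bisets of morphisms.\<close>

theorem mark_composition:
  assumes f: "f \<in> carrier (gset_ring p SS)" and st: "fstable f"
    and g: "g \<in> carrier (gset_ring p SS)" and gen: "fgen g" and D: "subgroup D SS"
  shows "mark SS D (biset_mult S S S f g) = mark SS D f * trace (snd ` D) g"
proof -
  obtain h where h: "h \<in> carrier (gset_ring p SS)" "Poly_Mapping.keys h \<subseteq> fclasses"
    "burnside_coset p SS g = burnside_coset p SS h" "\<forall>D. mark SS D h = mark SS D g"
    by (rule fgen_decomposition[OF g gen])
  have "burnside_coset p SS (biset_mult S S S f g) = burnside_coset p SS (biset_mult S S S f h)"
    using B.biset_comp_coset[OF f g] B.biset_comp_coset[OF f h(1)] h(3) by simp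
  then have "mark SS D (biset_mult S S S f g) = mark SS D (biset_mult S S S f h)"
    using B.KG.burnside_coset_eq_iff_marks[OF B.biset_mult_formal[OF f g] B.biset_mult_formal[OF f h(1)]] D by blast
  also have "\<dots> = lin (\<lambda>k. mark SS D f * trace (snd ` D) (Poly_Mapping.single k 1)) h"
    unfolding mark_biset_mult_lin[of D f h]
  proof (rule lin_cong[OF h(2)])
    fix k assume "k \<in> fclasses"
    then obtain P \<phi> where "mor P \<phi>" "k = iso_class SS (transitive_biset S S P \<phi>)" by (auto simp: fclasses_def)
    then show "mark SS D (biset_mult S S S f (Poly_Mapping.single k 1)) = mark SS D f * trace (snd ` D) (Poly_Mapping.single k 1)"
      using mark_mult_single[OF f st _ D, of P \<phi>] by (simp add: biset_single_def)
  qed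
  also have "\<dots> = mark SS D f * trace (snd ` D) h" unfolding lin_scale trace_lin[of _ h] ..
  also have "trace (snd ` D) h = trace (snd ` D) g" by (simp add: trace_def h(4))
  finally show ?thesis .
qed

text \<open>The trace of \<open>[P, \<phi>]\<close> is the family of marks of \<open>S/P\<close>; extend this linearly.\<close>

theorem trace_mark_function:
  assumes g: "g \<in> carrier (gset_ring p SS)" and gen: "fgen g"
  shows "\<exists>u\<in>carrier (gset_ring p S). \<forall>Q. subgroup Q S \<longrightarrow> mark S Q u = trace Q g"
proof -
  obtain h where h: "h \<in> carrier (gset_ring p SS)" "Poly_Mapping.keys h \<subseteq> fclasses"
    "burnside_coset p SS g = burnside_coset p SS h" "\<forall>D. mark SS D h = mark SS D g"
    by (rule fgen_decomposition[OF g gen])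
  have "\<exists>k'\<in>iso_classes S. \<forall>Q. subgroup Q S \<longrightarrow> mark S Q (Poly_Mapping.single k' 1) = trace Q (Poly_Mapping.single k 1)"
    if "k \<in> fclasses" for k
  proof -
    obtain P \<phi> where P: "mor P \<phi>" "k = iso_class SS (transitive_biset S S P \<phi>)" using \<open>k \<in> fclasses\<close> by (auto simp: fclasses_def)
    note PS = mor_subgroup[OF P(1)]
    have "mark S Q (Poly_Mapping.single (iso_class S (coset_gset S P)) 1) = trace Q (Poly_Mapping.single k 1)"
      if Q: "subgroup Q S" for Q
    proof -
      have "of_nat (card P) * mark S Q (Poly_Mapping.single (iso_class S (coset_gset S P)) 1) =
          (\<Sum>v\<in>carrier S. mark_weight Q (conj_map S v ` P))"
        using orbit_weight_coset[OF PS, of "mark_weight Q"] by (simp add: mark_def burnside_weight_single[OF is_gset_coset[OF PS]])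
      also have "\<dots> = of_nat (card (transporter P Q))"
        using finite_carrier by (simp add: mark_weight_def sum.If_cases transporter_def Int_def)
      also have "\<dots> = of_nat (card P) * trace Q (Poly_Mapping.single k 1)"
        using trace_single[OF P(1) Q] P(2) by (simp add: biset_single_def)
      finally show ?thesis using subgroup_card_pos[OF PS] by simp
    qed
    then show ?thesis using iso_class_in_iso_classes[OF is_gset_coset[OF PS]] by blast
  qed
  then obtain c where c: "\<And>k. k \<in> fclasses \<Longrightarrow> c k \<in> iso_classes S"
    "\<And>k Q. \<lbrakk>k \<in> fclasses; subgroup Q S\<rbrakk> \<Longrightarrow> mark S Q (Poly_Mapping.single (c k) 1) = trace Q (Poly_Mapping.single k 1)"
    by metis
  let ?u = "\<Sum>k\<in>Poly_Mapping.keys h. Poly_Mapping.single (c k) (Poly_Mapping.lookup h k)"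
  have "?u \<in> carrier (gset_ring p S)"
    using h c(1) by (intro formal_sum[OF prime] formal_single[OF prime]) (auto simp: carrier_gset_ring)
  moreover have "mark S Q ?u = trace Q g" if Q: "subgroup Q S" for Q
  proof -
    have "mark S Q ?u = (\<Sum>k\<in>Poly_Mapping.keys h. Poly_Mapping.lookup h k * mark S Q (Poly_Mapping.single (c k) 1))"
      unfolding mark_sum by (simp add: mark_def burnside_weight_def)
    also have "\<dots> = (\<Sum>k\<in>Poly_Mapping.keys h. Poly_Mapping.lookup h k * trace Q (Poly_Mapping.single k 1))"
      using h(2) c(2)[OF _ Q] by (intro sum.cong) auto
    also have "\<dots> = trace Q h" unfolding trace_lin[of Q h] lin_def ..
    finally show ?thesis by (simp add: trace_def h(4))
  qed
  ultimately show ?thesis by blast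
qed

lemma mark_stable_diagonal:
  assumes st: "fstable f" and \<psi>: "mor Q \<psi>"
  shows "mark SS (twisted_diagonal Q \<psi>) f = mark SS (twisted_diagonal Q (\<lambda>u\<in>Q. u)) f"
proof -
  let ?i = "\<lambda>u\<in>Q. u"
  note i = mor_incl[OF mor_subgroup[OF \<psi>]]
  have "twisted_diagonal Q \<psi> = (\<lambda>(a, b). (\<psi> a, b)) ` twisted_diagonal Q ?i"
    unfolding fst_map_twisted_diagonal by (rule twisted_diagonal_cong) (simp add: compose_def)
  then show ?thesis using st \<psi> twisted_diagonal_subgroup[OF i] unfolding fstable_def by fastforce
qed

lemma trace_stable:
  assumes st: "fstable f" and Q: "subgroup Q S"
  shows "trace Q f = F_card Q * mark SS (twisted_diagonal Q (\<lambda>u\<in>Q. u)) f / of_nat (card (carrier S))"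
proof -
  have "(\<Sum>\<psi>\<in>F Q (carrier S). mark SS (twisted_diagonal Q \<psi>) f) =
      (\<Sum>\<psi>\<in>F Q (carrier S). mark SS (twisted_diagonal Q (\<lambda>u\<in>Q. u)) f)"
    using mark_stable_diagonal[OF st] Q by (intro sum.cong) (auto simp: mor_def)
  then show ?thesis by (simp add: trace_def F_card_def)
qed

text \<open>The only possible marks of a stable and generated element whose trace is \<open>1\<close> at every subgroup: the
trace at \<open>Q\<close> is the sum of \<open>|F(Q, S)|\<close> equal marks, divided by \<open>|S|\<close>.\<close>

definition char_mark :: "('a \<times> 'a) set \<Rightarrow> rat"
  where "char_mark D = (if fdiag D then of_nat (card (carrier S)) / F_card (snd ` D) else 0)"

text \<open>The marks of \<open>f\<close> at \<open>D\<close> satisfy \<open>x t = x\<close>, where \<open>t\<close> is the trace at the second projection of \<open>D\<close>. As \<open>t\<close> is a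
multiple of the mark on the diagonal, also \<open>t t = t\<close>. The traces are marks of an element of the Burnside
ring of the \<open>p\<close>-group \<open>S\<close>, so they are all \<open>0\<close> or all \<open>1\<close>.\<close>

theorem characteristic_idempotent_marks:
  assumes f: "f \<in> carrier (gset_ring p SS)" and gen: "fgen f" and st: "fstable f"
    and idem: "\<And>D. subgroup D SS \<Longrightarrow> mark SS D (biset_mult S S S f f) = mark SS D f"
  shows "(\<forall>D. subgroup D SS \<longrightarrow> mark SS D f = 0) \<or> (\<forall>D. subgroup D SS \<longrightarrow> mark SS D f = char_mark D)"
proof -
  obtain u where u: "u \<in> carrier (gset_ring p S)" "\<And>Q. subgroup Q S \<Longrightarrow> mark S Q u = trace Q f"
    using trace_mark_function[OF f gen] by blast
  let ?x = "\<lambda>Q. mark SS (twisted_diagonal Q (\<lambda>u\<in>Q. u)) f"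
  have "mark S Q u * mark S Q u = mark S Q u" if Q: "subgroup Q S" for Q
  proof -
    note D = twisted_diagonal_subgroup[OF mor_incl[OF Q]]
    have "?x Q * trace Q f = ?x Q"
      using mark_composition[OF f st f gen D] idem[OF D] by simp
    moreover have "trace Q f * trace Q f = F_card Q * (?x Q * trace Q f) / of_nat (card (carrier S))"
      by (subst (1) trace_stable[OF st Q]) simp
    ultimately have "trace Q f * trace Q f = trace Q f" using trace_stable[OF st Q] by simp
    then show ?thesis using u(2)[OF Q] by simp
  qed
  moreover obtain n where n: "order S = p ^ n" using order_power by blast
  ultimately consider "\<forall>Q. subgroup Q S \<longrightarrow> trace Q f = 0" | "\<forall>Q. subgroup Q S \<longrightarrow> trace Q f = 1"
    using p_group_idempotent_marks[OF n u(1)] u(2) by metis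
  then show ?thesis
  proof cases
    case 1
    have "mark SS D f = 0" if D: "subgroup D SS" for D
      using mark_composition[OF f st f gen D] idem[OF D] 1 snd_image_subgroup[OF D] by simp
    then show ?thesis by blast
  next
    case 2
    have "mark SS D f = char_mark D" if D: "subgroup D SS" for D
    proof (cases "fdiag D")
      case True
      then obtain Q \<psi> where Q: "mor Q \<psi>" "D = twisted_diagonal Q \<psi>" by (auto simp: fdiag_def)
      have "F_card Q * ?x Q = of_nat (card (carrier S))"
        using trace_stable[OF st mor_subgroup[OF Q(1)]] 2 mor_subgroup[OF Q(1)] card_S_pos by (simp add: field_simps)
      then show ?thesis
        using True Q mark_stable_diagonal[OF st Q(1)] F_card_pos[OF mor_subgroup[OF Q(1)]]
        by (simp add: char_mark_def field_simps)
    next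
      case False
      then show ?thesis using gen D by (simp add: fgen_def char_mark_def)
    qed
    then show ?thesis by blast
  qed
qed

end

section \<open>Consequences of saturation\<close>

lemma (in finite_group) normalizer_iff:
  assumes D: "D \<subseteq> carrier G"
  shows "e \<in> normalizer G D \<longleftrightarrow> e \<in> carrier G \<and> conj_map G e ` D = D"
proof -
  have "e <#\<^bsub>G\<^esub> D #> inv e = conj_map G e ` D" if "e \<in> carrier G"
    by (auto simp: l_coset_def r_coset_def conj_map_def)
  then show ?thesis using D by (auto simp: normalizer_def stabilizer_def)
qed

lemma (in finite_group) normalizer_iff_subset:
  assumes D: "subgroup D G"
  shows "e \<in> normalizer G D \<longleftrightarrow> e \<in> carrier G \<and> conj_map G e ` D \<subseteq> D"
  unfolding normalizer_iff[OF subgroup.subset[OF D]]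
  using card_subset_eq[OF subgroup_finite[OF D]] conj_image_card[OF _ subgroup.subset[OF D]] by auto

lemma compose_image: "compose P \<psi> \<phi> ` P = \<psi> ` \<phi> ` P"
  by (simp add: compose_def image_image)

context fusion_system
begin

lemma conjugates_iff:
  assumes P: "subgroup P S" shows "Q \<in> conjugates P \<longleftrightarrow> (\<exists>\<phi>. mor P \<phi> \<and> \<phi> ` P = Q)"
proof
  assume "Q \<in> conjugates P"
  then obtain \<phi> \<psi> where Q: "subgroup Q S" and \<phi>: "\<phi> \<in> F P Q" and \<psi>: "\<psi> \<in> F Q P"
    and eq: "compose Q \<phi> \<psi> = (\<lambda>u\<in>Q. u)" by (auto simp: conjugates_def)
  have "\<phi> ` P = Q"
  proof
    show "\<phi> ` P \<subseteq> Q" using F_funcset[OF P Q \<phi>] by auto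
    show "Q \<subseteq> \<phi> ` P"
    proof
      fix q assume q: "q \<in> Q"
      then have "\<phi> (\<psi> q) = q" using fun_cong[OF eq, of q] by (simp add: compose_def)
      then show "q \<in> \<phi> ` P" using F_funcset[OF Q P \<psi> q] by (metis imageI)
    qed
  qed
  then show "\<exists>\<phi>. mor P \<phi> \<and> \<phi> ` P = Q" using F_mor[OF P Q \<phi>] by blast
next
  assume "\<exists>\<phi>. mor P \<phi> \<and> \<phi> ` P = Q"
  then obtain \<phi> where \<phi>: "mor P \<phi>" "\<phi> ` P = Q" by blast
  let ?\<psi> = "restrict (inv_into P \<phi>) Q"
  have Q: "subgroup Q S" using mor_image_subgroup[OF \<phi>(1)] \<phi>(2) by simp
  have 1: "\<phi> \<in> F P Q" using mor_F[OF \<phi>(1) Q] \<phi>(2) by simp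
  have 2: "?\<psi> \<in> F Q P" using mor_inverse[OF P subgroup_self mor_in[OF \<phi>(1)]] \<phi>(2) by simp
  have 3: "compose P ?\<psi> \<phi> = (\<lambda>u\<in>P. u)"
    using mor_inj[OF \<phi>(1)] \<phi>(2) by (auto simp: compose_def fun_eq_iff)
  have 4: "compose Q \<phi> ?\<psi> = (\<lambda>u\<in>Q. u)"
    using \<phi>(2) by (auto simp: compose_def fun_eq_iff f_inv_into_f)
  show "Q \<in> conjugates P" unfolding conjugates_def using Q 1 2 3 4 by blast
qed

lemma conjugates_trans:
  assumes P: "subgroup P S" and Q: "Q \<in> conjugates P" and R: "R \<in> conjugates Q"
  shows "R \<in> conjugates P"
proof -
  have Qs: "subgroup Q S" using Q by (simp add: conjugates_def)
  obtain \<phi> where \<phi>: "mor P \<phi>" "\<phi> ` P = Q" using Q conjugates_iff[OF P] by blast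
  obtain \<psi> where \<psi>: "mor Q \<psi>" "\<psi> ` Q = R" using R conjugates_iff[OF Qs] by blast
  have "mor P (compose P \<psi> \<phi>)" using mor_comp[OF \<phi>(1) \<psi>(1)] \<phi>(2) by simp
  moreover have "compose P \<psi> \<phi> ` P = R" using \<phi>(2) \<psi>(2) by (simp add: compose_image)
  ultimately show ?thesis using conjugates_iff[OF P] by blast
qed

lemma conjugates_sym: "\<lbrakk>subgroup P S; Q \<in> conjugates P\<rbrakk> \<Longrightarrow> P \<in> conjugates Q"
  unfolding conjugates_def by blast

lemma conjugates_refl: "subgroup P S \<Longrightarrow> P \<in> conjugates P"
  unfolding conjugates_iff using mor_incl[of P] by (intro exI[of _ "\<lambda>u\<in>P. u"]) auto

lemma conjugates_eq: 
  assumes P: "subgroup P S" and Q: "Q \<in> conjugates P" shows "conjugates Q = conjugates P"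
proof -
  have Qs: "subgroup Q S" using Q by (simp add: conjugates_def)
  show ?thesis using conjugates_trans[OF P Q] conjugates_trans[OF Qs conjugates_sym[OF P Q]] by blast
qed

text \<open>An injective map from the finite group \<open>S\<close> to itself is onto.\<close>

lemma conjugates_whole: "conjugates (carrier S) = {carrier S}"
proof -
  have "\<phi> ` carrier S = carrier S" if "mor (carrier S) \<phi>" for \<phi>
    using mor_closed[OF that] mor_inj[OF that] finite_carrier by (metis endo_inj_surj image_subsetI)
  then have "Q = carrier S" if "Q \<in> conjugates (carrier S)" for Q
    using that conjugates_iff[OF subgroup_self, of Q] by metis
  then show ?thesis using conjugates_refl[OF subgroup_self] by blast
qed

lemma fully_normalized_representative:
  assumes P: "subgroup P S" shows "\<exists>P0. P0 \<in> conjugates P \<and> fully_normalized P0"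
proof -
  have "conjugates P \<subseteq> Pow (carrier S)" using subgroup.subset by (auto simp: conjugates_def)
  then have fin: "finite (conjugates P)" using finite_carrier finite_subset by blast
  have ne: "conjugates P \<noteq> {}" using conjugates_refl[OF P] by blast
  let ?c = "\<lambda>Q. card (normalizer S Q)"
  obtain P0 where P0: "P0 \<in> conjugates P" "?c P0 = Max (?c ` conjugates P)"
    using Max_in[of "?c ` conjugates P"] fin ne by fastforce
  have "?c Q \<le> ?c P0" if "Q \<in> conjugates P" for Q
    unfolding P0(2) using fin that by simp
  then have "fully_normalized P0" unfolding fully_normalized_def conjugates_eq[OF P P0(1)] by blast
  then show ?thesis using P0(1) by blast
qed

text \<open>A choice that depends only on the class: conjugate subgroups have the same representative.\<close>

definition representative :: "'a set \<Rightarrow> 'a set"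
  where "representative P = (SOME P0. P0 \<in> conjugates P \<and> fully_normalized P0)"

lemma representative:
  assumes P: "subgroup P S"
  shows "representative P \<in> conjugates P" "fully_normalized (representative P)" "subgroup (representative P) S"
  using someI_ex[OF fully_normalized_representative[OF P]] unfolding representative_def conjugates_def by auto

lemma representative_cong: "\<lbrakk>subgroup P S; Q \<in> conjugates P\<rbrakk> \<Longrightarrow> representative Q = representative P"
  by (simp add: representative_def conjugates_eq)

lemma normalizer_subgroup: "subgroup P S \<Longrightarrow> subgroup (normalizer S P) S"
  by (rule normalizer_imp_subgroup[OF subgroup.subset])

lemma subgroup_le_normalizer: "subgroup P S \<Longrightarrow> P \<subseteq> normalizer S P"
  using subgroup.subset[of P S] subgroup.m_closed[of P S] subgroup.m_inv_closed[of P S]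
  by (auto simp: normalizer_iff_subset conj_map_def)

lemma subgroup_card_prime_power: "subgroup P S \<Longrightarrow> \<exists>n. card P = p ^ n"
proof -
  assume P: "subgroup P S"
  obtain n where n: "order S = p ^ n" using order_power by blast
  have "card P dvd p ^ n" using lagrange[OF P] n by (metis dvd_triv_right)
  then show ?thesis using divides_primepow_nat[OF prime] by blast
qed

lemma extender_subgroup:
  assumes \<phi>: "mor P \<phi>" shows "subgroup (extender P \<phi>) S"
proof (rule subgroupI)
  note P = mor_subgroup[OF \<phi>]
  note N = normalizer_subgroup[OF P]
  have NP: "conj_map S x u \<in> P" "x \<in> carrier S" if "x \<in> normalizer S P" "u \<in> P" for x u
    using that by (auto simp: normalizer_iff_subset[OF P])
  show "extender P \<phi> \<subseteq> carrier S" using subgroup.subset[OF N] by (auto simp: extender_def)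
  have uP: "u \<in> carrier S" if "u \<in> P" for u using that subgroup.subset[OF P] by blast
  have "\<one> \<in> extender P \<phi>"
    unfolding extender_def using subgroup.one_closed[OF N] uP mor_closed[OF \<phi>] by (auto intro!: bexI[of _ \<one>])
  then show "extender P \<phi> \<noteq> {}" by blast
  fix a assume "a \<in> extender P \<phi>"
  then obtain y where a: "a \<in> normalizer S P" and y: "y \<in> carrier S" "\<And>u. u \<in> P \<Longrightarrow> \<phi> (conj_map S a u) = conj_map S y (\<phi> u)"
    by (auto simp: extender_def)
  have ac: "a \<in> carrier S" using a subgroup.subset[OF N] by blast
  have ia: "inv a \<in> normalizer S P" using subgroup.m_inv_closed[OF N a] .
  have "\<phi> (conj_map S (inv a) u) = conj_map S (inv y) (\<phi> u)" if u: "u \<in> P" for u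
  proof -
    have v: "conj_map S (inv a) u \<in> P" using NP ia u by blast
    have "\<phi> u = conj_map S y (\<phi> (conj_map S (inv a) u))"
      using y(2)[OF v] conj_map_conj_inv[OF ac uP[OF u]] by simp
    then show ?thesis using conj_map_inv_conj[OF y(1) mor_closed[OF \<phi> v]] by simp
  qed
  then show "inv a \<in> extender P \<phi>" unfolding extender_def using ia y(1) by blast
  fix b assume "b \<in> extender P \<phi>"
  then obtain z where b: "b \<in> normalizer S P" and z: "z \<in> carrier S" "\<And>u. u \<in> P \<Longrightarrow> \<phi> (conj_map S b u) = conj_map S z (\<phi> u)"
    by (auto simp: extender_def)
  have bc: "b \<in> carrier S" using b subgroup.subset[OF N] by blast
  have "\<phi> (conj_map S (a \<otimes> b) u) = conj_map S (y \<otimes> z) (\<phi> u)" if u: "u \<in> P" for u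
    using y(2)[OF NP(1)[OF b u]] z(2)[OF u] conj_map_conj[OF ac bc uP[OF u]] conj_map_conj[OF y(1) z(1) mor_closed[OF \<phi> u]] by simp
  then show "a \<otimes> b \<in> extender P \<phi>" unfolding extender_def using subgroup.m_closed[OF N a b] y(1) z(1) by blast
qed

lemma Aut_F_group:
  assumes P: "subgroup P S" shows "finite_group (Aut_F P)"
proof -
  note bij = F_Bij[OF P]
  interpret Bij: group "BijGroup P" by (rule group_BijGroup)
  have "subgroup (F P P) (BijGroup P)"
  proof (rule Bij.subgroupI)
    show "F P P \<subseteq> carrier (BijGroup P)" using bij by (auto simp: BijGroup_def)
    show "F P P \<noteq> {}" using F_inclusion[OF P P] by blast
    fix \<phi> assume \<phi>: "\<phi> \<in> F P P"
    have "\<phi> ` P = P" using bij[OF \<phi>] by (simp add: Bij_def bij_betw_def)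
    then show "inv\<^bsub>BijGroup P\<^esub> \<phi> \<in> F P P" using inv_BijGroup[OF bij[OF \<phi>]] mor_inverse[OF P P \<phi>] by simp
    fix \<psi> assume \<psi>: "\<psi> \<in> F P P"
    show "\<phi> \<otimes>\<^bsub>BijGroup P\<^esub> \<psi> \<in> F P P" using bij[OF \<phi>] bij[OF \<psi>] mor_compose[OF P P P \<psi> \<phi>] by (simp add: BijGroup_def)
  qed
  then have "group (Aut_F P)" unfolding Aut_F_def by (rule Bij.subgroup_imp_group)
  moreover have "finite (F P P)"
    by (rule finite_subset[OF _ finite_F[OF P]]) (use F_mor[OF P P] in \<open>auto simp: mor_def\<close>)
  ultimately show ?thesis by (simp add: finite_group_def finite_group_axioms_def Aut_F_def)
qed

lemma Aut_F_mult:
  assumes P: "subgroup P S" and \<phi>: "\<phi> \<in> F P P" and \<psi>: "\<psi> \<in> F P P" and u: "u \<in> P"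
  shows "(\<phi> \<otimes>\<^bsub>Aut_F P\<^esub> \<psi>) u = \<phi> (\<psi> u)"
  using F_Bij[OF P \<phi>] F_Bij[OF P \<psi>] u by (simp add: Aut_F_def BijGroup_def compose_def)

lemma carrier_Aut_F [simp]: "carrier (Aut_F P) = F P P"
  by (simp add: Aut_F_def)

end

text \<open>The number of cosets of \<open>H\<close> is prime to \<open>p\<close>, so the \<open>p\<close>-group \<open>N\<close> fixes one of them.\<close>

lemma (in finite_group) sylow_subgroup_contains_conjugate:
  fixes N :: "'n monoid"
  assumes p: "Factorial_Ring.prime p" and H: "sylow_subgroup p H G"
    and N: "group N" "order N = p ^ n" and \<beta>: "\<beta> \<in> hom N G"
  obtains g where "g \<in> carrier G" "\<beta> ` carrier N \<subseteq> conj_map G g ` H"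
proof -
  obtain a m where H': "subgroup H G" "card H = p ^ a" "order G = p ^ a * m" "\<not> p dvd m"
    using H by (auto simp: sylow_subgroup_def)
  let ?X = "coset_gset G H"
  note X = is_gset_coset[OF H'(1)]
  have p0: "p > 0" using p prime_gt_0_nat by blast
  have finN: "finite (carrier N)"
    using N(2) p0 unfolding order_def by (metis card_gt_0_iff zero_less_power)
  interpret N: local_burnside N p
    using N(1) finN p by (simp add: local_burnside_def finite_group_def finite_group_axioms_def local_burnside_axioms_def)
  note Y = is_gset_res[OF X N(1) \<beta>]
  have "card (fst ?X) * p ^ a = p ^ a * m"
    using l_lagrange[OF finite_carrier H'(1)] H'(2,3) by (simp add: coset_gset_def)
  then have cX: "card (fst ?X) = m" using p0 by simp
  have f: "Poly_Mapping.single (iso_class N (gset_res \<beta> ?X)) 1 \<in> carrier (gset_ring p N)"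
    by (rule formal_single[OF p iso_class_in_iso_classes[OF Y] Z_loc_1[OF p]])
  obtain r where r: "r \<in> Z_loc p" "mark N {\<one>\<^bsub>N\<^esub>} (Poly_Mapping.single (iso_class N (gset_res \<beta> ?X)) 1) =
      mark N (carrier N) (Poly_Mapping.single (iso_class N (gset_res \<beta> ?X)) 1) + of_nat p * r"
    using N.p_group_mark_congruence_carrier[OF N(2) f] by metis
  have "fixed_points {\<one>\<^bsub>N\<^esub>} (gset_res \<beta> ?X) = fst ?X"
    using is_gset_one[OF Y] by (auto simp: fixed_points_def gset_res_def)
  then have eq: "of_nat m = (of_nat (card (fixed_points (\<beta> ` carrier N) ?X)) :: rat) + of_nat p * r"
    using r(2) cX by (simp add: mark_single[OF Y] fixed_points_res[of "carrier N"])
  have "fixed_points (\<beta> ` carrier N) ?X \<noteq> {}"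
  proof
    assume "fixed_points (\<beta> ` carrier N) ?X = {}"
    then have "0 = of_nat m + of_nat p * (- r)" using eq by simp
    then show False using Z_loc_unit[OF p H'(4) Z_loc_uminus[OF p r(1)]] by blast
  qed
  moreover have "\<beta> ` carrier N \<subseteq> carrier G" using \<beta> by (auto simp: hom_def)
  ultimately show thesis using fixed_points_coset_nonempty[OF H'(1)] that by metis
qed

context saturated_fusion_system
begin

text \<open>Transporting \<open>Aut_S(Q)\<close> along \<open>\<phi>\<close> gives a \<open>p\<close>-subgroup of \<open>Aut_F(P)\<close>. An automorphism \<open>\<alpha>\<close> of \<open>P\<close> moves
it into the Sylow subgroup \<open>Aut_S(P)\<close>, and then \<open>\<alpha>\<close> after \<open>\<phi>\<close> extends to the whole normalizer of \<open>Q\<close>.\<close>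

lemma morphism_on_normalizer:
  assumes \<phi>: "mor Q \<phi>" "\<phi> ` Q = P" and P: "fully_normalized P"
  obtains \<chi> where "mor (normalizer S Q) \<chi>" "\<chi> ` Q = P"
proof -
  note Q = mor_subgroup[OF \<phi>(1)]
  have Ps: "subgroup P S" using mor_image_subgroup[OF \<phi>(1)] \<phi>(2) by simp
  note N = normalizer_subgroup[OF Q]
  let ?N = "normalizer S Q"
  interpret A: finite_group "Aut_F P" by (rule Aut_F_group[OF Ps])
  have NQ: "conj_map S x u \<in> Q" "x \<in> carrier S" if "x \<in> ?N" "u \<in> Q" for x u
    using that by (auto simp: normalizer_iff_subset[OF Q])
  have NS: "x \<in> carrier S" if "x \<in> ?N" for x using that subgroup.subset[OF N] by blast
  have uQ: "u \<in> carrier S" if "u \<in> Q" for u using that subgroup.subset[OF Q] by blast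
  define i where "i = restrict (inv_into Q \<phi>) P"
  have i: "mor P i" using mor_inverse'[OF \<phi>(1)] \<phi>(2) by (simp add: i_def)
  have i\<phi>: "i (\<phi> u) = u" if "u \<in> Q" for u
    using that \<phi>(2) mor_inj[OF \<phi>(1)] by (auto simp: i_def)
  have iQ: "i v \<in> Q" "\<phi> (i v) = v" if v: "v \<in> P" for v
  proof -
    obtain u where "u \<in> Q" "v = \<phi> u" using v \<phi>(2) by blast
    then show "i v \<in> Q" "\<phi> (i v) = v" using i\<phi> by auto
  qed
  define \<beta> where "\<beta> x = (\<lambda>v\<in>P. \<phi> (conj_map S x (i v)))" for x
  have \<beta>F: "\<beta> x \<in> F P P" if x: "x \<in> ?N" for x
  proof -
    let ?c = "restrict (conj_map S x) Q"
    have c: "mor Q ?c" by (rule mor_conj_map[OF Q NS[OF x]])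
    have ci: "mor P (compose P ?c i)" by (rule mor_comp[OF i c]) (use iQ in auto)
    have "compose P ?c i ` P \<subseteq> Q" using iQ NQ[OF x] by (auto simp: compose_def)
    then have "mor P (compose P \<phi> (compose P ?c i))" by (rule mor_comp[OF ci \<phi>(1)])
    moreover have "compose P \<phi> (compose P ?c i) = \<beta> x" using iQ by (auto simp: \<beta>_def compose_def fun_eq_iff)
    ultimately have "mor P (\<beta> x)" by simp
    moreover have "\<beta> x ` P \<subseteq> P" using iQ NQ[OF x] \<phi>(2) by (auto simp: \<beta>_def)
    ultimately show ?thesis using mor_F[OF _ Ps] by blast
  qed
  have "\<beta> \<in> hom (sub ?N) (Aut_F P)"
  proof (rule homI)
    show "\<beta> x \<in> carrier (Aut_F P)" if "x \<in> carrier (sub ?N)" for x using \<beta>F that by simp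
    fix x y assume "x \<in> carrier (sub ?N)" "y \<in> carrier (sub ?N)"
    then have x: "x \<in> ?N" and y: "y \<in> ?N" by auto
    have xy: "x \<otimes> y \<in> ?N" using subgroup.m_closed[OF N x y] .
    have "\<beta> (x \<otimes> y) = \<beta> x \<otimes>\<^bsub>Aut_F P\<^esub> \<beta> y"
    proof (rule extensionalityI[of _ P])
      show "\<beta> (x \<otimes> y) \<in> extensional P" by (simp add: \<beta>_def)
      show "\<beta> x \<otimes>\<^bsub>Aut_F P\<^esub> \<beta> y \<in> extensional P"
        using F_extensional[OF Ps Ps] A.m_closed \<beta>F[OF x] \<beta>F[OF y] by simp
      fix v assume v: "v \<in> P"
      have yi: "conj_map S y (i v) \<in> Q" using NQ(1)[OF y iQ(1)[OF v]] .
      then have "\<phi> (conj_map S y (i v)) \<in> P" using \<phi>(2) by blast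
      then show "\<beta> (x \<otimes> y) v = (\<beta> x \<otimes>\<^bsub>Aut_F P\<^esub> \<beta> y) v"
        unfolding Aut_F_mult[OF Ps \<beta>F[OF x] \<beta>F[OF y] v]
        using v i\<phi>[OF yi] conj_map_conj[OF NS[OF x] NS[OF y] uQ[OF iQ(1)[OF v]]] by (simp add: \<beta>_def)
    qed
    then show "\<beta> (x \<otimes>\<^bsub>sub ?N\<^esub> y) = \<beta> x \<otimes>\<^bsub>Aut_F P\<^esub> \<beta> y" by simp
  qed
  note \<beta>_hom = this
  obtain n where n: "order (sub ?N) = p ^ n"
    using subgroup_card_prime_power[OF N] by (auto simp: order_def)
  have syl: "fully_centralized P" "sylow_subgroup p (Aut_S P) (Aut_F P)" using sylow[OF Ps P] by auto
  obtain g where "g \<in> carrier (Aut_F P)" "\<beta> ` carrier (sub ?N) \<subseteq> conj_map (Aut_F P) g ` Aut_S P"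
    by (rule A.sylow_subgroup_contains_conjugate[OF prime syl(2) subgroup_imp_group[OF N] n \<beta>_hom])
  then have g: "g \<in> F P P" "\<beta> ` ?N \<subseteq> conj_map (Aut_F P) g ` Aut_S P" by simp_all
  define \<alpha> where "\<alpha> = inv\<^bsub>Aut_F P\<^esub> g"
  have \<alpha>: "\<alpha> \<in> F P P" using A.inv_closed g(1) by (simp add: \<alpha>_def)
  have \<alpha>P: "\<alpha> v \<in> P" if "v \<in> P" for v using F_funcset[OF Ps Ps \<alpha> that] .
  define \<phi>' where "\<phi>' = compose Q \<alpha> \<phi>"
  have \<phi>': "mor Q \<phi>'" unfolding \<phi>'_def by (rule mor_comp[OF \<phi>(1) F_mor[OF Ps Ps \<alpha>]]) (simp add: \<phi>(2))
  have \<alpha>im: "\<alpha> ` P = P" using F_Bij[OF Ps \<alpha>] by (simp add: Bij_def bij_betw_def)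
  have im: "\<phi>' ` Q = P" unfolding \<phi>'_def using \<phi>(2) \<alpha>im by (simp add: compose_image)
  have "?N \<subseteq> extender Q \<phi>'"
  proof
    fix x assume x: "x \<in> ?N"
    obtain s where s: "s \<in> Aut_S P" "\<beta> x = conj_map (Aut_F P) g s" using g(2) x by blast
    obtain y where y: "y \<in> normalizer S P" "s = restrict (conj_map S y) P" using s(1) by (auto simp: Aut_S_def)
    have yc: "y \<in> carrier S" using y(1) subgroup.subset[OF normalizer_subgroup[OF Ps]] by blast
    have sF: "s \<in> F P P" using s(1) syl(2) subgroup.subset unfolding sylow_subgroup_def by fastforce
    have "\<alpha> \<otimes>\<^bsub>Aut_F P\<^esub> \<beta> x = s \<otimes>\<^bsub>Aut_F P\<^esub> \<alpha>"
    proof -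
      have gc: "g \<in> carrier (Aut_F P)" and sc: "s \<in> carrier (Aut_F P)" using g(1) sF by simp_all
      show ?thesis
        unfolding s(2) \<alpha>_def conj_map_def using gc sc by (simp del: carrier_Aut_F add: A.m_assoc[symmetric])
    qed
    then have comm: "\<alpha> (\<beta> x v) = s (\<alpha> v)" if "v \<in> P" for v
      using Aut_F_mult[OF Ps \<alpha> \<beta>F[OF x] that] Aut_F_mult[OF Ps sF \<alpha> that] by simp
    have "\<phi>' (conj_map S x u) = conj_map S y (\<phi>' u)" if u: "u \<in> Q" for u
    proof -
      have v: "\<phi> u \<in> P" using u \<phi>(2) by blast
      have "\<beta> x (\<phi> u) = \<phi> (conj_map S x u)" using v i\<phi>[OF u] by (simp add: \<beta>_def)
      then show ?thesis using comm[OF v] NQ(1)[OF x u] u \<alpha>P[OF v] y(2) by (simp add: \<phi>'_def compose_def)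
    qed
    then show "x \<in> extender Q \<phi>'" unfolding extender_def using x yc by blast
  qed
  then have ext: "extender Q \<phi>' = ?N" by (auto simp: extender_def)
  obtain \<chi> where \<chi>: "\<chi> \<in> F ?N (carrier S)" "\<forall>u\<in>Q. \<chi> u = \<phi>' u"
    using extension[OF Q mor_in[OF \<phi>']] syl(1) im ext by auto
  show thesis
  proof
    show "mor ?N \<chi>" using \<chi>(1) N by (simp add: mor_def)
    show "\<chi> ` Q = P" using \<chi>(2) im by auto
  qed
qed

text \<open>First carry the image of \<open>\<phi>\<close> to \<open>P0\<close> by a morphism \<open>\<chi>\<close> defined on its whole normalizer. If \<open>(y, x)\<close>
normalizes the graph, then conjugation by \<open>x\<close> corresponds under \<open>\<phi>\<close> to conjugation by \<open>y\<close>, and under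
\<open>\<chi> \<phi>\<close> to conjugation by \<open>\<chi> y\<close>. So \<open>x\<close> lies in the extender of \<open>\<chi> \<phi>\<close>, on which an extension \<open>\<psi>\<close> is
defined because \<open>P0\<close> is fully centralized. The pair \<open>(\<chi>, \<psi>)\<close> maps the graph to the diagonal of \<open>P0\<close>.\<close>

lemma normalizer_transport:
  assumes \<phi>: "mor P \<phi>" and P0: "P0 \<in> conjugates P" "fully_normalized P0"
  obtains \<chi> \<psi> M N where "mor M \<chi>" "mor N \<psi>" "normalizer SS (twisted_diagonal P \<phi>) \<subseteq> M \<times> N"
    "(\<lambda>(a, b). (\<chi> a, \<psi> b)) ` twisted_diagonal P \<phi> = twisted_diagonal P0 (\<lambda>u\<in>P0. u)"
proof -
  note P = mor_subgroup[OF \<phi>] and I = mor_image_subgroup[OF \<phi>]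
  have P0s: "subgroup P0 S" using P0(1) by (simp add: conjugates_def)
  have "\<phi> ` P \<in> conjugates P" using conjugates_iff[OF P] \<phi> by blast
  then have "P0 \<in> conjugates (\<phi> ` P)" using conjugates_eq[OF P] P0(1) by simp
  then obtain \<tau> where \<tau>: "mor (\<phi> ` P) \<tau>" "\<tau> ` \<phi> ` P = P0" by (auto simp: conjugates_iff[OF I])
  obtain \<chi> where \<chi>: "mor (normalizer S (\<phi> ` P)) \<chi>" "\<chi> ` \<phi> ` P = P0"
    by (rule morphism_on_normalizer[OF \<tau> P0(2)])
  note sub = subgroup_le_normalizer[OF I]
  define \<phi>1 where "\<phi>1 = compose P \<chi> \<phi>"
  have \<phi>1: "mor P \<phi>1" unfolding \<phi>1_def by (rule mor_comp[OF \<phi> \<chi>(1) sub])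
  have im: "\<phi>1 ` P = P0" using \<chi>(2) by (simp add: \<phi>1_def compose_def image_image)
  have "fully_centralized (\<phi>1 ` P)" using sylow[OF P0s P0(2)] im by simp
  then obtain \<psi> where \<psi>: "\<psi> \<in> F (extender P \<phi>1) (carrier S)" "\<forall>u\<in>P. \<psi> u = \<phi>1 u"
    using extension[OF P mor_in[OF \<phi>1]] by blast
  let ?D = "twisted_diagonal P \<phi>"
  note D = twisted_diagonal_subgroup[OF \<phi>]
  show thesis
  proof
    show "mor (normalizer S (\<phi> ` P)) \<chi>" by (rule \<chi>(1))
    show "mor (extender P \<phi>1) \<psi>" using \<psi>(1) extender_subgroup[OF \<phi>1] by (simp add: mor_def)
    show "normalizer SS ?D \<subseteq> normalizer S (\<phi> ` P) \<times> extender P \<phi>1"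
    proof
      fix e assume e: "e \<in> normalizer SS ?D"
      have eD: "e \<in> carrier SS" "conj_map SS e ` ?D \<subseteq> ?D" using e B.KG.normalizer_iff_subset[OF D] by auto
      obtain y x where xy: "e = (y, x)" "y \<in> carrier S" "x \<in> carrier S" using eD(1) by auto
      have c: "conj_map S x u \<in> P" "\<phi> (conj_map S x u) = conj_map S y (\<phi> u)" if u: "u \<in> P" for u
      proof -
        have "conj_map SS e (\<phi> u, u) \<in> ?D" using eD(2) u by (auto simp: twisted_diagonal_def)
        then show "conj_map S x u \<in> P" "\<phi> (conj_map S x u) = conj_map S y (\<phi> u)"
          unfolding xy(1) conj_map_SS[OF xy(2,3)] by (auto simp: twisted_diagonal_def)
      qed
      have xN: "x \<in> normalizer S P" using c(1) xy(3) by (auto simp: normalizer_iff_subset[OF P])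
      have yN: "y \<in> normalizer S (\<phi> ` P)"
        unfolding normalizer_iff_subset[OF I] using c xy(2) by (auto simp: c(2)[symmetric])
      have "\<phi>1 (conj_map S x u) = conj_map S (\<chi> y) (\<phi>1 u)" if u: "u \<in> P" for u
      proof -
        have fu: "\<phi> u \<in> normalizer S (\<phi> ` P)" using sub u by blast
        have iy: "inv y \<in> normalizer S (\<phi> ` P)" using subgroup.m_inv_closed[OF mor_subgroup[OF \<chi>(1)] yN] .
        have yf: "y \<otimes> \<phi> u \<in> normalizer S (\<phi> ` P)" using subgroup.m_closed[OF mor_subgroup[OF \<chi>(1)] yN fu] .
        have "\<chi> (conj_map S y (\<phi> u)) = conj_map S (\<chi> y) (\<chi> (\<phi> u))"
          unfolding conj_map_def using mor_mult[OF \<chi>(1) yf iy] mor_mult[OF \<chi>(1) yN fu] mor_inv[OF \<chi>(1) yN] by simp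
        then show ?thesis using c[OF u] u by (simp add: \<phi>1_def compose_def)
      qed
      then have "x \<in> extender P \<phi>1" unfolding extender_def using xN mor_closed[OF \<chi>(1) yN] by blast
      then show "e \<in> normalizer S (\<phi> ` P) \<times> extender P \<phi>1" using yN xy(1) by simp
    qed
    have "(\<lambda>(a, b). (\<chi> a, \<psi> b)) ` ?D = (\<lambda>u. (\<phi>1 u, \<phi>1 u)) ` P"
      unfolding twisted_diagonal_image image_image using \<psi>(2) by (intro image_cong) (auto simp: \<phi>1_def compose_def)
    also have "\<dots> = (\<lambda>v. (v, v)) ` P0" unfolding im[symmetric] image_image ..
    also have "\<dots> = twisted_diagonal P0 (\<lambda>u\<in>P0. u)" unfolding twisted_diagonal_image by (intro image_cong) auto
    finally show "(\<lambda>(a, b). (\<chi> a, \<psi> b)) ` ?D = twisted_diagonal P0 (\<lambda>u\<in>P0. u)" .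
  qed
qed

end

section \<open>Stabilization of a biset\<close>

lemma (in finite_group) mark_generate:
  assumes f: "f \<in> carrier (gset_ring p G)" shows "mark G (generate G A) f = mark G A f"
  unfolding mark_def
proof (rule burnside_weight_cong[OF f])
  fix B assume B: "subgroup B G"
  have "generate G A \<subseteq> B \<longleftrightarrow> A \<subseteq> B" using generate_subgroup_incl[OF _ B] generate.incl[of _ A G] by auto
  then show "mark_weight (generate G A) B = mark_weight A B" by (simp add: mark_weight_def)
qed

context fusion_system
begin

text \<open>Stability for the graphs with more than \<open>k\<close> elements.\<close>

definition stable_above :: "nat \<Rightarrow> (('a \<times> 'a, nat) gset set \<Rightarrow>\<^sub>0 rat) \<Rightarrow> bool"
  where "stable_above k f \<longleftrightarrow> (\<forall>Q \<psi> E. mor Q \<psi> \<longrightarrow> fdiag E \<longrightarrow> k < card E \<longrightarrow>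
    (snd ` E \<subseteq> Q \<longrightarrow> mark SS ((\<lambda>(a, b). (a, \<psi> b)) ` E) f = mark SS E f) \<and>
    (fst ` E \<subseteq> Q \<longrightarrow> mark SS ((\<lambda>(a, b). (\<psi> a, b)) ` E) f = mark SS E f))"

lemma card_snd_map:
  assumes \<psi>: "mor Q \<psi>" and sub: "snd ` E \<subseteq> Q" shows "card ((\<lambda>(a, b). (a, \<psi> b)) ` E) = card E"
proof (rule card_image, rule inj_onI)
  fix e e' assume e: "e \<in> E" "e' \<in> E" "(case e of (a, b) \<Rightarrow> (a, \<psi> b)) = (case e' of (a, b) \<Rightarrow> (a, \<psi> b))"
  have "snd e \<in> Q" "snd e' \<in> Q" using e sub by auto
  then show "e = e'" using e(3) mor_inj[OF \<psi>] by (auto simp: case_prod_unfold inj_on_def prod_eq_iff)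
qed

lemma card_fst_map:
  assumes \<psi>: "mor Q \<psi>" and sub: "fst ` E \<subseteq> Q" shows "card ((\<lambda>(a, b). (\<psi> a, b)) ` E) = card E"
proof (rule card_image, rule inj_onI)
  fix e e' assume e: "e \<in> E" "e' \<in> E" "(case e of (a, b) \<Rightarrow> (\<psi> a, b)) = (case e' of (a, b) \<Rightarrow> (\<psi> a, b))"
  have "fst e \<in> Q" "fst e' \<in> Q" using e sub by auto
  then show "e = e'" using e(3) mor_inj[OF \<psi>] by (auto simp: case_prod_unfold inj_on_def prod_eq_iff)
qed

lemma map_pair_hom:
  assumes \<chi>: "mor M \<chi>" and \<psi>: "mor N \<psi>"
  shows "group_hom (SS\<lparr>carrier := M \<times> N\<rparr>) SS (\<lambda>(a, b). (\<chi> a, \<psi> b))" "subgroup (M \<times> N) SS"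
    "inj_on (\<lambda>(a, b). (\<chi> a, \<psi> b)) (M \<times> N)"
proof -
  show sub: "subgroup (M \<times> N) SS"
    by (intro DirProd_subgroups is_group mor_subgroup[OF \<chi>] mor_subgroup[OF \<psi>])
  show "group_hom (SS\<lparr>carrier := M \<times> N\<rparr>) SS (\<lambda>(a, b). (\<chi> a, \<psi> b))"
    using B.KG.subgroup_imp_group[OF sub] B.KG.is_group
    by (auto simp: group_hom_def group_hom_axioms_def hom_def mor_closed[OF \<chi>] mor_closed[OF \<psi>]
        mor_mult[OF \<chi>] mor_mult[OF \<psi>])
  show "inj_on (\<lambda>(a, b). (\<chi> a, \<psi> b)) (M \<times> N)"
    using mor_inj[OF \<chi>] mor_inj[OF \<psi>] by (auto simp: inj_on_def)
qed

text \<open>If \<open>E\<close> is not a graph of a morphism, then neither is its image, and both marks vanish.\<close>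

lemma mark_map_pair:
  assumes f: "f \<in> carrier (gset_ring p SS)" and gen: "fgen f" and st: "stable_above k f"
    and \<chi>: "mor M \<chi>" and \<psi>: "mor N \<psi>" and E: "subgroup E SS" "E \<subseteq> M \<times> N" and card: "k < card E"
  shows "mark SS ((\<lambda>(a, b). (\<chi> a, \<psi> b)) ` E) f = mark SS E f"
proof -
  let ?E = "(\<lambda>(a, b). (a, \<psi> b)) ` E"
  have sE: "snd ` E \<subseteq> N" using E(2) by auto
  have fE: "fst ` ?E \<subseteq> M" using E(2) by auto
  have eq: "(\<lambda>(a, b). (\<chi> a, \<psi> b)) ` E = (\<lambda>(a, b). (\<chi> a, b)) ` ?E"
    unfolding image_image by (intro image_cong) auto
  show ?thesis
  proof (cases "fdiag E")
    case True
    have F: "fdiag ?E" using True fdiag_snd_map_iff[OF \<psi> sE] by simp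
    have "mark SS ((\<lambda>(a, b). (\<chi> a, b)) ` ?E) f = mark SS ?E f"
      using st \<chi> F fE card card_snd_map[OF \<psi> sE] unfolding stable_above_def by metis
    also have "\<dots> = mark SS E f" using st \<psi> True sE card unfolding stable_above_def by metis
    finally show ?thesis unfolding eq .
  next
    case False
    then have nf: "\<not> fdiag ((\<lambda>(a, b). (\<chi> a, \<psi> b)) ` E)"
      unfolding eq using fdiag_fst_map_iff[OF \<chi> fE] fdiag_snd_map_iff[OF \<psi> sE] by simp
    interpret h: group_hom "SS\<lparr>carrier := M \<times> N\<rparr>" SS "\<lambda>(a, b). (\<chi> a, \<psi> b)" by (rule map_pair_hom[OF \<chi> \<psi>])
    have "subgroup E (SS\<lparr>carrier := M \<times> N\<rparr>)" using B.KG.subgroup_incl[OF E(1) map_pair_hom(2)[OF \<chi> \<psi>] E(2)] .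
    then have "subgroup ((\<lambda>(a, b). (\<chi> a, \<psi> b)) ` E) SS" by (rule h.subgroup_img_is_subgroup)
    then show ?thesis using gen nf False E(1) by (simp add: fgen_def)
  qed
qed

text \<open>The conjugates of \<open>D\<close> that contain \<open>D\<close> are equal to \<open>D\<close>.\<close>

lemma mark_coset_self:
  assumes D: "subgroup D SS"
  shows "of_nat (card D) * mark SS D (Poly_Mapping.single (iso_class SS (coset_gset SS D)) 1) = of_nat (card (normalizer SS D))"
proof -
  have "of_nat (card D) * mark SS D (Poly_Mapping.single (iso_class SS (coset_gset SS D)) 1) =
      (\<Sum>e\<in>carrier SS. mark_weight D (conj_map SS e ` D))"
    using B.KG.orbit_weight_coset[OF D, of "mark_weight D"]
    by (simp add: mark_def burnside_weight_single[OF B.KG.is_gset_coset[OF D]])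
  also have "\<dots> = of_nat (card {e \<in> carrier SS. D \<subseteq> conj_map SS e ` D})"
    using B.KG.finite_carrier by (simp add: mark_weight_def sum.If_cases Int_def del: carrier_DirProd)
  also have "{e \<in> carrier SS. D \<subseteq> conj_map SS e ` D} = normalizer SS D"
  proof -
    have *: "D \<subseteq> conj_map SS e ` D \<longleftrightarrow> conj_map SS e ` D = D" if e: "e \<in> carrier SS" for e
      using card_subset_eq[of "conj_map SS e ` D" D] B.KG.subgroup_finite[OF D]
        B.KG.conj_image_card[OF e subgroup.subset[OF D]] by auto
    show ?thesis
    proof (rule Set.set_eqI)
      fix e show "e \<in> {e \<in> carrier SS. D \<subseteq> conj_map SS e ` D} \<longleftrightarrow> e \<in> normalizer SS D"
        unfolding B.KG.normalizer_iff[OF subgroup.subset[OF D]] mem_Collect_eq using *[of e] by (rule conj_cong[OF refl])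
    qed
  qed
  finally show ?thesis .
qed

end

context saturated_fusion_system
begin

text \<open>Apply \<open>burnside_average\<close> to the normalizer of the graph of \<open>\<phi>\<close>, and to its image in the normalizer of the
diagonal of \<open>P0\<close>. An element outside the graph generates with it a larger subgroup, where \<open>f\<close> is already
stable, so these summands agree. Each element of the graph contributes the difference of the marks
in question.\<close>

lemma mark_defect_divisible:
  assumes f: "f \<in> carrier (gset_ring p SS)" and gen: "fgen f" and st: "stable_above (card P) f"
    and \<phi>: "mor P \<phi>" and P0: "P0 \<in> conjugates P" "fully_normalized P0"
  obtains r where "r \<in> Z_loc p" "of_nat (card P) * (mark SS (twisted_diagonal P0 (\<lambda>u\<in>P0. u)) f - mark SS (twisted_diagonal P \<phi>) f) =
    of_nat (card (normalizer SS (twisted_diagonal P \<phi>))) * r"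
proof -
  let ?D = "twisted_diagonal P \<phi>" and ?Di = "twisted_diagonal P0 (\<lambda>u\<in>P0. u)"
  obtain \<chi> \<psi> M N where \<chi>: "mor M \<chi>" and \<psi>: "mor N \<psi>" and MN: "normalizer SS ?D \<subseteq> M \<times> N"
    and im: "(\<lambda>(a, b). (\<chi> a, \<psi> b)) ` ?D = ?Di" by (rule normalizer_transport[OF \<phi> P0])
  let ?\<theta> = "\<lambda>(a, b). (\<chi> a, \<psi> b)" and ?N = "normalizer SS ?D"
  interpret h: group_hom "SS\<lparr>carrier := M \<times> N\<rparr>" SS ?\<theta> by (rule map_pair_hom[OF \<chi> \<psi>])
  note MNs = map_pair_hom(2)[OF \<chi> \<psi>] and inj = map_pair_hom(3)[OF \<chi> \<psi>]
  note D = twisted_diagonal_subgroup[OF \<phi>]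
  note Dc = subgroup.subset[OF D]
  have N: "subgroup ?N SS" by (rule B.KG.normalizer_imp_subgroup[OF Dc])
  have nD: "conj_map SS m d \<in> ?D" if "m \<in> ?N" "d \<in> ?D" for m d
    using that B.KG.normalizer_iff_subset[OF D] by auto
  have DN: "?D \<subseteq> ?N"
  proof
    fix d assume d: "d \<in> ?D"
    have "conj_map SS d d' \<in> ?D" if "d' \<in> ?D" for d'
      unfolding conj_map_def using d that subgroup.m_closed[OF D] subgroup.m_inv_closed[OF D] by blast
    then show "d \<in> ?N" using d Dc B.KG.normalizer_iff_subset[OF D] by blast
  qed
  have Nim: "subgroup (?\<theta> ` ?N) SS"
    by (rule h.subgroup_img_is_subgroup[OF B.KG.subgroup_incl[OF N MNs MN]])
  have injN: "inj_on ?\<theta> ?N" by (rule inj_on_subset[OF inj MN])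
  have D0c: "?Di \<subseteq> carrier SS"
    unfolding im[symmetric] using subgroup.subset[OF Nim] DN by blast
  have \<theta>conj: "?\<theta> (conj_map SS m d) = conj_map SS (?\<theta> m) (?\<theta> d)" if "m \<in> M \<times> N" "d \<in> M \<times> N" for m d
    unfolding conj_map_def
    using h.hom_mult[of "m \<otimes>\<^bsub>SS\<^esub> d" "inv\<^bsub>SS\<^esub> m"] h.hom_mult[of m d] h.hom_inv[of m] that
      B.KG.m_inv_consistent[OF MNs that(1)] subgroup.m_closed[OF MNs that] subgroup.m_inv_closed[OF MNs that(1)] by simp
  have nD0: "conj_map SS m' d' \<in> ?Di" if m': "m' \<in> ?\<theta> ` ?N" and d': "d' \<in> ?Di" for m' d'
  proof -
    obtain m where m: "m \<in> ?N" "m' = ?\<theta> m" using m' by blast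
    have "d' \<in> ?\<theta> ` ?D" unfolding im by (rule d')
    then obtain d where d: "d \<in> ?D" "d' = ?\<theta> d" by blast
    have "m \<in> M \<times> N" "d \<in> M \<times> N" using m(1) d(1) DN MN by blast+
    then have "conj_map SS m' d' = ?\<theta> (conj_map SS m d)" using \<theta>conj m(2) d(2) by simp
    then show ?thesis unfolding im[symmetric] using nD[OF m(1) d(1)] by blast
  qed
  obtain r1 where r1: "r1 \<in> Z_loc p" "(\<Sum>m\<in>?N. mark SS (insert m ?D) f) = of_nat (card ?N) * r1"
    by (rule B.KG.burnside_average[OF f N Dc nD])
  obtain r2 where r2: "r2 \<in> Z_loc p" "(\<Sum>m\<in>?\<theta> ` ?N. mark SS (insert m ?Di) f) = of_nat (card (?\<theta> ` ?N)) * r2"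
    by (rule B.KG.burnside_average[OF f Nim D0c nD0])
  have r2': "(\<Sum>m\<in>?N. mark SS (insert (?\<theta> m) ?Di) f) = of_nat (card ?N) * r2"
    using r2(2) unfolding sum.reindex[OF injN] card_image[OF injN] by (simp add: o_def)
  have off: "mark SS (insert (?\<theta> m) ?Di) f = mark SS (insert m ?D) f" if m: "m \<in> ?N" "m \<notin> ?D" for m
  proof -
    let ?A = "insert m ?D"
    have A: "?A \<subseteq> ?N" "?A \<subseteq> M \<times> N" "?A \<subseteq> carrier SS" using m DN MN Dc subgroup.subset[OF N] by blast+
    let ?E = "generate SS ?A"
    have E: "subgroup ?E SS" by (rule B.KG.generate_is_subgroup[OF A(3)])
    have EMN: "?E \<subseteq> M \<times> N" by (rule B.KG.generate_subgroup_incl[OF A(2) MNs])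
    have "?A \<subseteq> ?E" using generate.incl[of _ ?A SS] by blast
    then have "card ?A \<le> card ?E" using B.KG.subgroup_finite[OF E] by (rule card_mono[rotated])
    moreover have "card ?A = Suc (card ?D)" using m(2) B.KG.subgroup_finite[OF D] by simp
    ultimately have lt: "card P < card ?E" using card_twisted_diagonal[of P \<phi>] by simp
    have "insert (?\<theta> m) ?Di = ?\<theta> ` ?A" by (simp add: im[symmetric])
    then have "mark SS (insert (?\<theta> m) ?Di) f = mark SS (generate SS (?\<theta> ` ?A)) f"
      using B.KG.mark_generate[OF f] by simp
    also have "generate SS (?\<theta> ` ?A) = ?\<theta> ` ?E"
      using h.generate_img[of ?A] A(2) B.KG.generate_consistent[OF A(2) MNs] by simp
    also have "mark SS (?\<theta> ` ?E) f = mark SS ?E f" by (rule mark_map_pair[OF f gen st \<chi> \<psi> E EMN lt])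
    also have "\<dots> = mark SS ?A f" by (rule B.KG.mark_generate[OF f])
    finally show ?thesis .
  qed
  have "of_nat (card ?N) * (r2 - r1) = (\<Sum>m\<in>?N. mark SS (insert (?\<theta> m) ?Di) f - mark SS (insert m ?D) f)"
    unfolding sum_subtractf r1(2) r2' by (simp add: right_diff_distrib)
  also have "\<dots> = (\<Sum>m\<in>?D. mark SS (insert (?\<theta> m) ?Di) f - mark SS (insert m ?D) f)"
    using off by (intro sum.mono_neutral_right B.KG.subgroup_finite[OF N] DN) auto
  also have "\<dots> = (\<Sum>m\<in>?D. mark SS ?Di f - mark SS ?D f)"
  proof (rule sum.cong[OF refl])
    fix m assume m: "m \<in> ?D"
    then have "?\<theta> m \<in> ?Di" using im by blast
    then show "mark SS (insert (?\<theta> m) ?Di) f - mark SS (insert m ?D) f = mark SS ?Di f - mark SS ?D f"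
      using m by (simp add: insert_absorb)
  qed
  also have "\<dots> = of_nat (card P) * (mark SS ?Di f - mark SS ?D f)" by (simp add: card_twisted_diagonal)
  finally show thesis using that[of "r2 - r1"] Z_loc_diff[OF prime r2(1) r1(1)] by simp
qed

text \<open>The common value that the marks on the graphs of all morphisms out of conjugates of \<open>Q\<close> are given by the
stabilization: the mark on the diagonal of a fully normalized conjugate.\<close>

definition target_mark :: "(('a \<times> 'a, nat) gset set \<Rightarrow>\<^sub>0 rat) \<Rightarrow> 'a set \<Rightarrow> rat"
  where "target_mark f Q = mark SS (twisted_diagonal (representative Q) (\<lambda>u\<in>representative Q. u)) f"

lemma target_mark_cong: "\<lbrakk>subgroup Q S; mor Q \<psi>\<rbrakk> \<Longrightarrow> target_mark f (\<psi> ` Q) = target_mark f Q"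
proof -
  assume Q: "subgroup Q S" and \<psi>: "mor Q \<psi>"
  have "\<psi> ` Q \<in> conjugates Q" using conjugates_iff[OF Q] \<psi> by blast
  then show ?thesis by (simp only: target_mark_def representative_cong[OF Q])
qed

text \<open>Add multiples of the transitive bisets of morphisms out of subgroups of order \<open>Suc k\<close>. They have no fixed
points under graphs that are larger, and among the graphs of the same order only under conjugate ones. So
the marks can be corrected independently for each conjugacy class; that the coefficients are
\<open>p\<close>-integral is \<open>mark_defect_divisible\<close>.\<close>

lemma stabilization_step:
  assumes f: "f \<in> carrier (gset_ring p SS)" and gen: "fgen f" and st: "stable_above (Suc k) f"
  obtains f' where "f' \<in> carrier (gset_ring p SS)" "fgen f'" "stable_above k f'"
    "mark SS (twisted_diagonal (carrier S) (\<lambda>u\<in>carrier S. u)) f' = mark SS (twisted_diagonal (carrier S) (\<lambda>u\<in>carrier S. u)) f"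
proof -
  define T where "T = {D. fdiag D \<and> card D = Suc k}"
  define cls where "cls D = iso_class SS (coset_gset SS D)" for D
  define x :: "('a \<times> 'a) set \<Rightarrow> rat" where "x D = target_mark f (snd ` D)" for D
  have Tsub: "subgroup D SS" "fdiag D" "card D = Suc k" if "D \<in> T" for D using that fdiag_subgroup by (auto simp: T_def)
  have "T \<subseteq> Pow (carrier SS)" using subgroup.subset[OF Tsub(1)] by blast
  then have finT: "finite T" using B.KG.finite_carrier finite_subset by blast
  have "\<exists>r. r \<in> Z_loc p \<and> r * mark SS D (Poly_Mapping.single (cls D) 1) = x D - mark SS D f" if D: "D \<in> T" for D
  proof -
    obtain P \<phi> where P: "mor P \<phi>" "D = twisted_diagonal P \<phi>" using Tsub(2)[OF D] by (auto simp: fdiag_def)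
    have cP: "card P = Suc k" using Tsub(3)[OF D] P(2) card_twisted_diagonal[of P \<phi>] by simp
    note rep = representative[OF mor_subgroup[OF P(1)]]
    obtain r where r: "r \<in> Z_loc p" "of_nat (card P) * (x D - mark SS D f) = of_nat (card (normalizer SS D)) * r"
      using mark_defect_divisible[OF f gen _ P(1) rep(1,2)] st unfolding cP P(2) x_def target_mark_def by auto
    have "of_nat (card P) * (r * mark SS D (Poly_Mapping.single (cls D) 1)) = r * (of_nat (card D) * mark SS D (Poly_Mapping.single (cls D) 1))"
      using P(2) card_twisted_diagonal[of P \<phi>] by simp
    also have "\<dots> = of_nat (card P) * (x D - mark SS D f)"
      unfolding cls_def mark_coset_self[OF Tsub(1)[OF D]] r(2) by simp
    finally have "r * mark SS D (Poly_Mapping.single (cls D) 1) = x D - mark SS D f" using cP by simp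
    then show ?thesis using r(1) by blast
  qed
  then obtain c where c: "\<And>D. D \<in> T \<Longrightarrow> c D \<in> Z_loc p"
    "\<And>D. D \<in> T \<Longrightarrow> c D * mark SS D (Poly_Mapping.single (cls D) 1) = x D - mark SS D f" by metis
  \<comment> \<open>Conjugate graphs have the same coset space, so there is one coefficient for each isomorphism class.\<close>
  define d where "d \<kappa> = inv_into T cls \<kappa>" for \<kappa>
  have d: "d \<kappa> \<in> T" "cls (d \<kappa>) = \<kappa>" if "\<kappa> \<in> cls ` T" for \<kappa>
    using that by (auto simp: d_def inv_into_into f_inv_into_f)
  define g where "g = (\<Sum>\<kappa>\<in>cls ` T. Poly_Mapping.single \<kappa> (c (d \<kappa>)))"
  have clsT: "cls ` T \<subseteq> fclasses" by (auto simp: T_def fdiag_def cls_def fclasses_def transitive_biset_def)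
  have gF: "g \<in> carrier (gset_ring p SS)"
    unfolding g_def using c(1) d(1) clsT fclasses_sub by (intro formal_sum[OF prime] formal_single[OF prime]) auto
  have "Poly_Mapping.keys g \<subseteq> fclasses"
    unfolding g_def using keys_sum[of "\<lambda>\<kappa>. Poly_Mapping.single \<kappa> (c (d \<kappa>))" "cls ` T"] clsT
    by (auto split: if_splits)
  then have ggen: "fgen g" by (rule fgen_fclasses)
  have mg: "mark SS E g = (\<Sum>\<kappa>\<in>cls ` T. c (d \<kappa>) * mark SS E (Poly_Mapping.single \<kappa> 1))" for E
    unfolding g_def mark_sum by (simp add: mark_def burnside_weight_def)
  have big: "\<exists>e\<in>carrier SS. E = conj_map SS e ` D" "cls E = cls D"
    if E: "subgroup E SS" "Suc k \<le> card E" and D: "D \<in> T" and nz: "mark SS E (Poly_Mapping.single (cls D) 1) \<noteq> 0" for E D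
  proof -
    have "card (fixed_points E (coset_gset SS D)) \<noteq> 0"
      using nz unfolding cls_def mark_single[OF B.KG.is_gset_coset[OF Tsub(1)[OF D]] subgroup.subset[OF E(1)]] by simp
    from B.KG.fixed_points_coset_same_card[OF Tsub(1)[OF D] E(1) _ this] Tsub(3)[OF D] E(2)
    show "\<exists>e\<in>carrier SS. E = conj_map SS e ` D" "cls E = cls D" unfolding cls_def by auto
  qed
  have out: "mark SS E g = 0" if E: "subgroup E SS" "Suc k \<le> card E" "E \<notin> T" for E
    unfolding mg
  proof (rule sum.neutral, rule ballI)
    fix \<kappa> assume \<kappa>: "\<kappa> \<in> cls ` T"
    have "mark SS E (Poly_Mapping.single (cls (d \<kappa>)) 1) = 0"
    proof (rule ccontr)
      assume "mark SS E (Poly_Mapping.single (cls (d \<kappa>)) 1) \<noteq> 0"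
      then obtain e where e: "e \<in> carrier SS" "E = conj_map SS e ` d \<kappa>" using big(1)[OF E(1,2) d(1)[OF \<kappa>]] by blast
      have "card E = Suc k"
        using e B.KG.conj_image_card[OF e(1) subgroup.subset[OF Tsub(1)[OF d(1)[OF \<kappa>]]]] Tsub(3)[OF d(1)[OF \<kappa>]] by simp
      moreover have "fdiag E" unfolding e(2) by (rule fdiag_conj[OF Tsub(2)[OF d(1)[OF \<kappa>]] e(1)])
      ultimately show False using E(3) by (simp add: T_def)
    qed
    then show "c (d \<kappa>) * mark SS E (Poly_Mapping.single \<kappa> 1) = 0" using d(2)[OF \<kappa>] by simp
  qed
  have inT: "mark SS E g = x E - mark SS E f" if E: "E \<in> T" for E
  proof -
    have \<kappa>: "cls E \<in> cls ` T" using E by blast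
    define D' where "D' = d (cls E)"
    have D: "D' \<in> T" "cls D' = cls E" using d[OF \<kappa>] by (simp_all add: D'_def)
    have "mark SS E g = (\<Sum>\<kappa>\<in>{cls E}. c (d \<kappa>) * mark SS E (Poly_Mapping.single \<kappa> 1))"
      unfolding mg
    proof (rule sum.mono_neutral_right)
      show "\<forall>\<kappa>\<in>cls ` T - {cls E}. c (d \<kappa>) * mark SS E (Poly_Mapping.single \<kappa> 1) = 0"
      proof
        fix \<kappa>' assume k': "\<kappa>' \<in> cls ` T - {cls E}"
        then have "mark SS E (Poly_Mapping.single (cls (d \<kappa>')) 1) = 0"
          using big(2)[OF Tsub(1)[OF E] _ d(1), of \<kappa>'] Tsub(3)[OF E] d(2)[of \<kappa>'] by auto
        then show "c (d \<kappa>') * mark SS E (Poly_Mapping.single \<kappa>' 1) = 0" using d(2)[of \<kappa>'] k' by simp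
      qed
    qed (use finT \<kappa> in auto)
    then have 1: "mark SS E g = c D' * mark SS E (Poly_Mapping.single (cls D') 1)" using D(2) by (simp add: D'_def)
    have "of_nat (card E) * mark SS E (Poly_Mapping.single (cls E) 1) \<noteq> 0"
      unfolding cls_def mark_coset_self[OF Tsub(1)[OF E]]
      using B.KG.subgroup_card_pos[OF B.KG.normalizer_imp_subgroup[OF subgroup.subset[OF Tsub(1)[OF E]]]] by simp
    then have "mark SS E (Poly_Mapping.single (cls D') 1) \<noteq> 0" using D(2) by simp
    then obtain e where e: "e \<in> carrier SS" "E = conj_map SS e ` D'"
      using big(1)[OF Tsub(1)[OF E] _ D(1)] Tsub(3)[OF E] by auto
    note Ds = subgroup.subset[OF Tsub(1)[OF D(1)]]
    have sing: "Poly_Mapping.single (cls D') 1 \<in> carrier (gset_ring p SS)"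
      using clsT fclasses_sub D(1) prime by (intro formal_single) auto
    have 2: "mark SS E (Poly_Mapping.single (cls D') 1) = mark SS D' (Poly_Mapping.single (cls D') 1)"
      by (subst e(2)) (rule B.KG.mark_conj[OF sing e(1) Ds])
    have 3: "mark SS E f = mark SS D' f" by (subst e(2)) (rule B.KG.mark_conj[OF f e(1) Ds])
    have 4: "x E = x D'"
    proof -
      obtain u v where uv: "e = (u, v)" "u \<in> carrier S" "v \<in> carrier S" using e(1) by auto
      have Q: "subgroup (snd ` D') S" by (rule snd_image_subgroup[OF Tsub(1)[OF D(1)]])
      have "snd ` E = (\<lambda>z. conj_map S v (snd z)) ` D'"
        unfolding e(2) uv(1) image_image using conj_map_SS[OF uv(2,3)] by (intro image_cong) (auto simp: case_prod_unfold)
      also have "\<dots> = restrict (conj_map S v) (snd ` D') ` (snd ` D')" by (auto simp: image_image)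
      finally show ?thesis unfolding x_def using target_mark_cong[OF Q mor_conj_map[OF Q uv(3)], of f] by simp
    qed
    show ?thesis unfolding 1 2 c(2)[OF D(1)] 3 4 ..
  qed
  have above: "mark SS E (f + g) = (if card E = Suc k then x E else mark SS E f)" if E: "fdiag E" "k < card E" for E
  proof (cases "card E = Suc k")
    case True
    then have "E \<in> T" using E(1) by (simp add: T_def)
    then show ?thesis using inT[of E] True by (simp add: mark_add)
  next
    case False
    then have "E \<notin> T" by (simp add: T_def)
    then show ?thesis using out[OF fdiag_subgroup[OF E(1)]] E(2) False by (simp add: mark_add)
  qed
  show thesis
  proof
    show "f + g \<in> carrier (gset_ring p SS)" by (rule formal_add[OF prime f gF])
    show "fgen (f + g)" using gen ggen by (simp add: fgen_def mark_add)
    show "stable_above k (f + g)"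
      unfolding stable_above_def
    proof (intro allI impI conjI)
      fix Q \<psi> E assume \<psi>: "mor Q \<psi>" and E: "fdiag E" and card: "k < card E"
      {
        assume sub: "snd ` E \<subseteq> Q"
        let ?E = "(\<lambda>(a, b). (a, \<psi> b)) ` E"
        have E': "fdiag ?E" "card ?E = card E" using fdiag_snd_map[OF E \<psi> sub] card_snd_map[OF \<psi> sub] by auto
        have sE: "subgroup (snd ` E) S" by (rule snd_image_subgroup[OF fdiag_subgroup[OF E]])
        have "snd ` ?E = restrict \<psi> (snd ` E) ` (snd ` E)" by (auto simp: image_image case_prod_unfold)
        then have "x ?E = x E" unfolding x_def using target_mark_cong[OF sE mor_restrict[OF \<psi> sE sub]] by simp
        moreover have "mark SS ?E f = mark SS E f" if "card E \<noteq> Suc k"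
          using st \<psi> E sub card that unfolding stable_above_def by (metis Suc_lessI)
        ultimately show "mark SS ?E (f + g) = mark SS E (f + g)"
          using above[OF E card] above[OF E'(1)] E'(2) card by simp
      next
        assume sub: "fst ` E \<subseteq> Q"
        let ?E = "(\<lambda>(a, b). (\<psi> a, b)) ` E"
        have E': "fdiag ?E" "card ?E = card E" using fdiag_fst_map[OF E \<psi> sub] card_fst_map[OF \<psi> sub] by auto
        have "snd ` ?E = snd ` E" by (auto simp: image_image case_prod_unfold)
        then have "x ?E = x E" unfolding x_def by simp
        moreover have "mark SS ?E f = mark SS E f" if "card E \<noteq> Suc k"
          using st \<psi> E sub card that unfolding stable_above_def by (metis Suc_lessI)
        ultimately show "mark SS ?E (f + g) = mark SS E (f + g)"
          using above[OF E card] above[OF E'(1)] E'(2) card by simp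
      }
    qed
    let ?D = "twisted_diagonal (carrier S) (\<lambda>u\<in>carrier S. u)"
    note i = mor_incl[OF subgroup_self]
    show "mark SS ?D (f + g) = mark SS ?D f"
    proof (cases "k < card ?D")
      case True
      \<comment> \<open>\<open>S\<close> is its only conjugate, so the mark at its diagonal is the target mark already.\<close>
      have "representative (carrier S) = carrier S"
        using representative(1)[OF subgroup_self] conjugates_whole by simp
      then have "x ?D = mark SS ?D f" by (simp add: x_def target_mark_def)
      then show ?thesis using above[OF fdiagI[OF i] True] by simp
    next
      case False
      then have "card (carrier S) \<le> k" using card_twisted_diagonal[of "carrier S" "\<lambda>u\<in>carrier S. u"] by simp
      have "T = {}"
      proof (rule equals0I)
        fix D assume D: "D \<in> T"
        then obtain P \<phi> where P: "mor P \<phi>" "D = twisted_diagonal P \<phi>" by (auto simp: T_def fdiag_def)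
        have "card D = card P" using P(2) card_twisted_diagonal[of P \<phi>] by simp
        also have "\<dots> \<le> card (carrier S)" using subgroup.subset[OF mor_subgroup[OF P(1)]] finite_carrier by (rule card_mono[rotated])
        finally show False using D \<open>card (carrier S) \<le> k\<close> by (simp add: T_def)
      qed
      then have "g = 0" by (simp add: g_def)
      then show ?thesis by simp
    qed
  qed
qed

end

section \<open>Existence of the characteristic idempotent\<close>

context saturated_fusion_system
begin

abbreviation diagonal_S :: "('a \<times> 'a) set"
  where "diagonal_S \<equiv> twisted_diagonal (carrier S) (\<lambda>u\<in>carrier S. u)"

definition identity_biset :: "('a \<times> 'a, nat) gset set \<Rightarrow>\<^sub>0 rat"
  where "identity_biset = biset_single S S (carrier S) (\<lambda>u\<in>carrier S. u)"

lemma identity_biset: "identity_biset \<in> carrier (gset_ring p SS)" "fgen identity_biset"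
proof -
  show "identity_biset \<in> carrier (gset_ring p SS)"
    unfolding identity_biset_def by (rule biset_single_mor[OF mor_incl[OF subgroup_self]])
  show "fgen identity_biset"
    by (rule fgen_fclasses)
      (use mor_incl[OF subgroup_self] in \<open>auto simp: identity_biset_def biset_single_def fclasses_def\<close>)
qed

lemma stable_above_whole: "stable_above (card (carrier S)) f"
proof -
  have "\<not> card (carrier S) < card E" if "fdiag E" for E
  proof -
    obtain P \<phi> where P: "mor P \<phi>" "E = twisted_diagonal P \<phi>" using \<open>fdiag E\<close> by (auto simp: fdiag_def)
    have "card P \<le> card (carrier S)"
      using subgroup.subset[OF mor_subgroup[OF P(1)]] finite_carrier by (rule card_mono[rotated])
    then show ?thesis using P(2) card_twisted_diagonal[of P \<phi>] by simp
  qed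
  then show ?thesis unfolding stable_above_def by blast
qed

lemma stabilization:
  "j \<le> card (carrier S) \<Longrightarrow> \<exists>f\<in>carrier (gset_ring p SS). fgen f \<and> stable_above (card (carrier S) - j) f \<and>
    mark SS diagonal_S f = mark SS diagonal_S identity_biset"
proof (induction j)
  case 0
  then show ?case using identity_biset stable_above_whole by auto
next
  case (Suc j)
  then obtain f where f: "f \<in> carrier (gset_ring p SS)" "fgen f" "stable_above (card (carrier S) - j) f"
    "mark SS diagonal_S f = mark SS diagonal_S identity_biset"
    using Suc_leD[OF Suc.prems] by blast
  have "stable_above (Suc (card (carrier S) - Suc j)) f" using f(3) Suc.prems by (simp add: Suc_diff_Suc)
  then obtain f' where f': "f' \<in> carrier (gset_ring p SS)" "fgen f'" "stable_above (card (carrier S) - Suc j) f'"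
    "mark SS diagonal_S f' = mark SS diagonal_S f" by (rule stabilization_step[OF f(1,2)])
  have "mark SS diagonal_S f' = mark SS diagonal_S identity_biset" using f'(4) f(4) by (rule trans)
  then show ?case using f'(1,2,3) by blast
qed

lemma stable_above_zero:
  assumes f: "f \<in> carrier (gset_ring p SS)" and gen: "fgen f" and st: "stable_above 0 f" shows "fstable f"
  unfolding fstable_def
proof (intro allI impI conjI)
  fix Q \<psi> E assume \<psi>: "mor Q \<psi>" and E: "subgroup E SS"
  have Ec: "E \<subseteq> carrier S \<times> carrier S" using subgroup.subset[OF E] by simp
  have pos: "0 < card E" by (rule B.KG.subgroup_card_pos[OF E])
  note i = mor_incl[OF subgroup_self]
  {
    assume "snd ` E \<subseteq> Q"
    then have "E \<subseteq> carrier S \<times> Q" using Ec by (auto simp: image_subset_iff)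
    from mark_map_pair[OF f gen st i \<psi> E this pos]
    have "mark SS ((\<lambda>(a, b). ((\<lambda>u\<in>carrier S. u) a, \<psi> b)) ` E) f = mark SS E f" .
    moreover have "(\<lambda>(a, b). ((\<lambda>u\<in>carrier S. u) a, \<psi> b)) ` E = (\<lambda>(a, b). (a, \<psi> b)) ` E"
      using Ec by (intro image_cong) auto
    ultimately show "mark SS ((\<lambda>(a, b). (a, \<psi> b)) ` E) f = mark SS E f" by simp
  next
    assume "fst ` E \<subseteq> Q"
    then have "E \<subseteq> Q \<times> carrier S" using Ec by (auto simp: image_subset_iff)
    from mark_map_pair[OF f gen st \<psi> i E this pos]
    have "mark SS ((\<lambda>(a, b). (\<psi> a, (\<lambda>u\<in>carrier S. u) b)) ` E) f = mark SS E f" .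
    moreover have "(\<lambda>(a, b). (\<psi> a, (\<lambda>u\<in>carrier S. u) b)) ` E = (\<lambda>(a, b). (\<psi> a, b)) ` E"
      using Ec by (intro image_cong) auto
    ultimately show "mark SS ((\<lambda>(a, b). (\<psi> a, b)) ` E) f = mark SS E f" by simp
  }
qed

lemma sylow_whole:
  obtains a m where "Aut_S (carrier S) \<subseteq> F (carrier S) (carrier S)" "card (Aut_S (carrier S)) = p ^ a"
    "card (F (carrier S) (carrier S)) = p ^ a * m" "\<not> p dvd m"
proof -
  have "fully_normalized (carrier S)" unfolding fully_normalized_def conjugates_whole by simp
  then have "sylow_subgroup p (Aut_S (carrier S)) (Aut_F (carrier S))" using sylow[OF subgroup_self] by blast
  then obtain a m where am: "subgroup (Aut_S (carrier S)) (Aut_F (carrier S))" "card (Aut_S (carrier S)) = p ^ a"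
    "order (Aut_F (carrier S)) = p ^ a * m" "\<not> p dvd m" by (auto simp: sylow_subgroup_def)
  show thesis using that[of a m] subgroup.subset[OF am(1)] am(2,3,4) by (simp add: order_def)
qed

text \<open>The diagonal of \<open>S\<close> is conjugate to the graphs of the inner automorphisms, and only to these.\<close>

lemma mark_identity_biset:
  assumes \<psi>: "\<psi> \<in> F (carrier S) (carrier S)"
  shows "mark SS (twisted_diagonal (carrier S) \<psi>) identity_biset =
    (if \<psi> \<in> Aut_S (carrier S) then mark SS diagonal_S identity_biset else 0)"
proof (cases "\<psi> \<in> Aut_S (carrier S)")
  case True
  note D = twisted_diagonal_subgroup[OF mor_incl[OF subgroup_self]]
  obtain y where y: "y \<in> carrier S" "\<psi> = restrict (conj_map S y) (carrier S)"
    using True subgroup.subset[OF normalizer_subgroup[OF subgroup_self]] by (auto simp: Aut_S_def)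
  have "twisted_diagonal (carrier S) \<psi> = conj_map SS (y, \<one>) ` diagonal_S"
    unfolding twisted_diagonal_image image_image using y by (intro image_cong) (auto simp: conj_map_SS)
  then show ?thesis
    using True B.KG.mark_conj[OF identity_biset(1) _ subgroup.subset[OF D], of "(y, \<one>)"] y(1) by simp
next
  case False
  note i = mor_incl[OF subgroup_self]
  note D = twisted_diagonal_subgroup[OF i]
  have \<psi>': "mor (carrier S) \<psi>" using \<psi> subgroup_self by (simp add: mor_def)
  note E = twisted_diagonal_subgroup[OF \<psi>']
  have "fixed_points (twisted_diagonal (carrier S) \<psi>) (coset_gset SS diagonal_S) = {}"
  proof (rule ccontr)
    assume "fixed_points (twisted_diagonal (carrier S) \<psi>) (coset_gset SS diagonal_S) \<noteq> {}"
    then obtain e where e: "e \<in> carrier SS" "twisted_diagonal (carrier S) \<psi> \<subseteq> conj_map SS e ` diagonal_S"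
      using B.KG.fixed_points_coset_nonempty[OF D subgroup.subset[OF E]] by metis
    obtain u v where uv: "e = (u, v)" "u \<in> carrier S" "v \<in> carrier S" using e(1) by auto
    have "\<psi> q = conj_map S (u \<otimes> inv v) q" if q: "q \<in> carrier S" for q
    proof -
      have "(\<psi> q, q) \<in> twisted_diagonal (carrier S) \<psi>" using q by (auto simp: twisted_diagonal_def)
      then have "(\<psi> q, q) \<in> conj_map SS e ` diagonal_S" using e(2) by blast
      then obtain w where w: "w \<in> carrier S" "\<psi> q = conj_map S u w" "q = conj_map S v w"
        using uv by (auto simp: twisted_diagonal_def conj_map_SS)
      then have "conj_map S (inv v) q = w" using conj_map_inv_conj[OF uv(3)] by simp
      then show ?thesis using w(2) conj_map_conj[OF uv(2) inv_closed[OF uv(3)] q] by simp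
    qed
    then have "\<psi> = restrict (conj_map S (u \<otimes> inv v)) (carrier S)"
      using mor_extensional[OF \<psi>'] by (auto simp: fun_eq_iff extensional_def)
    moreover have "u \<otimes> inv v \<in> normalizer S (carrier S)"
      using uv normalizer_iff[OF subset_refl] by (simp add: conj_image_carrier)
    ultimately show False using False by (auto simp: Aut_S_def)
  qed
  then have "mark SS (twisted_diagonal (carrier S) \<psi>) identity_biset = 0"
    unfolding identity_biset_def biset_single_def transitive_biset_def
    by (simp add: mark_single[OF B.KG.is_gset_coset[OF D] subgroup.subset[OF E]])
  then show ?thesis using False by simp
qed

text \<open>The trace at \<open>S\<close> of the identity biset is \<open>1\<close>, where only the morphisms in \<open>Aut_S(S)\<close> contribute, each
with the mark at the diagonal. For \<open>f\<close> all of \<open>Aut_F(S)\<close> contributes this same mark. So the trace is the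
index, and \<open>Aut_S(S)\<close> is a Sylow subgroup.\<close>

lemma trace_whole:
  assumes st: "fstable f" and eq: "mark SS diagonal_S f = mark SS diagonal_S identity_biset"
  obtains m where "\<not> p dvd m" "trace (carrier S) f = of_nat m"
proof -
  let ?x = "mark SS diagonal_S identity_biset"
  obtain a m where a: "Aut_S (carrier S) \<subseteq> F (carrier S) (carrier S)" "card (Aut_S (carrier S)) = p ^ a"
    "card (F (carrier S) (carrier S)) = p ^ a * m" "\<not> p dvd m" by (rule sylow_whole)
  have "transporter (carrier S) (carrier S) = carrier S"
    by (auto simp: transporter_def conj_image_carrier)
  then have "trace (carrier S) identity_biset = 1"
    using trace_single[OF mor_incl[OF subgroup_self] subgroup_self] card_S_pos by (simp add: identity_biset_def)
  then have "of_nat (card (carrier S)) = (\<Sum>\<psi>\<in>F (carrier S) (carrier S). mark SS (twisted_diagonal (carrier S) \<psi>) identity_biset)"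
    using card_S_pos by (simp add: trace_def field_simps)
  also have "\<dots> = (\<Sum>\<psi>\<in>F (carrier S) (carrier S). if \<psi> \<in> Aut_S (carrier S) then ?x else 0)"
    by (intro sum.cong refl mark_identity_biset)
  also have "\<dots> = of_nat (p ^ a) * ?x"
    using finite_F[OF subgroup_self] a(1,2) by (simp add: sum.If_cases Int_absorb1)
  finally have S: "of_nat (card (carrier S)) = of_nat (p ^ a) * ?x" .
  have "trace (carrier S) f = of_nat (p ^ a * m) * ?x / of_nat (card (carrier S))"
    unfolding trace_stable[OF st subgroup_self] eq F_card_def a(3) ..
  moreover have "of_nat (p ^ a) * ?x \<noteq> 0" unfolding S[symmetric] by (rule less_imp_neq[OF card_S_pos, symmetric])
  then have "(of_nat (p ^ a) :: rat) \<noteq> 0" "?x \<noteq> 0" unfolding mult_eq_0_iff by blast+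
  ultimately have "trace (carrier S) f = of_nat m" unfolding S of_nat_mult by (auto split: if_splits)
  then show thesis using that a(4) by blast
qed

text \<open>The traces of the stabilized element \<open>f\<close> are congruent modulo \<open>p\<close> to its trace at \<open>S\<close>, hence units. Pull them
back along the second projection, invert them in the ring of mark functions of \<open>S \<times> S\<close>, and multiply.\<close>

theorem characteristic_idempotent_exists:
  "\<exists>f\<in>carrier (gset_ring p SS). \<forall>D. subgroup D SS \<longrightarrow> mark SS D f = char_mark D"
proof -
  obtain f where f: "f \<in> carrier (gset_ring p SS)" and gen: "fgen f" and "stable_above 0 f"
    and eq: "mark SS diagonal_S f = mark SS diagonal_S identity_biset"
    using stabilization[of "card (carrier S)"] by auto
  then have st: "fstable f" using stable_above_zero by blast
  obtain m where m: "\<not> p dvd m" "trace (carrier S) f = of_nat m" by (rule trace_whole[OF st eq])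
  obtain u where u: "u \<in> carrier (gset_ring p S)" "\<And>Q. subgroup Q S \<Longrightarrow> mark S Q u = trace Q f"
    using trace_mark_function[OF f gen] by blast
  have unit: "trace Q f \<noteq> 0 \<and> 1 / trace Q f \<in> Z_loc p" if Q: "subgroup Q S" for Q
  proof -
    obtain i where i: "card Q = p ^ i" using subgroup_card_prime_power[OF Q] by blast
    obtain j where j: "card (carrier S) = p ^ j" using subgroup_card_prime_power[OF subgroup_self] by blast
    obtain r where r: "r \<in> Z_loc p" "mark S {\<one>} u = mark S Q u + of_nat p * r"
      by (rule p_group_mark_congruence[OF Q i u(1)])
    obtain s where s: "s \<in> Z_loc p" "mark S {\<one>} u = mark S (carrier S) u + of_nat p * s"
      by (rule p_group_mark_congruence[OF subgroup_self j u(1)])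
    have "trace Q f = of_nat m + of_nat p * (s - r)"
      using r(2) s(2) u(2)[OF Q] u(2)[OF subgroup_self] m(2) by (simp add: algebra_simps)
    then show ?thesis by (rule Z_loc_unit[OF prime m(1) Z_loc_diff[OF prime s(1) r(1)]])
  qed
  have snd_hom: "snd \<in> hom SS S" by (auto simp: hom_def mult_DirProd')
  let ?U = "\<lambda>D. trace (snd ` D) f"
  have U: "?U \<in> B.KG.mark_functions"
    unfolding B.KG.mark_functions_def
  proof (intro CollectI bexI allI impI)
    fix D assume D: "subgroup D SS"
    show "mark SS D (linear_ext (\<lambda>x. \<Union>X\<in>x. iso_class SS (gset_res snd X)) u) = ?U D"
      unfolding mark_res[OF u(1) B.KG.is_group snd_hom subgroup.subset[OF D]] by (rule u(2)[OF snd_image_subgroup[OF D]])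
  qed (rule res_formal[OF prime u(1) B.KG.is_group snd_hom])
  have U_unit: "?U D \<noteq> 0 \<and> 1 / ?U D \<in> Z_loc p" if "subgroup D SS" for D
    by (rule unit[OF snd_image_subgroup[OF that]])
  have "\<exists>v\<in>B.KG.mark_functions. \<forall>D. subgroup D SS \<longrightarrow> ?U D * v D = 1"
    by (rule B.KG.mark_functions_inverse[OF U U_unit]) blast+
  then obtain v where v: "v \<in> B.KG.mark_functions" "\<And>D. subgroup D SS \<Longrightarrow> ?U D * v D = 1" by blast
  have "(\<lambda>D. mark SS D f) \<in> B.KG.mark_functions" using f by (auto simp: B.KG.mark_functions_def)
  from B.KG.mark_functions_mult[OF this v(1)]
  obtain h where h: "h \<in> carrier (gset_ring p SS)" "\<And>D. subgroup D SS \<Longrightarrow> mark SS D h = mark SS D f * v D"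
    unfolding B.KG.mark_functions_def by blast
  have "mark SS D h = char_mark D" if D: "subgroup D SS" for D
  proof (cases "fdiag D")
    case False
    then show ?thesis using h(2)[OF D] gen D by (simp add: fgen_def char_mark_def)
  next
    case True
    then obtain Q \<psi> where Q: "mor Q \<psi>" "D = twisted_diagonal Q \<psi>" by (auto simp: fdiag_def)
    note Qs = mor_subgroup[OF Q(1)]
    have "mark SS D f = trace Q f * of_nat (card (carrier S)) / F_card Q"
      using trace_stable[OF st Qs] mark_stable_diagonal[OF st Q(1)] F_card_pos[OF Qs] card_S_pos Q(2)
      by (simp add: field_simps)
    then have "mark SS D h = (trace Q f * v D) * of_nat (card (carrier S)) / F_card Q" using h(2)[OF D] by simp
    also have "trace Q f * v D = 1" using v(2)[OF D] Q(2) by simp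
    finally show ?thesis using True Q(2) by (simp add: char_mark_def)
  qed
  then show ?thesis using h(1) by blast
qed

section \<open>The idempotents of the rings of stable elements\<close>

lemma char_mark_fgen:
  assumes "\<And>D. subgroup D SS \<Longrightarrow> mark SS D f = char_mark D" shows "fgen f"
  using assms by (simp add: fgen_def char_mark_def)

text \<open>Composition with \<open>\<psi>\<close> is a bijection between the sets of morphisms.\<close>

lemma F_card_image:
  assumes \<psi>: "mor Q \<psi>" shows "F_card (\<psi> ` Q) = F_card Q"
proof -
  note Q = mor_subgroup[OF \<psi>] and I = mor_image_subgroup[OF \<psi>]
  let ?i = "restrict (inv_into Q \<psi>) (\<psi> ` Q)"
  have i: "mor (\<psi> ` Q) ?i" by (rule mor_inverse'[OF \<psi>])
  have i\<psi>: "?i (\<psi> u) = u" if "u \<in> Q" for u using that mor_inj[OF \<psi>] by simp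
  have iQ: "?i ` \<psi> ` Q \<subseteq> Q" using i\<psi> by auto
  have "bij_betw (\<lambda>\<phi>. compose Q \<phi> \<psi>) (F (\<psi> ` Q) (carrier S)) (F Q (carrier S))"
  proof (rule bij_betw_byWitness[where f' = "\<lambda>\<phi>. compose (\<psi> ` Q) \<phi> ?i"])
    show "\<forall>\<phi>\<in>F (\<psi> ` Q) (carrier S). compose (\<psi> ` Q) (compose Q \<phi> \<psi>) ?i = \<phi>"
    proof
      fix \<phi> assume "\<phi> \<in> F (\<psi> ` Q) (carrier S)"
      then have "\<phi> \<in> extensional (\<psi> ` Q)" by (rule F_extensional[OF I subgroup_self])
      moreover have "compose (\<psi> ` Q) (compose Q \<phi> \<psi>) ?i w = \<phi> w" if "w \<in> \<psi> ` Q" for w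
        using that i\<psi> by (auto simp: compose_def)
      ultimately show "compose (\<psi> ` Q) (compose Q \<phi> \<psi>) ?i = \<phi>" by (intro extensionalityI[of _ "\<psi> ` Q"]) auto
    qed
    show "\<forall>\<phi>\<in>F Q (carrier S). compose Q (compose (\<psi> ` Q) \<phi> ?i) \<psi> = \<phi>"
    proof
      fix \<phi> assume "\<phi> \<in> F Q (carrier S)"
      then have "\<phi> \<in> extensional Q" by (rule F_extensional[OF Q subgroup_self])
      moreover have "compose Q (compose (\<psi> ` Q) \<phi> ?i) \<psi> w = \<phi> w" if "w \<in> Q" for w
        using that i\<psi> by (auto simp: compose_def)
      ultimately show "compose Q (compose (\<psi> ` Q) \<phi> ?i) \<psi> = \<phi>" by (intro extensionalityI[of _ Q]) auto
    qed
    show "(\<lambda>\<phi>. compose Q \<phi> \<psi>) ` F (\<psi> ` Q) (carrier S) \<subseteq> F Q (carrier S)"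
      using mor_comp[OF \<psi>] I by (auto simp: mor_def)
    show "(\<lambda>\<phi>. compose (\<psi> ` Q) \<phi> ?i) ` F Q (carrier S) \<subseteq> F (\<psi> ` Q) (carrier S)"
      using mor_comp[OF i _ iQ] Q by (auto simp: mor_def)
  qed
  then show ?thesis unfolding F_card_def using bij_betw_same_card by metis
qed

lemma char_mark_fstable:
  assumes "\<And>D. subgroup D SS \<Longrightarrow> mark SS D f = char_mark D" shows "fstable f"
  unfolding fstable_def
proof (intro allI impI conjI)
  fix Q \<psi> E assume \<psi>: "mor Q \<psi>" and E: "subgroup E SS"
  have Ec: "E \<subseteq> carrier S \<times> carrier S" using subgroup.subset[OF E] by simp
  note i = mor_incl[OF subgroup_self]
  have img: "subgroup ((\<lambda>(a, b). (\<chi> a, \<eta> b)) ` E) SS" if "mor M \<chi>" "mor N \<eta>" "E \<subseteq> M \<times> N" for M N \<chi> \<eta>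
    using group_hom.subgroup_img_is_subgroup[OF map_pair_hom(1)[OF that(1,2)] B.KG.subgroup_incl[OF E map_pair_hom(2)[OF that(1,2)] that(3)]] .
  {
    assume sub: "snd ` E \<subseteq> Q"
    let ?E = "(\<lambda>(a, b). (a, \<psi> b)) ` E"
    have "?E = (\<lambda>(a, b). ((\<lambda>u\<in>carrier S. u) a, \<psi> b)) ` E" using Ec by (intro image_cong) auto
    moreover have "E \<subseteq> carrier S \<times> Q" using Ec sub by (auto simp: image_subset_iff)
    ultimately have E': "subgroup ?E SS" using img[OF i \<psi>] by simp
    have "snd ` ?E = restrict \<psi> (snd ` E) ` (snd ` E)" by (auto simp: image_image case_prod_unfold)
    then have "F_card (snd ` ?E) = F_card (snd ` E)"
      using F_card_image[OF mor_restrict[OF \<psi> snd_image_subgroup[OF E] sub]] by simp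
    then show "mark SS ?E f = mark SS E f"
      unfolding assms[OF E] assms[OF E'] char_mark_def fdiag_snd_map_iff[OF \<psi> sub] by simp
  next
    assume sub: "fst ` E \<subseteq> Q"
    let ?E = "(\<lambda>(a, b). (\<psi> a, b)) ` E"
    have "?E = (\<lambda>(a, b). (\<psi> a, (\<lambda>u\<in>carrier S. u) b)) ` E" using Ec by (intro image_cong) auto
    moreover have "E \<subseteq> Q \<times> carrier S" using Ec sub by (auto simp: image_subset_iff)
    ultimately have E': "subgroup ?E SS" using img[OF \<psi> i] by simp
    have "snd ` ?E = snd ` E" by (auto simp: image_image case_prod_unfold)
    then show "mark SS ?E f = mark SS E f"
      unfolding assms[OF E] assms[OF E'] char_mark_def fdiag_fst_map_iff[OF \<psi> sub] by simp
  }
qed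

lemma char_mark_idempotent:
  assumes f: "f \<in> carrier (gset_ring p SS)" and marks: "\<And>D. subgroup D SS \<Longrightarrow> mark SS D f = char_mark D"
    and D: "subgroup D SS"
  shows "mark SS D (biset_mult S S S f f) = mark SS D f"
proof -
  have gen: "fgen f" by (rule char_mark_fgen) (rule marks)
  have st: "fstable f" by (rule char_mark_fstable) (rule marks)
  have Q: "subgroup (snd ` D) S" by (rule snd_image_subgroup[OF D])
  have "trace (snd ` D) f = 1"
    unfolding trace_stable[OF st Q] marks[OF twisted_diagonal_subgroup[OF mor_incl[OF Q]]]
    using F_card_pos[OF Q] card_S_pos fdiagI[OF mor_incl[OF Q]] by (simp add: char_mark_def)
  then show ?thesis using mark_composition[OF f st f gen D] by simp
qed

text \<open>The trivial subgroup has a single morphism to \<open>S\<close>, so \<open>char_mark\<close> has the value \<open>|S|\<close> there.\<close>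

lemma trivial_fdiag: "fdiag {\<one>\<^bsub>SS\<^esub>}" "snd ` {\<one>\<^bsub>SS\<^esub>} = {\<one>}" "F_card {\<one>} = 1"
proof -
  note t = triv_subgroup
  have one: "\<psi> \<one> = \<one>" if \<psi>: "mor {\<one>} \<psi>" for \<psi>
    using group_hom.hom_one[OF mor_group_hom[OF \<psi>]] by simp
  have "twisted_diagonal {\<one>} (\<lambda>u\<in>{\<one>}. u) = {\<one>\<^bsub>SS\<^esub>}" by (auto simp: twisted_diagonal_def)
  then show "fdiag {\<one>\<^bsub>SS\<^esub>}" using fdiagI[OF mor_incl[OF t]] by simp
  show "snd ` {\<one>\<^bsub>SS\<^esub>} = {\<one>}" by simp
  have "F {\<one>} (carrier S) = {\<lambda>u\<in>{\<one>}. u}"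
  proof -
    have "\<psi> = (\<lambda>u\<in>{\<one>}. u)" if "\<psi> \<in> F {\<one>} (carrier S)" for \<psi>
      by (rule extensionalityI[of _ "{\<one>}"])
        (use that one[of \<psi>] F_extensional[OF t subgroup_self that] t in \<open>auto simp: mor_def\<close>)
    then show ?thesis using mor_in[OF mor_incl[OF t]] by blast
  qed
  then show "F_card {\<one>} = 1" by (simp add: F_card_def)
qed

text \<open>All points are fixed by the trivial subgroup, so its mark counts them.\<close>

lemma augmentation_coset:
  assumes f: "f \<in> carrier (gset_ring p SS)"
  shows "augmentation S (burnside_coset p SS f) = mark SS {\<one>\<^bsub>SS\<^esub>} f / of_nat (card (carrier S))"
proof -
  let ?\<epsilon> = "\<lambda>h. \<Sum>x\<in>Poly_Mapping.keys h. Poly_Mapping.lookup h x * (of_nat (the_elem ((\<lambda>X. card (fst X)) ` x)) / of_nat (order S)) :: rat"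
  have "?\<epsilon> h = mark SS {\<one>\<^bsub>SS\<^esub>} f / of_nat (card (carrier S))" if h: "h \<in> burnside_coset p SS f" for h
  proof -
    have hF: "h \<in> carrier (gset_ring p SS)" by (rule burnside_coset_formal[OF prime f h])
    have "of_nat (the_elem ((\<lambda>X. card (fst X)) ` x)) = class_weight SS (mark_weight {\<one>\<^bsub>SS\<^esub>}) x"
      if x: "x \<in> Poly_Mapping.keys h" for x
    proof -
      have "x \<in> iso_classes SS" using hF x by (auto simp: carrier_gset_ring)
      then obtain X :: "(_, nat) gset" where X: "is_gset SS X" "x = iso_class SS X" by (rule iso_class_repE)
      have "(\<lambda>Y. card (fst Y)) ` x = {card (fst X)}"
      proof -
        have "card (fst Y) = card (fst X)" if "Y \<in> x" for Y
          using that bij_betw_same_card[of _ "fst X" "fst Y"] unfolding X(2) iso_class_iff gset_iso_def by auto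
        then have "(\<lambda>Y. card (fst Y)) ` x = (\<lambda>Y. card (fst X)) ` x" by (rule image_cong[OF refl])
        also have "\<dots> = {card (fst X)}" using iso_class_nonempty[OF X(1)] X(2) by (simp add: image_constant_conv)
        finally show ?thesis .
      qed
      moreover have "fixed_points {\<one>\<^bsub>SS\<^esub>} X = fst X" using is_gset_one[OF X(1)] unfolding fixed_points_def by blast
      moreover have "{\<one>\<^bsub>SS\<^esub>} \<subseteq> carrier SS" by simp
      ultimately show ?thesis
        unfolding X(2) class_weight_iso_class[OF X(1)] by (simp only: orbit_weight_mark[OF X(1)] the_elem_eq)
    qed
    then have "?\<epsilon> h = (\<Sum>x\<in>Poly_Mapping.keys h. Poly_Mapping.lookup h x * class_weight SS (mark_weight {\<one>\<^bsub>SS\<^esub>}) x) / of_nat (card (carrier S))"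
      unfolding sum_divide_distrib by (intro sum.cong) (auto simp: order_def)
    also have "\<dots> = mark SS {\<one>\<^bsub>SS\<^esub>} h / of_nat (card (carrier S))" by (simp add: mark_def burnside_weight_def lin_def)
    finally show ?thesis using B.KG.mark_coset[OF h] by simp
  qed
  then have "?\<epsilon> ` burnside_coset p SS f = (\<lambda>h. mark SS {\<one>\<^bsub>SS\<^esub>} f / of_nat (card (carrier S))) ` burnside_coset p SS f"
    by (rule image_cong[OF refl])
  also have "\<dots> = {mark SS {\<one>\<^bsub>SS\<^esub>} f / of_nat (card (carrier S))}"
    using burnside_coset_self[OF prime, of f SS] by blast
  finally have "?\<epsilon> ` burnside_coset p SS f = {mark SS {\<one>\<^bsub>SS\<^esub>} f / of_nat (card (carrier S))}" .
  then show ?thesis unfolding augmentation_def by simp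
qed

lemma mem_char_burnside_idempotents:
  "A \<in> idempotents (char_burnside p S F) \<longleftrightarrow> (\<exists>f\<in>carrier (gset_ring p SS). A = burnside_coset p SS f \<and> fgen f \<and> fstable f \<and>
    (\<forall>D. subgroup D SS \<longrightarrow> mark SS D (biset_mult S S S f f) = mark SS D f))"
proof -
  have "A \<otimes>\<^bsub>char_burnside p S F\<^esub> A = A \<longleftrightarrow> (\<forall>D. subgroup D SS \<longrightarrow> mark SS D (biset_mult S S S f f) = mark SS D f)"
    if f: "f \<in> carrier (gset_ring p SS)" and A: "A = burnside_coset p SS f" for f
    unfolding A using B.biset_comp_coset[OF f f]
      B.KG.burnside_coset_eq_iff_marks[OF B.biset_mult_formal[OF f f] f]
    by (simp add: char_burnside_def double_burnside_ring_def)
  moreover have "A \<in> carrier (char_burnside p S F) \<longleftrightarrow> (\<exists>f\<in>carrier (gset_ring p SS). A = burnside_coset p SS f \<and> fgen f \<and> fstable f)"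
    using biset_generated_iff biset_stable_iff
    by (auto simp: char_burnside_def double_burnside_ring_def carrier_burnside_ring[OF prime])
  ultimately show ?thesis unfolding idempotents_def by blast
qed

lemma zero_char_burnside: "\<zero>\<^bsub>char_burnside p S F\<^esub> = burnside_coset p SS 0"
  by (simp add: char_burnside_def double_burnside_ring_def zero_burnside_ring[OF prime])

theorem unique_nonzero_idempotent:
  "\<exists>!\<omega>. \<omega> \<in> idempotents (char_burnside p S F) \<and> \<omega> \<noteq> \<zero>\<^bsub>char_burnside p S F\<^esub>"
proof -
  obtain e where e: "e \<in> carrier (gset_ring p SS)" "\<And>D. subgroup D SS \<Longrightarrow> mark SS D e = char_mark D"
    using characteristic_idempotent_exists by blast
  have triv: "subgroup {\<one>\<^bsub>SS\<^esub>} SS" by (rule B.KG.triv_subgroup)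
  have "char_mark {\<one>\<^bsub>SS\<^esub>} = of_nat (card (carrier S))" using trivial_fdiag by (simp add: char_mark_def)
  then have "mark SS {\<one>\<^bsub>SS\<^esub>} e \<noteq> mark SS {\<one>\<^bsub>SS\<^esub>} 0" using e(2)[OF triv] card_S_pos by simp
  then have "burnside_coset p SS e \<noteq> burnside_coset p SS 0"
    unfolding B.KG.burnside_coset_eq_iff_marks[OF e(1) formal_zero[OF prime]] using triv by blast
  moreover have "burnside_coset p SS e \<in> idempotents (char_burnside p S F)"
    unfolding mem_char_burnside_idempotents
    using e(1) char_mark_fgen[OF e(2)] char_mark_fstable[OF e(2)] char_mark_idempotent[OF e] by blast
  moreover have "\<omega> = burnside_coset p SS e"
    if \<omega>: "\<omega> \<in> idempotents (char_burnside p S F)" "\<omega> \<noteq> burnside_coset p SS 0" for \<omega>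
  proof -
    obtain f where f: "f \<in> carrier (gset_ring p SS)" "\<omega> = burnside_coset p SS f" "fgen f" "fstable f"
      "\<And>D. subgroup D SS \<Longrightarrow> mark SS D (biset_mult S S S f f) = mark SS D f"
      using \<omega>(1) unfolding mem_char_burnside_idempotents by blast
    have "\<not> (\<forall>D. subgroup D SS \<longrightarrow> mark SS D f = 0)"
      using \<omega>(2) B.KG.burnside_coset_eq_iff_marks[OF f(1) formal_zero[OF prime]] f(2) by simp
    then have "\<forall>D. subgroup D SS \<longrightarrow> mark SS D f = char_mark D"
      using characteristic_idempotent_marks[OF f(1,3,4,5)] by blast
    then have "\<forall>D. subgroup D SS \<longrightarrow> mark SS D f = mark SS D e" using e(2) by simp
    then show ?thesis using B.KG.burnside_coset_eq_iff_marks[OF f(1) e(1)] f(2) by simp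
  qed
  ultimately show ?thesis unfolding zero_char_burnside by blast
qed

text \<open>A nonzero idempotent has augmentation \<open>1\<close>, by the value of \<open>char_mark\<close> at the trivial subgroup; the
augmentation of \<open>0\<close> is not invertible.\<close>

lemma characteristic_iff_nonzero:
  "\<omega> \<in> idempotents (double_burnside_ring p S) \<and> biset_characteristic p S F \<omega> \<longleftrightarrow>
    \<omega> \<in> idempotents (char_burnside p S F) \<and> \<omega> \<noteq> \<zero>\<^bsub>char_burnside p S F\<^esub>"
proof
  assume \<omega>: "\<omega> \<in> idempotents (double_burnside_ring p S) \<and> biset_characteristic p S F \<omega>"
  then have "\<omega> \<in> idempotents (char_burnside p S F)"
    by (auto simp: idempotents_def char_burnside_def biset_characteristic_def)
  moreover have "\<omega> \<noteq> burnside_coset p SS 0"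
  proof
    assume "\<omega> = burnside_coset p SS 0"
    then have "augmentation S \<omega> = 0" using augmentation_coset[OF formal_zero[OF prime]] by simp
    then show False using \<omega> by (simp add: biset_characteristic_def)
  qed
  ultimately show "\<omega> \<in> idempotents (char_burnside p S F) \<and> \<omega> \<noteq> \<zero>\<^bsub>char_burnside p S F\<^esub>"
    by (simp add: zero_char_burnside)
next
  assume \<omega>: "\<omega> \<in> idempotents (char_burnside p S F) \<and> \<omega> \<noteq> \<zero>\<^bsub>char_burnside p S F\<^esub>"
  then obtain f where f: "f \<in> carrier (gset_ring p SS)" "\<omega> = burnside_coset p SS f" "fgen f" "fstable f"
      "\<And>D. subgroup D SS \<Longrightarrow> mark SS D (biset_mult S S S f f) = mark SS D f"
    unfolding mem_char_burnside_idempotents by blast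
  have "\<not> (\<forall>D. subgroup D SS \<longrightarrow> mark SS D f = 0)"
    using \<omega> B.KG.burnside_coset_eq_iff_marks[OF f(1) formal_zero[OF prime]] f(2) by (simp add: zero_char_burnside)
  then have "mark SS {\<one>\<^bsub>SS\<^esub>} f = char_mark {\<one>\<^bsub>SS\<^esub>}"
    using characteristic_idempotent_marks[OF f(1,3,4,5)] B.KG.triv_subgroup by blast
  also have "\<dots> = of_nat (card (carrier S))" using trivial_fdiag by (simp add: char_mark_def)
  finally have "augmentation S \<omega> = 1" unfolding f(2) augmentation_coset[OF f(1)] using card_S_pos by simp
  then have "biset_characteristic p S F \<omega>"
    unfolding biset_characteristic_def f(2) biset_generated_iff[OF f(1)] biset_stable_iff[OF f(1)]
    using f(3,4) Z_loc_1[OF prime] by auto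
  moreover have "\<omega> \<in> idempotents (double_burnside_ring p S)"
    using \<omega> by (auto simp: idempotents_def char_burnside_def)
  ultimately show "\<omega> \<in> idempotents (double_burnside_ring p S) \<and> biset_characteristic p S F \<omega>" by blast
qed

lemma burnside_res_coset:
  assumes f: "f \<in> carrier (gset_ring p S)" and P: "subgroup P S" and \<phi>: "\<phi> \<in> hom (sub P) S"
  shows "burnside_res p (sub P) \<phi> (burnside_coset p S f) =
    burnside_coset p (sub P) (linear_ext (\<lambda>x. \<Union>X\<in>x. iso_class (sub P) (gset_res \<phi> X)) f)"
proof -
  interpret P: local_burnside "sub P" p by (rule local_burnside_subgroup[OF P])
  show ?thesis
    unfolding burnside_res_def
  proof (rule UN_burnside_coset[OF prime])
    fix g assume g: "g \<in> burnside_coset p S f"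
    note gF = burnside_coset_formal[OF prime f g]
    show "burnside_coset p (sub P) (linear_ext (\<lambda>x. \<Union>X\<in>x. iso_class (sub P) (gset_res \<phi> X)) g) =
        burnside_coset p (sub P) (linear_ext (\<lambda>x. \<Union>X\<in>x. iso_class (sub P) (gset_res \<phi> X)) f)"
      unfolding P.burnside_coset_eq_iff_marks[OF res_formal[OF prime gF P.is_group \<phi>] res_formal[OF prime f P.is_group \<phi>]]
      using mark_res[OF gF P.is_group \<phi> subgroup.subset] mark_res[OF f P.is_group \<phi> subgroup.subset] mark_coset[OF g] by simp
  qed
qed

lemma one_burnside_ring: "\<one>\<^bsub>burnside_ring p S\<^esub> = burnside_coset p S (Poly_Mapping.single point_class 1)"
  by (simp add: burnside_ring_def FactRing_def burnside_coset_def point_class_def gset_ring_def)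

text \<open>The marks of a restriction are marks of the original element.\<close>

lemma constant_marks_stable:
  assumes f: "f \<in> carrier (gset_ring p S)" and const: "\<And>E. E \<subseteq> carrier S \<Longrightarrow> mark S E f = c"
  shows "burnside_coset p S f \<in> carrier (stable_burnside p S F)"
proof -
  have "burnside_res p (sub P) \<phi> (burnside_coset p S f) = burnside_res p (sub P) (\<lambda>u. u) (burnside_coset p S f)"
    if P: "subgroup P S" and \<phi>: "\<phi> \<in> F P (carrier S)" for P \<phi>
  proof -
    interpret P: local_burnside "sub P" p by (rule local_burnside_subgroup[OF P])
    have m: "\<phi> \<in> hom (sub P) S" using mor_hom P \<phi> by (simp add: mor_def)
    have i: "(\<lambda>u. u) \<in> hom (sub P) S" using subgroup.subset[OF P] by (auto simp: hom_def)
    have im: "\<chi> ` E \<subseteq> carrier S" if "\<chi> \<in> hom (sub P) S" "subgroup E (sub P)" for \<chi> E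
      using that subgroup.subset[OF that(2)] by (auto simp: hom_def)
    show ?thesis
      unfolding burnside_res_coset[OF f P m] burnside_res_coset[OF f P i]
        P.burnside_coset_eq_iff_marks[OF res_formal[OF prime f P.is_group m] res_formal[OF prime f P.is_group i]]
      using mark_res[OF f P.is_group m subgroup.subset] mark_res[OF f P.is_group i subgroup.subset]
        const[OF im[OF m]] const[OF im[OF i]] by simp
  qed
  then show ?thesis using f by (auto simp: stable_burnside_def carrier_burnside_ring[OF prime])
qed

theorem stable_burnside_idempotents:
  "idempotents (stable_burnside p S F) = {\<zero>\<^bsub>stable_burnside p S F\<^esub>, \<one>\<^bsub>stable_burnside p S F\<^esub>}"
proof -
  let ?o = "Poly_Mapping.single point_class 1"
  have o: "?o \<in> carrier (gset_ring p S)" by (rule formal_single[OF prime point_class_in Z_loc_1[OF prime]])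
  have z: "0 \<in> carrier (gset_ring p S)" by (rule formal_zero[OF prime])
  have mo: "mark S D ?o = 1" if "subgroup D S" for D using mark_point[OF subgroup.subset[OF that]] .
  have zero: "\<zero>\<^bsub>stable_burnside p S F\<^esub> = burnside_coset p S 0"
    by (simp add: stable_burnside_def zero_burnside_ring[OF prime])
  have one: "\<one>\<^bsub>stable_burnside p S F\<^esub> = burnside_coset p S ?o"
    by (simp add: stable_burnside_def one_burnside_ring)
  have idem: "burnside_coset p S f \<otimes>\<^bsub>stable_burnside p S F\<^esub> burnside_coset p S f = burnside_coset p S f \<longleftrightarrow>
      (\<forall>D. subgroup D S \<longrightarrow> mark S D f * mark S D f = mark S D f)"
    if f: "f \<in> carrier (gset_ring p S)" for f
    using mult_burnside_ring[OF f f] burnside_coset_eq_iff_marks[OF mult_formal[OF prime f f] f] mark_mult[OF f f subgroup.subset]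
    by (simp add: stable_burnside_def)
  have "burnside_coset p S 0 \<in> idempotents (stable_burnside p S F)"
    using constant_marks_stable[OF z, of 0] idem[OF z] by (simp add: idempotents_def)
  moreover have "burnside_coset p S ?o \<in> idempotents (stable_burnside p S F)"
    using constant_marks_stable[OF o mark_point] idem[OF o] mo by (simp add: idempotents_def)
  moreover have "A \<in> {burnside_coset p S 0, burnside_coset p S ?o}" if A: "A \<in> idempotents (stable_burnside p S F)" for A
  proof -
    have "A \<in> carrier (burnside_ring p S)" using A by (simp add: idempotents_def stable_burnside_def)
    then obtain f where f: "f \<in> carrier (gset_ring p S)" "A = burnside_coset p S f"
      unfolding carrier_burnside_ring[OF prime] by blast
    have "\<And>D. subgroup D S \<Longrightarrow> mark S D f * mark S D f = mark S D f"
      using A idem[OF f(1)] f(2) by (simp add: idempotents_def)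
    moreover obtain n where "order S = p ^ n" using order_power by blast
    ultimately consider "\<forall>D. subgroup D S \<longrightarrow> mark S D f = 0" | "\<forall>D. subgroup D S \<longrightarrow> mark S D f = 1"
      using p_group_idempotent_marks[OF _ f(1)] by metis
    then show ?thesis
    proof cases
      case 1
      then have "A = burnside_coset p S 0" unfolding f(2) burnside_coset_eq_iff_marks[OF f(1) z] by simp
      then show ?thesis by simp
    next
      case 2
      then have "A = burnside_coset p S ?o"
        unfolding f(2) burnside_coset_eq_iff_marks[OF f(1) o] using mo by simp
      then show ?thesis by simp
    qed
  qed
  ultimately show ?thesis unfolding zero one by blast
qed

lemma one_stable_burnside: "\<one>\<^bsub>stable_burnside p S F\<^esub> = burnside_class p S (coset_gset S (carrier S))"
  by (simp add: stable_burnside_def one_burnside_ring burnside_class_def point_class_def)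

end

theorem corollary6p6:
  fixes S :: "'a monoid" and p :: nat and F :: "'a set \<Rightarrow> 'a set \<Rightarrow> ('a \<Rightarrow> 'a) set"
  assumes "saturated_fusion_system S p F"
  shows "\<one>\<^bsub>stable_burnside p S F\<^esub> = burnside_class p S (coset_gset S (carrier S)) \<and>
    idempotents (stable_burnside p S F) =
      {\<zero>\<^bsub>stable_burnside p S F\<^esub>, \<one>\<^bsub>stable_burnside p S F\<^esub>} \<and>
    (\<exists>!\<omega>. \<omega> \<in> idempotents (char_burnside p S F) \<and> \<omega> \<noteq> \<zero>\<^bsub>char_burnside p S F\<^esub>) \<and>
    (\<exists>!\<omega>. \<omega> \<in> idempotents (double_burnside_ring p S) \<and> biset_characteristic p S F \<omega>)"
proof -
  interpret saturated_fusion_system S p F by fact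
  show ?thesis
    unfolding characteristic_iff_nonzero
    using one_stable_burnside stable_burnside_idempotents unique_nonzero_idempotent by blast
qed

end
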